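(* The theory $\mathrm{RCA}_0^{\Omega}+\mathrm{STP}$ proves the equivalences $$\Sigma^0_1\text{-DET}^{*}\leftrightarrow\mathrm{U}\Sigma^0_1\text{-DET}^{\mathrm{st}}\leftrightarrow(S^2)^{\mathrm{st}}.$$
   Context: BASE THEORY. Finite types: $0$ (natural numbers), $\sigma\to\tau$, and $\sigma^{*}$ (finite sequences of objects of type $\sigma$); $1=0\to 0$, $2=1\to 0$, $3=2\to 0$. Superscripts indicate types; tuples are coded as single objects where convenient. Equality $=_0$ is primitive; for $\tau=\tau_1\to\dots\to\tau_k\to 0$, $x=_\tau y$ means $(\forall z_1\dots z_k)(xz_1\dots z_k=_0 yz_1\dots z_k)$. $\mathrm{RCA}_0^{\omega}$ is Kohlenbach's higher-order base theory: classical arithmetic in all finite types with combinators, zero, successor, the recursor $R_0$ (primitive recursion with type $0$ values), quantifier-free induction, extensionality $x=_\rho y\to\varphi(x)=_\tau\varphi(y)$ for all $\varphi^{\rho\to\tau}$, and $\mathrm{QF\text{-}AC}^{1,0}$, where $\mathrm{QF\text{-}AC}^{\sigma,\tau}$ is $(\forall x^\sigma)(\exists y^\tau)A_0(x,y)\to(\exists F^{\sigma\to\tau})(\forall x)A_0(x,F(x))$ for quantifier-free $A_0$. $\mathrm{RCA}_0^{\Omega}$ extends $\mathrm{RCA}_0^{\omega}$ (with the types $\sigma^*$) by a predicate $\mathrm{st}$ ("is standard") for each type. A formula is internal if it does not contain $\mathrm{st}$; $(\forall^{\mathrm{st}}x)A$ is $(\forall x)(\mathrm{st}(x)\to A)$,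 $(\exists^{\mathrm{st}}x)A$ is $(\exists x)(\mathrm{st}(x)\wedge A)$; $N\in\Omega$ means $\neg\mathrm{st}(N^0)$; $A^{\mathrm{st}}$ is $A$ with all quantifiers (except bounded number quantifiers) relativised to $\mathrm{st}$. Axioms: (i) standardness respects equality, closed terms are standard, a standard functional applied to a standard object is standard, and numbers below a standard number are standard; (ii) Idealization: $(\forall^{\mathrm{st}}x^{\sigma^*})(\exists y^\tau)(\forall z\in x)\varphi(z,y)\to(\exists y)(\forall^{\mathrm{st}}z^{\sigma})\varphi(z,y)$ for internal $\varphi$; (iii) $\mathrm{HAC}_{\mathrm{int}}$: $(\forall^{\mathrm{st}}x^{\rho})(\exists^{\mathrm{st}}y^{\tau})\varphi(x,y)\to(\exists^{\mathrm{st}}\Phi^{\rho\to\tau^*})(\forall^{\mathrm{st}}x)(\exists y\in\Phi(x))\varphi(x,y)$ for internal $\varphi$; (iv) $\mathrm{PF\text{-}TP}_\forall$: $(\forall^{\mathrm{st}}x^\tau)\varphi(x)\to(\forall x^\tau)\varphi(x)$ for internal $\varphi(x)$ with no parameters other than $x$; (v) for certain functionals uniquely specified by a parameter-free internal formula $D$ (e.g. the Suslin functional in $(S^2)$), a constant $\Xi_0$ with the axiom $\mathrm{st}(\Xi_0)\wedge(\forall^{\mathrm{st}}\Xi)[D^{\mathrm{st}}(\Xi)\to \Xi_0$ and $\Xi$ agree on all standard inputs$]$; these constants do not count as parameters in (iv). NOTATION. $\overline{h}k$ is the (code of the) initial segment of $h$ of length $k$. Sets $X^1$ are given by characteristic functions.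 A strategy for player 0 is a function $S_0$ from finite sequences of natural numbers of even length to $\mathbb{N}$; a strategy for player 1 is a function $S_1$ from finite sequences of odd length to $\mathbb{N}$ (both coded as type $1$ objects). $S_0\otimes S_1$ is the resulting play, i.e. the unique $h^1$ with $h(2n)=S_0(\overline{h}(2n))$ and $h(2n+1)=S_1(\overline{h}(2n+1))$ for all $n$. Let $\varphi(h^1,f^1)\equiv(\exists k^0)f(\overline{h}k)=0$. PRINCIPLES. $\mathrm{STP}$: $(\forall X^1)(\exists^{\mathrm{st}}Y^1)(\forall^{\mathrm{st}}x^0)(x\in X\leftrightarrow x\in Y)$. $(S^2)$: $(\exists S^2)(\forall f^1)[S(f)=_00\leftrightarrow(\exists g^1)(\forall x^0)(f(\overline{g}x)\neq0)]$. $\Sigma^0_1\text{-DET}$: $(\forall f^1)\big[(\exists S_0)(\forall S_1)\varphi(S_0\otimes S_1,f)\vee(\exists S_1)(\forall S_0)\neg\varphi(S_0\otimes S_1,f)\big]$. $\Sigma^0_1\text{-DET}^*$: $\Sigma^0_1\text{-DET}^{\mathrm{st}}$ without '$\mathrm{st}$' in the innermost $\Pi^1_1$-formulas, i.e. $(\forall^{\mathrm{st}}f^1)\big[(\exists^{\mathrm{st}}S_0)(\forall S_1)\varphi(S_0\otimes S_1,f)\vee(\exists^{\mathrm{st}}S_1)(\forall S_0)\neg\varphi(S_0\otimes S_1,f)\big]$. $\mathrm{U}\Sigma^0_1\text{-DET}$: $(\exists\Phi^{1\to(1\times1)})(\forall f^1)\big[(\forall S_1)\varphi(\Phi(f)(1)\otimes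 S_1,f)\vee(\forall S_0)\neg\varphi(S_0\otimes\Phi(f)(2),f)\big]$, where $\Phi(f)(1),\Phi(f)(2)$ are the two components of $\Phi(f)$. *)

theory Defs
  imports Main
begin

text \<open>
  Deep embedding of Kohlenbach's \<open>RCA\<^sub>0\<^sup>\<omega>\<close> (with types of finite sequences) and of its nonstandard
  extension \<open>RCA\<^sub>0\<^sup>\<Omega>\<close>.  Variables are de Bruijn indices; a context lists the types of the free
  variables, index 0 first.
\<close>

section \<open>Types, terms, formulas\<close>

datatype ty = Nat | Fun ty ty (infixr "\<rightarrow>" 65) | Star ty

abbreviation ty1 :: ty where "ty1 \<equiv> Nat \<rightarrow> Nat"
abbreviation ty2 :: ty where "ty2 \<equiv> ty1 \<rightarrow> Nat"

text \<open>
  Finite sequences are introduced as a definitional extension: an object of type \<open>\<sigma>\<^sup>*\<close> is given by a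
  length and a function \<open>0 \<rightarrow> \<sigma>\<close>.  \<open>Seg \<sigma> n \<alpha>\<close> is the sequence \<open>\<langle>\<alpha>(0),\<dots>,\<alpha>(n-1)\<rangle>\<close>, \<open>Len \<sigma> s\<close> is \<open>|s|\<close>
  and \<open>Ent \<sigma> s i\<close> is the entry \<open>s\<^sub>i\<close>.  The usual constructors are definable from these.

  \<open>Xi i \<tau>\<close> is the \<open>i\<close>-th of the symbols of type \<open>\<tau>\<close> that are available for functionals specified by
  a formula; which of them are in the language is fixed by \<open>specs\<close> below.
\<close>

datatype cst =
    Zero | Succ | Rec
  | KC ty ty | SC ty ty ty
  | Len ty | Ent ty | Seg ty
  | Xi nat ty

primrec cty :: "cst \<Rightarrow> ty" where
  "cty Zero = Nat"
| "cty Succ = Nat \<rightarrow> Nat"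
| "cty Rec = Nat \<rightarrow> Nat \<rightarrow> (Nat \<rightarrow> Nat \<rightarrow> Nat) \<rightarrow> Nat"
| "cty (KC \<sigma> \<tau>) = \<sigma> \<rightarrow> \<tau> \<rightarrow> \<sigma>"
| "cty (SC \<rho> \<sigma> \<tau>) = (\<rho> \<rightarrow> \<sigma> \<rightarrow> \<tau>) \<rightarrow> (\<rho> \<rightarrow> \<sigma>) \<rightarrow> \<rho> \<rightarrow> \<tau>"
| "cty (Len \<sigma>) = Star \<sigma> \<rightarrow> Nat"
| "cty (Ent \<sigma>) = Star \<sigma> \<rightarrow> Nat \<rightarrow> \<sigma>"
| "cty (Seg \<sigma>) = Nat \<rightarrow> (Nat \<rightarrow> \<sigma>) \<rightarrow> Star \<sigma>"
| "cty (Xi i \<tau>) = \<tau>"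

datatype tm = Var nat | Con cst | App tm tm (infixl "\<cdot>" 90)

datatype fm =
    Eq tm tm (infix "\<doteq>" 60)
  | St ty tm
  | Bot
  | Imp fm fm (infixr "\<^bold>\<longrightarrow>" 45)
  | All ty fm

abbreviation Neg :: "fm \<Rightarrow> fm" ("\<^bold>\<not> _" [55] 55) where
  "\<^bold>\<not> A \<equiv> A \<^bold>\<longrightarrow> Bot"
abbreviation Conj :: "fm \<Rightarrow> fm \<Rightarrow> fm" (infixr "\<^bold>\<and>" 52) where
  "A \<^bold>\<and> B \<equiv> \<^bold>\<not> (A \<^bold>\<longrightarrow> \<^bold>\<not> B)"
abbreviation Disj :: "fm \<Rightarrow> fm \<Rightarrow> fm" (infixr "\<^bold>\<or>" 50) where
  "A \<^bold>\<or> B \<equiv> \<^bold>\<not> A \<^bold>\<longrightarrow> B"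
abbreviation Iff :: "fm \<Rightarrow> fm \<Rightarrow> fm" (infix "\<^bold>\<longleftrightarrow>" 44) where
  "A \<^bold>\<longleftrightarrow> B \<equiv> (A \<^bold>\<longrightarrow> B) \<^bold>\<and> (B \<^bold>\<longrightarrow> A)"
abbreviation Ex :: "ty \<Rightarrow> fm \<Rightarrow> fm" where
  "Ex \<tau> A \<equiv> \<^bold>\<not> All \<tau> (\<^bold>\<not> A)"
abbreviation AllSt :: "ty \<Rightarrow> fm \<Rightarrow> fm" where
  "AllSt \<tau> A \<equiv> All \<tau> (St \<tau> (Var 0) \<^bold>\<longrightarrow> A)"
abbreviation ExSt :: "ty \<Rightarrow> fm \<Rightarrow> fm" where
  "ExSt \<tau> A \<equiv> Ex \<tau> (St \<tau> (Var 0) \<^bold>\<and> A)"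

type_synonym ctx = "ty list"

fun ty_of :: "ctx \<Rightarrow> tm \<Rightarrow> ty option" where
  "ty_of \<Gamma> (Var n) = (if n < length \<Gamma> then Some (\<Gamma> ! n) else None)"
| "ty_of \<Gamma> (Con c) = Some (cty c)"
| "ty_of \<Gamma> (t \<cdot> u) = (case ty_of \<Gamma> t of
       Some (\<sigma> \<rightarrow> \<tau>) \<Rightarrow> (if ty_of \<Gamma> u = Some \<sigma> then Some \<tau> else None)
     | _ \<Rightarrow> None)"

text \<open>
  \<open>\<D> (i, \<tau>) = Some D\<close> means that \<open>Xi i \<tau>\<close> belongs to the language and that \<open>D\<close>, a formula whose
  only free variable is \<open>Var 0\<close> of type \<open>\<tau>\<close>, is its specification.
\<close>

type_synonym specs = "nat \<times> ty \<Rightarrow> fm option"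

fun in_lang :: "specs \<Rightarrow> tm \<Rightarrow> bool" where
  "in_lang \<D> (Var n) \<longleftrightarrow> True"
| "in_lang \<D> (Con (Xi i \<tau>)) \<longleftrightarrow> \<D> (i, \<tau>) \<noteq> None"
| "in_lang \<D> (Con c) \<longleftrightarrow> True"
| "in_lang \<D> (t \<cdot> u) \<longleftrightarrow> in_lang \<D> t \<and> in_lang \<D> u"

definition wt :: "specs \<Rightarrow> ctx \<Rightarrow> tm \<Rightarrow> ty \<Rightarrow> bool" where
  "wt \<D> \<Gamma> t \<tau> \<longleftrightarrow> ty_of \<Gamma> t = Some \<tau> \<and> in_lang \<D> t"

primrec wf_fm :: "specs \<Rightarrow> ctx \<Rightarrow> fm \<Rightarrow> bool" where
  "wf_fm \<D> \<Gamma> (t \<doteq> u) \<longleftrightarrow> wt \<D> \<Gamma> t Nat \<and> wt \<D> \<Gamma> u Nat"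
| "wf_fm \<D> \<Gamma> (St \<tau> t) \<longleftrightarrow> wt \<D> \<Gamma> t \<tau>"
| "wf_fm \<D> \<Gamma> Bot \<longleftrightarrow> True"
| "wf_fm \<D> \<Gamma> (A \<^bold>\<longrightarrow> B) \<longleftrightarrow> wf_fm \<D> \<Gamma> A \<and> wf_fm \<D> \<Gamma> B"
| "wf_fm \<D> \<Gamma> (All \<tau> A) \<longleftrightarrow> wf_fm \<D> (\<tau> # \<Gamma>) A"

primrec internal :: "fm \<Rightarrow> bool" where
  "internal (t \<doteq> u) \<longleftrightarrow> True"
| "internal (St \<tau> t) \<longleftrightarrow> False"
| "internal Bot \<longleftrightarrow> True"
| "internal (A \<^bold>\<longrightarrow> B) \<longleftrightarrow> internal A \<and> internal B"
| "internal (All \<tau> A) \<longleftrightarrow> internal A"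

primrec qfree :: "fm \<Rightarrow> bool" where
  "qfree (t \<doteq> u) \<longleftrightarrow> True"
| "qfree (St \<tau> t) \<longleftrightarrow> False"
| "qfree Bot \<longleftrightarrow> True"
| "qfree (A \<^bold>\<longrightarrow> B) \<longleftrightarrow> qfree A \<and> qfree B"
| "qfree (All \<tau> A) \<longleftrightarrow> False"

text \<open>
  The relativisation \<open>A\<^sup>s\<^sup>t\<close>.  There are no primitive bounded quantifiers; relativising a number
  quantifier with a standard bound is harmless since numbers below a standard number are standard.
\<close>

primrec rel :: "fm \<Rightarrow> fm" where
  "rel (t \<doteq> u) = (t \<doteq> u)"
| "rel (St \<tau> t) = St \<tau> t"
| "rel Bot = Bot"
| "rel (A \<^bold>\<longrightarrow> B) = (rel A \<^bold>\<longrightarrow> rel B)"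
| "rel (All \<tau> A) = AllSt \<tau> (rel A)"


section \<open>Parallel substitution\<close>

primrec tsub :: "(nat \<Rightarrow> tm) \<Rightarrow> tm \<Rightarrow> tm" where
  "tsub s (Var n) = s n"
| "tsub s (Con c) = Con c"
| "tsub s (t \<cdot> u) = tsub s t \<cdot> tsub s u"

abbreviation tlift :: "tm \<Rightarrow> tm" where
  "tlift \<equiv> tsub (\<lambda>n. Var (Suc n))"

definition up :: "(nat \<Rightarrow> tm) \<Rightarrow> nat \<Rightarrow> tm" where
  "up s = case_nat (Var 0) (\<lambda>n. tlift (s n))"

primrec fsub :: "(nat \<Rightarrow> tm) \<Rightarrow> fm \<Rightarrow> fm" where
  "fsub s (t \<doteq> u) = (tsub s t \<doteq> tsub s u)"
| "fsub s (St \<tau> t) = St \<tau> (tsub s t)"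
| "fsub s Bot = Bot"
| "fsub s (A \<^bold>\<longrightarrow> B) = (fsub s A \<^bold>\<longrightarrow> fsub s B)"
| "fsub s (All \<tau> A) = All \<tau> (fsub (up s) A)"

abbreviation flift :: "fm \<Rightarrow> fm" where
  "flift \<equiv> fsub (\<lambda>n. Var (Suc n))"

abbreviation inst :: "tm \<Rightarrow> fm \<Rightarrow> fm" where
  "inst t \<equiv> fsub (case_nat t Var)"


section \<open>Closed terms\<close>

primrec occurs0 :: "tm \<Rightarrow> bool" where
  "occurs0 (Var n) \<longleftrightarrow> n = 0"
| "occurs0 (Con c) \<longleftrightarrow> False"
| "occurs0 (t \<cdot> u) \<longleftrightarrow> occurs0 t \<or> occurs0 u"

text \<open>
  Bracket abstraction: if \<open>t\<close> is typed in \<open>\<sigma> # \<Gamma>\<close>, then \<open>lam \<Gamma> \<sigma> t\<close> is the combinatory term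
  for \<open>\<lambda>x\<^sup>\<sigma>. t\<close> over \<open>\<Gamma>\<close>.
\<close>

primrec lam :: "ctx \<Rightarrow> ty \<Rightarrow> tm \<Rightarrow> tm" where
  "lam \<Gamma> \<sigma> (Var n) = (case n of
       0 \<Rightarrow> Con (SC \<sigma> (\<sigma> \<rightarrow> \<sigma>) \<sigma>) \<cdot> Con (KC \<sigma> (\<sigma> \<rightarrow> \<sigma>)) \<cdot> Con (KC \<sigma> \<sigma>)
     | Suc m \<Rightarrow> Con (KC (\<Gamma> ! m) \<sigma>) \<cdot> Var m)"
| "lam \<Gamma> \<sigma> (Con c) = Con (KC (cty c) \<sigma>) \<cdot> Con c"
| "lam \<Gamma> \<sigma> (t \<cdot> u) =
     (if occurs0 (t \<cdot> u)
      then Con (SC \<sigma> (the (ty_of (\<sigma> # \<Gamma>) u)) (the (ty_of (\<sigma> # \<Gamma>) (t \<cdot> u))))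
             \<cdot> lam \<Gamma> \<sigma> t \<cdot> lam \<Gamma> \<sigma> u
      else Con (KC (the (ty_of (\<sigma> # \<Gamma>) (t \<cdot> u))) \<sigma>) \<cdot> tsub (\<lambda>n. Var (n - 1)) (t \<cdot> u))"

text \<open>
  \<open>lams \<Gamma> [\<sigma>\<^sub>1,\<dots>,\<sigma>\<^sub>k] t\<close> is \<open>\<lambda>x\<^sub>1\<dots>x\<^sub>k. t\<close>; in \<open>t\<close> the variable \<open>x\<^sub>k\<close> has index 0 and
  \<open>x\<^sub>1\<close> has index \<open>k-1\<close>.
\<close>

primrec lams :: "ctx \<Rightarrow> ty list \<Rightarrow> tm \<Rightarrow> tm" where
  "lams \<Gamma> [] t = t"
| "lams \<Gamma> (\<sigma> # \<sigma>s) t = lam \<Gamma> \<sigma> (lams (\<sigma> # \<Gamma>) \<sigma>s t)"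

abbreviation zero :: tm where "zero \<equiv> Con Zero"
abbreviation one :: tm where "one \<equiv> Con Succ \<cdot> Con Zero"

primrec zero_of :: "ty \<Rightarrow> tm" where
  "zero_of Nat = Con Zero"
| "zero_of (\<sigma> \<rightarrow> \<tau>) = Con (KC \<tau> \<sigma>) \<cdot> zero_of \<tau>"
| "zero_of (Star \<sigma>) = Con (Seg \<sigma>) \<cdot> Con Zero \<cdot> (Con (KC \<sigma> Nat) \<cdot> zero_of \<sigma>)"

definition predT :: tm where
  "predT = lams [] [Nat] (Con Rec \<cdot> Var 0 \<cdot> zero \<cdot> lams [Nat] [Nat, Nat] (Var 0))"

text \<open>Truncated subtraction.\<close>
definition subT :: tm where
  "subT = lams [] [Nat, Nat]
     (Con Rec \<cdot> Var 0 \<cdot> Var 1 \<cdot> lams [Nat, Nat] [Nat, Nat] (predT \<cdot> Var 1))"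

definition addT :: tm where
  "addT = lams [] [Nat, Nat]
     (Con Rec \<cdot> Var 0 \<cdot> Var 1 \<cdot> lams [Nat, Nat] [Nat, Nat] (Con Succ \<cdot> Var 1))"

text \<open>The triangular numbers \<open>0 + 1 + \<dots> + n\<close>.\<close>
definition triT :: tm where
  "triT = lams [] [Nat]
     (Con Rec \<cdot> Var 0 \<cdot> zero \<cdot> lams [Nat] [Nat, Nat] (Con Succ \<cdot> (addT \<cdot> Var 1 \<cdot> Var 0)))"

text \<open>Cantor pairing.\<close>
definition pairT :: tm where
  "pairT = lams [] [Nat, Nat] (addT \<cdot> (triT \<cdot> (addT \<cdot> Var 1 \<cdot> Var 0)) \<cdot> Var 0)"

text \<open>
  Finite sequences of numbers are coded by numbers: \<open>0\<close> codes the empty sequence and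
  \<open>\<langle>s, n\<rangle> + 1\<close> codes the extension by \<open>n\<close> of the sequence coded by \<open>s\<close>.  The coding is bijective.
\<close>
definition snocT :: tm where
  "snocT = lams [] [Nat, Nat] (Con Succ \<cdot> (pairT \<cdot> Var 1 \<cdot> Var 0))"

text \<open>\<open>initT h k\<close> is the code of \<open>\<langle>h(0),\<dots>,h(k-1)\<rangle>\<close>.\<close>
definition initT :: tm where
  "initT = lams [] [ty1, Nat]
     (Con Rec \<cdot> Var 0 \<cdot> zero
        \<cdot> lams [Nat, ty1] [Nat, Nat] (snocT \<cdot> Var 1 \<cdot> (Var 3 \<cdot> Var 0)))"

text \<open>\<open>condT n a b\<close> is \<open>a\<close> if \<open>n = 0\<close> and \<open>b\<close> otherwise.\<close>
definition condT :: tm where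
  "condT = lams [] [Nat, Nat, Nat]
     (Con Rec \<cdot> Var 2 \<cdot> Var 1 \<cdot> lams [Nat, Nat, Nat] [Nat, Nat] (Var 2))"

text \<open>\<open>parT n\<close> is \<open>0\<close> for even and \<open>1\<close> for odd \<open>n\<close>.\<close>
definition parT :: tm where
  "parT = lams [] [Nat]
     (Con Rec \<cdot> Var 0 \<cdot> zero \<cdot> lams [Nat] [Nat, Nat] (subT \<cdot> one \<cdot> Var 1))"

text \<open>
  \<open>posT S\<^sub>0 S\<^sub>1 n\<close> is the code of the first \<open>n\<close> moves of the play of \<open>S\<^sub>0\<close> against \<open>S\<^sub>1\<close>, so that
  \<open>playT S\<^sub>0 S\<^sub>1\<close> is \<open>S\<^sub>0 \<otimes> S\<^sub>1\<close>.  Strategies are arbitrary objects of type 1; only their values at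
  codes of sequences of the appropriate parity are used.
\<close>
definition posT :: tm where
  "posT = lams [] [ty1, ty1, Nat]
     (Con Rec \<cdot> Var 0 \<cdot> zero
        \<cdot> lams [Nat, ty1, ty1] [Nat, Nat]
            (snocT \<cdot> Var 1 \<cdot> (condT \<cdot> (parT \<cdot> Var 0) \<cdot> (Var 4 \<cdot> Var 1) \<cdot> (Var 3 \<cdot> Var 1))))"

definition playT :: tm where
  "playT = lams [] [ty1, ty1, Nat]
     (condT \<cdot> (parT \<cdot> Var 0)
        \<cdot> (Var 2 \<cdot> (posT \<cdot> Var 2 \<cdot> Var 1 \<cdot> Var 0))
        \<cdot> (Var 1 \<cdot> (posT \<cdot> Var 2 \<cdot> Var 1 \<cdot> Var 0)))"


section \<open>Order and extensional equality\<close>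

definition lt :: "tm \<Rightarrow> tm \<Rightarrow> fm" where
  "lt t u = (subT \<cdot> (Con Succ \<cdot> t) \<cdot> u \<doteq> zero)"

primrec eq :: "ty \<Rightarrow> tm \<Rightarrow> tm \<Rightarrow> fm" where
  "eq Nat t u = (t \<doteq> u)"
| "eq (\<sigma> \<rightarrow> \<tau>) t u = All \<sigma> (eq \<tau> (tlift t \<cdot> Var 0) (tlift u \<cdot> Var 0))"
| "eq (Star \<sigma>) t u =
     ((Con (Len \<sigma>) \<cdot> t \<doteq> Con (Len \<sigma>) \<cdot> u) \<^bold>\<and>
      All Nat (lt (Var 0) (Con (Len \<sigma>) \<cdot> tlift t) \<^bold>\<longrightarrow>
        eq \<sigma> (Con (Ent \<sigma>) \<cdot> tlift t \<cdot> Var 0) (Con (Ent \<sigma>) \<cdot> tlift u \<cdot> Var 0)))"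


section \<open>Derivability\<close>

text \<open>
  Natural deduction for many-sorted classical predicate logic with equality at type 0.
  \<open>deriv \<D> Ax \<Gamma> H A\<close>: the formula \<open>A\<close> in the free variables \<open>\<Gamma>\<close> is derivable from the hypotheses \<open>H\<close>
  and the axioms \<open>Ax\<close>.
\<close>

inductive deriv :: "specs \<Rightarrow> (ctx \<Rightarrow> fm set) \<Rightarrow> ctx \<Rightarrow> fm set \<Rightarrow> fm \<Rightarrow> bool"
  for \<D> :: specs and Ax :: "ctx \<Rightarrow> fm set" where
  Axiom: "\<lbrakk>A \<in> Ax \<Gamma>; wf_fm \<D> \<Gamma> A\<rbrakk> \<Longrightarrow> deriv \<D> Ax \<Gamma> H A"
| Hyp: "\<lbrakk>A \<in> H; wf_fm \<D> \<Gamma> A\<rbrakk> \<Longrightarrow> deriv \<D> Ax \<Gamma> H A"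
| ImpI: "\<lbrakk>wf_fm \<D> \<Gamma> A; deriv \<D> Ax \<Gamma> (insert A H) B\<rbrakk> \<Longrightarrow> deriv \<D> Ax \<Gamma> H (A \<^bold>\<longrightarrow> B)"
| ImpE: "\<lbrakk>deriv \<D> Ax \<Gamma> H (A \<^bold>\<longrightarrow> B); deriv \<D> Ax \<Gamma> H A\<rbrakk> \<Longrightarrow> deriv \<D> Ax \<Gamma> H B"
| Classical: "\<lbrakk>wf_fm \<D> \<Gamma> A; deriv \<D> Ax \<Gamma> (insert (\<^bold>\<not> A) H) Bot\<rbrakk> \<Longrightarrow> deriv \<D> Ax \<Gamma> H A"
| AllI: "deriv \<D> Ax (\<tau> # \<Gamma>) (flift ` H) A \<Longrightarrow> deriv \<D> Ax \<Gamma> H (All \<tau> A)"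
| AllE: "\<lbrakk>deriv \<D> Ax \<Gamma> H (All \<tau> A); wt \<D> \<Gamma> t \<tau>\<rbrakk> \<Longrightarrow> deriv \<D> Ax \<Gamma> H (inst t A)"
| EqI: "wt \<D> \<Gamma> t Nat \<Longrightarrow> deriv \<D> Ax \<Gamma> H (t \<doteq> t)"
| EqE: "\<lbrakk>wf_fm \<D> (Nat # \<Gamma>) A; deriv \<D> Ax \<Gamma> H (t \<doteq> u); deriv \<D> Ax \<Gamma> H (inst t A)\<rbrakk>
    \<Longrightarrow> deriv \<D> Ax \<Gamma> H (inst u A)"

definition proves :: "specs \<Rightarrow> (ctx \<Rightarrow> fm set) \<Rightarrow> fm \<Rightarrow> bool" where
  "proves \<D> Ax A \<longleftrightarrow> deriv \<D> Ax [] {} A"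


section \<open>The base theory\<close>

text \<open>
  \<open>RCAw \<D> \<Gamma>\<close>: the axioms of \<open>RCA\<^sub>0\<^sup>\<omega>\<close> over the language given by \<open>\<D>\<close>; the formulas in the schemas
  may have parameters from \<open>\<Gamma>\<close>.  In the schemas, \<open>A\<close> has its distinguished variables at the lowest
  indices (for \<open>QFAC\<close>: \<open>y\<close> is 0 and \<open>x\<close> is 1), and the substitutions re-index the parameters.
\<close>

inductive_set RCAw :: "specs \<Rightarrow> ctx \<Rightarrow> fm set" for \<D> :: specs and \<Gamma> :: ctx where
  Succ_nonzero: "All Nat (\<^bold>\<not> (Con Succ \<cdot> Var 0 \<doteq> zero)) \<in> RCAw \<D> \<Gamma>"
| Succ_inj: "All Nat (All Nat ((Con Succ \<cdot> Var 1 \<doteq> Con Succ \<cdot> Var 0) \<^bold>\<longrightarrow> (Var 1 \<doteq> Var 0)))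
    \<in> RCAw \<D> \<Gamma>"
| K: "All \<sigma> (All \<tau> (eq \<sigma> (Con (KC \<sigma> \<tau>) \<cdot> Var 1 \<cdot> Var 0) (Var 1))) \<in> RCAw \<D> \<Gamma>"
| S: "All (\<rho> \<rightarrow> \<sigma> \<rightarrow> \<tau>) (All (\<rho> \<rightarrow> \<sigma>) (All \<rho>
      (eq \<tau> (Con (SC \<rho> \<sigma> \<tau>) \<cdot> Var 2 \<cdot> Var 1 \<cdot> Var 0) (Var 2 \<cdot> Var 0 \<cdot> (Var 1 \<cdot> Var 0)))))
    \<in> RCAw \<D> \<Gamma>"
| Rec_zero: "All Nat (All (Nat \<rightarrow> Nat \<rightarrow> Nat) (Con Rec \<cdot> zero \<cdot> Var 1 \<cdot> Var 0 \<doteq> Var 1))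
    \<in> RCAw \<D> \<Gamma>"
| Rec_Succ: "All Nat (All Nat (All (Nat \<rightarrow> Nat \<rightarrow> Nat)
      (Con Rec \<cdot> (Con Succ \<cdot> Var 2) \<cdot> Var 1 \<cdot> Var 0
         \<doteq> Var 0 \<cdot> (Con Rec \<cdot> Var 2 \<cdot> Var 1 \<cdot> Var 0) \<cdot> Var 2)))
    \<in> RCAw \<D> \<Gamma>"
| Len_Seg: "All Nat (All (Nat \<rightarrow> \<sigma>) (Con (Len \<sigma>) \<cdot> (Con (Seg \<sigma>) \<cdot> Var 1 \<cdot> Var 0) \<doteq> Var 1))
    \<in> RCAw \<D> \<Gamma>"
| Ent_Seg: "All Nat (All (Nat \<rightarrow> \<sigma>) (All Nat (lt (Var 0) (Var 2) \<^bold>\<longrightarrow>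
      eq \<sigma> (Con (Ent \<sigma>) \<cdot> (Con (Seg \<sigma>) \<cdot> Var 2 \<cdot> Var 1) \<cdot> Var 0) (Var 1 \<cdot> Var 0))))
    \<in> RCAw \<D> \<Gamma>"
| Ent_default: "All (Star \<sigma>) (All Nat (\<^bold>\<not> lt (Var 0) (Con (Len \<sigma>) \<cdot> Var 1) \<^bold>\<longrightarrow>
      eq \<sigma> (Con (Ent \<sigma>) \<cdot> Var 1 \<cdot> Var 0) (zero_of \<sigma>)))
    \<in> RCAw \<D> \<Gamma>"
| Ext: "All (\<rho> \<rightarrow> \<tau>) (All \<rho> (All \<rho>
      (eq \<rho> (Var 1) (Var 0) \<^bold>\<longrightarrow> eq \<tau> (Var 2 \<cdot> Var 1) (Var 2 \<cdot> Var 0))))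
    \<in> RCAw \<D> \<Gamma>"
| QFInd: "\<lbrakk>qfree A; wf_fm \<D> (Nat # \<Gamma>) A\<rbrakk> \<Longrightarrow>
    (inst zero A \<^bold>\<and>
     All Nat (A \<^bold>\<longrightarrow> fsub (case_nat (Con Succ \<cdot> Var 0) (\<lambda>n. Var (Suc n))) A)
      \<^bold>\<longrightarrow> All Nat A)
    \<in> RCAw \<D> \<Gamma>"
| QFAC: "\<lbrakk>qfree A; wf_fm \<D> (Nat # ty1 # \<Gamma>) A\<rbrakk> \<Longrightarrow>
    (All ty1 (Ex Nat A)
      \<^bold>\<longrightarrow> Ex ty2 (All ty1
            (fsub (case_nat (Var 1 \<cdot> Var 0) (case_nat (Var 0) (\<lambda>n. Var (n + 2)))) A)))
    \<in> RCAw \<D> \<Gamma>"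

text \<open>
  Admissible families of specifications: parameter-free internal formulas of the original language
  that \<open>RCA\<^sub>0\<^sup>\<omega>\<close> proves to be satisfied by at most one functional.
\<close>

definition admissible :: "specs \<Rightarrow> bool" where
  "admissible \<D> \<longleftrightarrow> (\<forall>i \<tau> D. \<D> (i, \<tau>) = Some D \<longrightarrow>
     internal D \<and> wf_fm Map.empty [\<tau>] D \<and>
     proves Map.empty (RCAw Map.empty)
       (All \<tau> (All \<tau>
          (inst (Var 1) D \<^bold>\<and> D \<^bold>\<longrightarrow> eq \<tau> (Var 1) (Var 0)))))"


section \<open>The nonstandard extension\<close>

text \<open>
  In \<open>Idealization\<close>, \<open>z\<close> and \<open>y\<close> are the variables 0 and 1 of \<open>A\<close>; in \<open>HACint\<close>, \<open>y\<close> and \<open>x\<close> are the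
  variables 0 and 1 of \<open>A\<close>.  Quantifiers \<open>\<forall>z \<in> s\<close> and \<open>\<exists>z \<in> s\<close> over a finite sequence are quantifiers
  over the indices below its length.  In \<open>Spec\<close>, agreement of two functionals on all standard inputs
  is the relativisation of their extensional equality.
\<close>

inductive_set RCAOmega :: "specs \<Rightarrow> ctx \<Rightarrow> fm set" for \<D> :: specs and \<Gamma> :: ctx where
  Base: "A \<in> RCAw \<D> \<Gamma> \<Longrightarrow> A \<in> RCAOmega \<D> \<Gamma>"
| St_eq: "All \<tau> (All \<tau> (St \<tau> (Var 1) \<^bold>\<and> eq \<tau> (Var 1) (Var 0) \<^bold>\<longrightarrow> St \<tau> (Var 0)))
    \<in> RCAOmega \<D> \<Gamma>"
| St_closed: "wt \<D> [] t \<tau> \<Longrightarrow> St \<tau> t \<in> RCAOmega \<D> \<Gamma>"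
| St_app: "All (\<sigma> \<rightarrow> \<tau>) (All \<sigma>
      (St (\<sigma> \<rightarrow> \<tau>) (Var 1) \<^bold>\<and> St \<sigma> (Var 0) \<^bold>\<longrightarrow> St \<tau> (Var 1 \<cdot> Var 0)))
    \<in> RCAOmega \<D> \<Gamma>"
| St_below: "All Nat (All Nat (St Nat (Var 1) \<^bold>\<and> lt (Var 0) (Var 1) \<^bold>\<longrightarrow> St Nat (Var 0)))
    \<in> RCAOmega \<D> \<Gamma>"
| Idealization: "\<lbrakk>internal A; wf_fm \<D> (\<sigma> # \<tau> # \<Gamma>) A\<rbrakk> \<Longrightarrow>
    (AllSt (Star \<sigma>) (Ex \<tau> (All Nat (lt (Var 0) (Con (Len \<sigma>) \<cdot> Var 2) \<^bold>\<longrightarrow>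
        fsub (case_nat (Con (Ent \<sigma>) \<cdot> Var 2 \<cdot> Var 0)
               (case_nat (Var 1) (\<lambda>n. Var (n + 3)))) A)))
      \<^bold>\<longrightarrow> Ex \<tau> (AllSt \<sigma> A))
    \<in> RCAOmega \<D> \<Gamma>"
| HACint: "\<lbrakk>internal A; wf_fm \<D> (\<tau> # \<rho> # \<Gamma>) A\<rbrakk> \<Longrightarrow>
    (AllSt \<rho> (ExSt \<tau> A)
      \<^bold>\<longrightarrow> ExSt (\<rho> \<rightarrow> Star \<tau>) (AllSt \<rho> (Ex Nat
            (lt (Var 0) (Con (Len \<tau>) \<cdot> (Var 2 \<cdot> Var 1)) \<^bold>\<and>
             fsub (case_nat (Con (Ent \<tau>) \<cdot> (Var 2 \<cdot> Var 1) \<cdot> Var 0)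
                    (case_nat (Var 1) (\<lambda>n. Var (n + 3)))) A))))
    \<in> RCAOmega \<D> \<Gamma>"
| PFTP: "\<lbrakk>internal A; wf_fm \<D> [\<tau>] A\<rbrakk> \<Longrightarrow> (AllSt \<tau> A \<^bold>\<longrightarrow> All \<tau> A) \<in> RCAOmega \<D> \<Gamma>"
| Spec: "\<D> (i, \<tau>) = Some D \<Longrightarrow>
    St \<tau> (Con (Xi i \<tau>)) \<^bold>\<and> AllSt \<tau> (rel D \<^bold>\<longrightarrow> rel (eq \<tau> (Con (Xi i \<tau>)) (Var 0)))
    \<in> RCAOmega \<D> \<Gamma>"


section \<open>The principles\<close>

text \<open>Sets are characteristic functions: \<open>x \<in> X\<close> is \<open>X(x) = 1\<close>.\<close>

definition is_set :: "tm \<Rightarrow> fm" where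
  "is_set X = All Nat ((tlift X \<cdot> Var 0 \<doteq> zero) \<^bold>\<or> (tlift X \<cdot> Var 0 \<doteq> one))"

definition STP :: fm where
  "STP = All ty1 (is_set (Var 0) \<^bold>\<longrightarrow>
     ExSt ty1 (is_set (Var 0) \<^bold>\<and>
       AllSt Nat ((Var 2 \<cdot> Var 0 \<doteq> one) \<^bold>\<longleftrightarrow> (Var 1 \<cdot> Var 0 \<doteq> one))))"

text \<open>\<open>has_path f\<close>: \<open>(\<exists>g\<^sup>1)(\<forall>x\<^sup>0) f(\<langle>g(0),\<dots>,g(x-1)\<rangle>) \<noteq> 0\<close>.\<close>
definition has_path :: "tm \<Rightarrow> fm" where
  "has_path f = Ex ty1 (All Nat (\<^bold>\<not> (tlift (tlift f) \<cdot> (initT \<cdot> Var 1 \<cdot> Var 0) \<doteq> zero)))"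

definition S2 :: fm where
  "S2 = Ex ty2 (All ty1 ((Var 1 \<cdot> Var 0 \<doteq> zero) \<^bold>\<longleftrightarrow> has_path (Var 0)))"

text \<open>
  The specification of the Suslin functional.  The matrix of \<open>S2\<close> fixes \<open>S(f)\<close> only up to being
  zero; as specifications have to be unique, the Suslin functional is taken to be 0-1-valued.
\<close>
definition Suslin_spec :: fm where
  "Suslin_spec = All ty1
     (((Var 1 \<cdot> Var 0 \<doteq> zero) \<^bold>\<or> (Var 1 \<cdot> Var 0 \<doteq> one)) \<^bold>\<and>
      ((Var 1 \<cdot> Var 0 \<doteq> zero) \<^bold>\<longleftrightarrow> has_path (Var 0)))"

text \<open>\<open>win h f\<close>: \<open>(\<exists>k\<^sup>0) f(\<langle>h(0),\<dots>,h(k-1)\<rangle>) = 0\<close>, i.e. player 0 wins the play \<open>h\<close>.\<close>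
definition win :: "tm \<Rightarrow> tm \<Rightarrow> fm" where
  "win h f = Ex Nat (tlift f \<cdot> (initT \<cdot> tlift h \<cdot> Var 0) \<doteq> zero)"

abbreviation play :: "tm \<Rightarrow> tm \<Rightarrow> tm" where
  "play S\<^sub>0 S\<^sub>1 \<equiv> playT \<cdot> S\<^sub>0 \<cdot> S\<^sub>1"

definition DETstar :: fm where
  "DETstar = AllSt ty1
     (ExSt ty1 (All ty1 (win (play (Var 1) (Var 0)) (Var 2)))
      \<^bold>\<or> ExSt ty1 (All ty1 (\<^bold>\<not> win (play (Var 0) (Var 1)) (Var 2))))"

text \<open>A functional of type \<open>1 \<rightarrow> (1 \<times> 1)\<close> is a pair of functionals of type \<open>1 \<rightarrow> 1\<close>.\<close>
definition UDET :: fm where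
  "UDET = Ex (ty1 \<rightarrow> ty1) (Ex (ty1 \<rightarrow> ty1) (All ty1
     (All ty1 (win (play (Var 3 \<cdot> Var 1) (Var 0)) (Var 1))
      \<^bold>\<or> All ty1 (\<^bold>\<not> win (play (Var 0) (Var 2 \<cdot> Var 1)) (Var 1)))))"

end

theory Submission
  imports Defs "HOL-Library.Countable" "HOL-Library.Nat_Bijection"
begin

text \<open>
  Derivability is reduced to truth in models: by a Henkin construction, whose models consist of terms
  modulo provable extensional equality, it suffices to verify the equivalences in every model of
  \<open>RCA\<^sub>0\<^sup>\<Omega>\<close>, where one can argue in HOL, restricting induction to quantifier-free formulas.

  For the directions to \<open>(S\<^sup>2)\<close>, one lets player 1 play the initial segments of an alleged path, so that
  only finitely many candidates for a path remain (two for \<open>U\<Sigma>\<^sup>0\<^sub>1-DET\<close>, and those provided by \<open>HACint\<close>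
  for \<open>\<Sigma>\<^sup>0\<^sub>1-DET\<^sup>*\<close>); that a candidate is a path is decided in the same way, by a game in which player 0
  has to play a counterexample.

  Conversely, given \<open>(S\<^sup>2)\<^sup>s\<^sup>t\<close>, the constant for the Suslin functional is parameter-free, so \<open>PF-TP\<^sub>\<forall>\<close>
  yields \<open>\<Pi>\<^sup>0\<^sub>1\<close>-transfer and shows that it is a Suslin functional for all arguments.  The winning strategy
  in an open game should decrease the rank of the position.  In place of ordinals one uses the closed
  game in which the ranks of two positions are compared by playing from both: its winning set, a
  greatest fixed point and hence \<open>\<Sigma>\<^sup>1\<^sub>1\<close>, is a relation \<open>Gt\<close> on positions.  The positions that start an
  infinite \<open>Gt\<close>-descending chain are exactly those that are safe for player 1, and in any other
  position player 0 can move, or has to see player 1 move, to a \<open>Gt\<close>-smaller one.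
\<close>

section \<open>Substitution\<close>

text \<open>In \<open>DETstar\<close> a standard strategy has to beat all opponents, nonstandard
  ones included, whereas \<open>rel S2\<close> speaks of standard arguments only. This is why the
  Suslin functional is made correct everywhere before any game is analysed; the analysis takes place
  in the whole model, and standardness returns only when a strategy is selected. The other obstacle
  is that induction is available for quantifier-free formulas only. The relations of the analysis
  are therefore zero sets of closed terms containing the Suslin constant, applied to the game, and
  existential claims proved by induction carry their witness as a term. Well-foundedness in the
  sense of HOL is no help, as the numbers of a model may be nonstandard. That player 0 wins is
  instead read off from a lost play: its positions would themselves form an infinite descending
  chain inside the model.\<close>

instance ty :: countable by countable_datatype
instance cst :: countable by countable_datatype
instance tm :: countable by countable_datatype
instance fm :: countable by countable_datatype

lemma tsub_tsub: "tsub s (tsub r t) = tsub (\<lambda>n. tsub s (r n)) t"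
  by (induction t) auto

lemma up_comp: "(\<lambda>n. tsub (up s) (up r n)) = up (\<lambda>n. tsub s (r n))"
proof
  fix n show "tsub (up s) (up r n) = up (\<lambda>n. tsub s (r n)) n"
    by (cases n) (auto simp: up_def tsub_tsub)
qed

lemma fsub_fsub: "fsub s (fsub r A) = fsub (\<lambda>n. tsub s (r n)) A"
  by (induction A arbitrary: s r) (auto simp: tsub_tsub up_comp)

lemma tsub_Var [simp]: "tsub Var t = t"
  by (induction t) auto

lemma up_Var [simp]: "up Var = Var"
  by (rule ext) (simp add: up_def split: nat.split)

lemma fsub_Var [simp]: "fsub Var A = A"
  by (induction A) auto

lemma ty_of_App: "ty_of \<Gamma> (t \<cdot> u) = Some \<tau> \<longleftrightarrow>
    (\<exists>\<sigma>. ty_of \<Gamma> t = Some (\<sigma> \<rightarrow> \<tau>) \<and> ty_of \<Gamma> u = Some \<sigma>)"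
  by (auto split: option.splits ty.splits)

lemma tsub_cong: "ty_of \<Gamma> t = Some \<tau> \<Longrightarrow> (\<And>i. i < length \<Gamma> \<Longrightarrow> s i = r i) \<Longrightarrow> tsub s t = tsub r t"
proof (induction t arbitrary: \<tau>)
  case (Var x)
  then show ?case by (simp split: if_splits)
next
  case (App t1 t2)
  then show ?case unfolding ty_of_App tsub.simps by blast
qed simp

lemma up_cong: "(\<And>i. i < length \<Gamma> \<Longrightarrow> s i = r i) \<Longrightarrow> i < length (\<tau> # \<Gamma>) \<Longrightarrow> up s i = up r i"
  by (cases i) (auto simp: up_def)

lemma fsub_cong: "wf_fm \<D> \<Gamma> A \<Longrightarrow> (\<And>i. i < length \<Gamma> \<Longrightarrow> s i = r i) \<Longrightarrow> fsub s A = fsub r A"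
proof (induction A arbitrary: \<Gamma> s r)
  case (All \<tau> A)
  have "\<And>i. i < length (\<tau> # \<Gamma>) \<Longrightarrow> up s i = up r i" using All.prems(2) by (rule up_cong)
  with All.IH[of "\<tau> # \<Gamma>" "up s" "up r"] All.prems(1) show ?case by simp
next
  case (Imp A B)
  then show ?case by (metis fsub.simps(4) wf_fm.simps(4))
next
  case (Eq t u)
  then show ?case using tsub_cong[of \<Gamma> _ Nat s r] by (simp add: wt_def)
next
  case (St \<tau> t)
  then show ?case using tsub_cong[of \<Gamma> t \<tau> s r] by (simp add: wt_def)
qed simp

lemma in_lang_tsub: "in_lang \<D> t \<Longrightarrow> ty_of \<Gamma> t = Some \<tau> \<Longrightarrow>
    (\<And>i. i < length \<Gamma> \<Longrightarrow> in_lang \<D> (s i)) \<Longrightarrow> in_lang \<D> (tsub s t)"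
proof (induction t arbitrary: \<tau>)
  case (Var x)
  then show ?case by (simp split: if_splits)
next
  case (App t u)
  then show ?case unfolding ty_of_App by auto
qed simp

lemma ty_of_tsub: "ty_of \<Gamma> t = Some \<tau> \<Longrightarrow>
    (\<And>i. i < length \<Gamma> \<Longrightarrow> ty_of \<Delta> (s i) = Some (\<Gamma> ! i)) \<Longrightarrow> ty_of \<Delta> (tsub s t) = Some \<tau>"
proof (induction t arbitrary: \<tau>)
  case (Var x)
  then show ?case by (simp split: if_splits)
next
  case (App t u)
  then show ?case unfolding ty_of_App tsub.simps by blast
qed simp

definition typed_sub :: "specs \<Rightarrow> ctx \<Rightarrow> ctx \<Rightarrow> (nat \<Rightarrow> tm) \<Rightarrow> bool" where
  "typed_sub \<D> \<Gamma> \<Delta> s \<longleftrightarrow> (\<forall>i < length \<Gamma>. wt \<D> \<Delta> (s i) (\<Gamma> ! i))"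

lemma wt_tsub: "wt \<D> \<Gamma> t \<tau> \<Longrightarrow> typed_sub \<D> \<Gamma> \<Delta> s \<Longrightarrow> wt \<D> \<Delta> (tsub s t) \<tau>"
  unfolding typed_sub_def wt_def by (blast intro: in_lang_tsub ty_of_tsub)

lemma wt_Var [simp]: "wt \<D> \<Gamma> (Var n) \<tau> \<longleftrightarrow> n < length \<Gamma> \<and> \<Gamma> ! n = \<tau>"
  by (auto simp: wt_def)

lemma typed_sub_lift: "typed_sub \<D> \<Gamma> (\<tau> # \<Gamma>) (\<lambda>n. Var (Suc n))"
  by (auto simp: typed_sub_def)

lemma wt_tlift: "wt \<D> \<Gamma> t \<sigma> \<Longrightarrow> wt \<D> (\<tau> # \<Gamma>) (tlift t) \<sigma>"
  by (rule wt_tsub[OF _ typed_sub_lift])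

lemma typed_sub_up: "typed_sub \<D> \<Gamma> \<Delta> s \<Longrightarrow> typed_sub \<D> (\<tau> # \<Gamma>) (\<tau> # \<Delta>) (up s)"
  unfolding typed_sub_def
proof (intro allI impI)
  fix i assume *: "\<forall>i<length \<Gamma>. wt \<D> \<Delta> (s i) (\<Gamma> ! i)" and "i < length (\<tau> # \<Gamma>)"
  then show "wt \<D> (\<tau> # \<Delta>) (up s i) ((\<tau> # \<Gamma>) ! i)"
    by (cases i) (auto simp: up_def wt_tlift)
qed

lemma wf_fsub: "wf_fm \<D> \<Gamma> A \<Longrightarrow> typed_sub \<D> \<Gamma> \<Delta> s \<Longrightarrow> wf_fm \<D> \<Delta> (fsub s A)"
  by (induction A arbitrary: \<Gamma> \<Delta> s) (auto intro: wt_tsub typed_sub_up)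

lemma typed_sub_inst: "wt \<D> \<Gamma> t \<tau> \<Longrightarrow> typed_sub \<D> (\<tau> # \<Gamma>) \<Gamma> (case_nat t Var)"
  by (auto simp: typed_sub_def less_Suc_eq_0_disj)

lemma wf_inst: "wf_fm \<D> (\<tau> # \<Gamma>) A \<Longrightarrow> wt \<D> \<Gamma> t \<tau> \<Longrightarrow> wf_fm \<D> \<Gamma> (inst t A)"
  by (rule wf_fsub[OF _ typed_sub_inst])

lemma fsub_inst: "fsub s (inst t A) = inst (tsub s t) (fsub (up s) A)"
proof -
  have "(\<lambda>n. tsub s (case_nat t Var n)) = (\<lambda>n. tsub (case_nat (tsub s t) Var) (up s n))"
    by (rule ext) (simp add: up_def tsub_tsub split: nat.split)
  then show ?thesis by (simp add: fsub_fsub)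
qed

lemma inst_up: "inst t (fsub (up s) A) = fsub (case_nat t s) A"
proof -
  have "(\<lambda>n. tsub (case_nat t Var) (up s n)) = case_nat t s"
    by (rule ext) (simp add: up_def tsub_tsub split: nat.split)
  then show ?thesis by (simp add: fsub_fsub)
qed

lemma ty_of_append: "ty_of \<Gamma> t = Some \<tau> \<Longrightarrow> ty_of (\<Gamma> @ \<Delta>) t = Some \<tau>"
proof (induction t arbitrary: \<tau>)
  case (Var x)
  then show ?case by (simp add: nth_append split: if_splits)
next
  case (App t u)
  then show ?case unfolding ty_of_App by blast
qed simp

lemma wt_append: "wt \<D> \<Gamma> t \<tau> \<Longrightarrow> wt \<D> (\<Gamma> @ \<Delta>) t \<tau>"
  by (simp add: wt_def ty_of_append)

text \<open>Indices count from the front of the context, so new variables at its far end leave all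
  indices unchanged; the Henkin witnesses are added there.\<close>

lemma wf_append: "wf_fm \<D> \<Gamma> A \<Longrightarrow> wf_fm \<D> (\<Gamma> @ \<Delta>) A"
proof (induction A arbitrary: \<Gamma>)
  case (All \<tau> A)
  from All.IH[of "\<tau> # \<Gamma>"] All.prems show ?case by simp
qed (auto intro: wt_append)

lemma ty_of_closed: "ty_of [] t = Some \<tau> \<Longrightarrow> ty_of \<Gamma> t = Some \<tau>"
  using ty_of_append[of "[]" t \<tau> \<Gamma>] by simp

lemma tsub_closed: "ty_of [] t = Some \<tau> \<Longrightarrow> tsub s t = t"
  using tsub_cong[of "[]" t \<tau> s Var] by simp


section \<open>Derivations\<close>

lemma deriv_wf: "deriv \<D> Ax \<Gamma> H A \<Longrightarrow> wf_fm \<D> \<Gamma> A"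
proof (induction rule: deriv.induct)
  case (EqE \<Gamma> A H t u)
  then show ?case by (auto intro: wf_inst)
qed (auto simp: wf_inst)

lemma deriv_weaken: "deriv \<D> Ax \<Gamma> H A \<Longrightarrow> H \<subseteq> H' \<Longrightarrow> deriv \<D> Ax \<Gamma> H' A"
proof (induction arbitrary: H' rule: deriv.induct)
  case (ImpI \<Gamma> A H B)
  show ?case by (rule deriv.ImpI[OF ImpI.hyps(1)], rule ImpI.IH) (use ImpI.prems in auto)
next
  case (Classical \<Gamma> A H)
  show ?case by (rule deriv.Classical[OF Classical.hyps(1)], rule Classical.IH) (use Classical.prems in auto)
next
  case (AllI \<tau> \<Gamma> H A)
  show ?case by (rule deriv.AllI, rule AllI.IH) (use AllI.prems in auto)
qed (blast intro: deriv.intros)+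

lemma deriv_mono_Ax: "deriv \<D> (\<lambda>_. {}) \<Gamma> H A \<Longrightarrow> deriv \<D> Ax \<Gamma> H A"
  by (induction \<Gamma> H A rule: deriv.induct) (auto intro: deriv.intros)

lemma deriv_append: "deriv \<D> (\<lambda>_. {}) \<Gamma> H A \<Longrightarrow> deriv \<D> (\<lambda>_. {}) (\<Gamma> @ \<Delta>) H A"
proof (induction \<Gamma> H A rule: deriv.induct)
  case (EqE \<Gamma> A H t u)
  from wf_append[OF EqE.hyps(1), of \<Delta>] EqE.IH show ?case by (auto intro: deriv.EqE)
qed (auto intro: deriv.intros wf_append wt_append)

lemma flift_image: "fsub (up s) ` flift ` H = flift ` fsub s ` H"
  by (simp add: image_image fsub_fsub up_def)

text \<open>An arbitrary \<open>Ax\<close> need not be closed under substitution. The structural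
  results are therefore about derivations without axioms, and theorems are kept among the hypotheses
  instead.\<close>

lemma deriv_fsub:
  "deriv \<D> (\<lambda>_. {}) \<Gamma> H A \<Longrightarrow> typed_sub \<D> \<Gamma> \<Delta> s \<Longrightarrow> deriv \<D> (\<lambda>_. {}) \<Delta> (fsub s ` H) (fsub s A)"
proof (induction \<Gamma> H A arbitrary: \<Delta> s rule: deriv.induct)
  case (Hyp A H \<Gamma>)
  then show ?case by (auto intro: deriv.Hyp wf_fsub)
next
  case (ImpI \<Gamma> A H B)
  then show ?case by (simp add: deriv.ImpI wf_fsub)
next
  case (Classical \<Gamma> A H)
  show ?case
    by (rule deriv.Classical)
      (use Classical.IH[OF Classical.prems] wf_fsub[OF Classical.hyps(1) Classical.prems] in simp_all)
next
  case (AllI \<tau> \<Gamma> H A)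
  from AllI.IH[OF typed_sub_up[OF AllI.prems]] show ?case
    by (auto simp: flift_image intro!: deriv.AllI)
next
  case (AllE \<Gamma> H \<tau> A t)
  have "deriv \<D> (\<lambda>_. {}) \<Delta> (fsub s ` H) (inst (tsub s t) (fsub (up s) A))"
    by (rule deriv.AllE) (use AllE.IH[OF AllE.prems] wt_tsub[OF AllE.hyps(2) AllE.prems] in simp_all)
  then show ?case by (simp add: fsub_inst)
next
  case (EqI \<Gamma> t H)
  then show ?case by (auto intro!: deriv.EqI wt_tsub)
next
  case (EqE \<Gamma> A H t u)
  have "deriv \<D> (\<lambda>_. {}) \<Delta> (fsub s ` H) (inst (tsub s u) (fsub (up s) A))"
  proof (rule deriv.EqE)
    show "wf_fm \<D> (Nat # \<Delta>) (fsub (up s) A)"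
      by (rule wf_fsub[OF EqE.hyps(1) typed_sub_up[OF EqE.prems]])
    show "deriv \<D> (\<lambda>_. {}) \<Delta> (fsub s ` H) (tsub s t \<doteq> tsub s u)"
      using EqE.IH(1)[OF EqE.prems] by simp
    show "deriv \<D> (\<lambda>_. {}) \<Delta> (fsub s ` H) (inst (tsub s t) (fsub (up s) A))"
      using EqE.IH(2)[OF EqE.prems] by (simp add: fsub_inst)
  qed
  then show ?case by (simp add: fsub_inst)
next
  case (ImpE \<Gamma> H A B)
  from ImpE.IH[OF ImpE.prems] show ?case by (simp add: deriv.ImpE[of _ _ _ _ "fsub s A"])
qed simp

lemma deriv_finite: "deriv \<D> Ax \<Gamma> H A \<Longrightarrow> \<exists>F. finite F \<and> F \<subseteq> H \<and> deriv \<D> Ax \<Gamma> F A"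
proof (induction rule: deriv.induct)
  case (Axiom A \<Gamma> H)
  then show ?case by (intro exI[of _ "{}"]) (auto intro: deriv.Axiom)
next
  case (Hyp A H \<Gamma>)
  then show ?case by (intro exI[of _ "{A}"]) (auto intro: deriv.Hyp)
next
  case (ImpI \<Gamma> A H B)
  then obtain F where "finite F" "F \<subseteq> insert A H" "deriv \<D> Ax \<Gamma> F B" by blast
  moreover from this have "deriv \<D> Ax \<Gamma> (insert A (F - {A})) B" by (auto elim: deriv_weaken)
  ultimately show ?case using ImpI.hyps
    by (intro exI[of _ "F - {A}"]) (auto intro: deriv.ImpI)
next
  case (ImpE \<Gamma> H A B)
  then obtain F F' where "finite F" "F \<subseteq> H" "deriv \<D> Ax \<Gamma> F (A \<^bold>\<longrightarrow> B)"
    "finite F'" "F' \<subseteq> H" "deriv \<D> Ax \<Gamma> F' A" by blast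
  moreover from this have "deriv \<D> Ax \<Gamma> (F \<union> F') (A \<^bold>\<longrightarrow> B)" "deriv \<D> Ax \<Gamma> (F \<union> F') A"
    by (auto elim: deriv_weaken)
  ultimately show ?case by (intro exI[of _ "F \<union> F'"]) (auto intro: deriv.ImpE)
next
  case (Classical \<Gamma> A H)
  then obtain F where "finite F" "F \<subseteq> insert (\<^bold>\<not> A) H" "deriv \<D> Ax \<Gamma> F Bot" by blast
  moreover from this have "deriv \<D> Ax \<Gamma> (insert (\<^bold>\<not> A) (F - {\<^bold>\<not> A})) Bot"
    by (auto elim: deriv_weaken)
  ultimately show ?case using Classical.hyps
    by (intro exI[of _ "F - {\<^bold>\<not> A}"]) (auto intro: deriv.Classical)
next
  case (AllI \<tau> \<Gamma> H A)
  then obtain F where "finite F" "F \<subseteq> flift ` H" "deriv \<D> Ax (\<tau> # \<Gamma>) F A" by blast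
  moreover from this obtain F' where "finite F'" "F' \<subseteq> H" "F = flift ` F'"
    by (metis finite_subset_image)
  ultimately show ?case by (auto intro!: exI[of _ F'] deriv.AllI)
next
  case (AllE \<Gamma> H \<tau> A t)
  then show ?case by (blast intro: deriv.AllE)
next
  case (EqI \<Gamma> t H)
  then show ?case by (intro exI[of _ "{}"]) (auto intro: deriv.EqI)
next
  case (EqE \<Gamma> A H t u)
  then obtain F F' where "finite F" "F \<subseteq> H" "deriv \<D> Ax \<Gamma> F (t \<doteq> u)"
    "finite F'" "F' \<subseteq> H" "deriv \<D> Ax \<Gamma> F' (inst t A)" by blast
  moreover from this have "deriv \<D> Ax \<Gamma> (F \<union> F') (t \<doteq> u)" "deriv \<D> Ax \<Gamma> (F \<union> F') (inst t A)"
    by (auto elim: deriv_weaken)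
  ultimately show ?case using EqE.hyps(1)
    by (intro exI[of _ "F \<union> F'"]) (auto intro: deriv.EqE)
qed

lemma deriv_cut: "deriv \<D> Ax \<Gamma> H A \<Longrightarrow> deriv \<D> Ax \<Gamma> (insert A H) B \<Longrightarrow> deriv \<D> Ax \<Gamma> H B"
  by (rule deriv.ImpE[of _ _ _ _ A]) (auto intro: deriv.ImpI deriv_wf)

lemma deriv_exfalso: "deriv \<D> Ax \<Gamma> H Bot \<Longrightarrow> wf_fm \<D> \<Gamma> A \<Longrightarrow> deriv \<D> Ax \<Gamma> H A"
  by (rule deriv.Classical) (auto elim: deriv_weaken)

text \<open>A derivation uses finitely many hypotheses, and each of them is cut against its proof.
  This leads back from theorems kept as hypotheses to derivability from the axioms.\<close>

lemma deriv_theorems: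
  "deriv \<D> (\<lambda>_. {}) [] H A \<Longrightarrow> (\<And>B. B \<in> H \<Longrightarrow> deriv \<D> Ax [] {} B) \<Longrightarrow> deriv \<D> Ax [] {} A"
proof -
  assume A: "deriv \<D> (\<lambda>_. {}) [] H A" and *: "\<And>B. B \<in> H \<Longrightarrow> deriv \<D> Ax [] {} B"
  obtain F where F: "finite F" "F \<subseteq> H" "deriv \<D> (\<lambda>_. {}) [] F A"
    using deriv_finite[OF A] by blast
  have "deriv \<D> Ax [] F A" using deriv_mono_Ax F(3) .
  with F(1,2) show ?thesis
  proof (induction F)
    case (insert B F)
    have "deriv \<D> Ax [] F B" by (rule deriv_weaken[OF *]) (use insert in auto)
    with insert show ?case using deriv_cut by auto
  qed
qed

lemma ty_of_zero_of: "ty_of \<Gamma> (zero_of \<tau>) = Some \<tau>"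
  by (induction \<tau>) auto

lemma wt_zero_of: "wt \<D> \<Gamma> (zero_of \<tau>) \<tau>"
proof -
  have "in_lang \<D> (zero_of \<tau>)" by (induction \<tau>) auto
  then show ?thesis by (simp add: wt_def ty_of_zero_of)
qed

section \<open>Structures\<close>

text \<open>All sorts share one universe and \<open>T\<close> gives the sort of an element, so that
  neither \<open>ap\<close> nor \<open>st\<close> needs a type argument.\<close>

locale fm_structure =
  fixes U :: "'a set" and T :: "'a \<Rightarrow> ty" and ap :: "'a \<Rightarrow> 'a \<Rightarrow> 'a" (infixl "\<bullet>" 90)
    and con :: "cst \<Rightarrow> 'a" and st :: "'a \<Rightarrow> bool"
begin

definition dom :: "ty \<Rightarrow> 'a set" where
  "dom \<tau> = {a \<in> U. T a = \<tau>}"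

primrec ev :: "(nat \<Rightarrow> 'a) \<Rightarrow> tm \<Rightarrow> 'a" where
  "ev e (Var n) = e n"
| "ev e (Con c) = con c"
| "ev e (t \<cdot> u) = ev e t \<bullet> ev e u"

primrec sat :: "(nat \<Rightarrow> 'a) \<Rightarrow> fm \<Rightarrow> bool" where
  "sat e (t \<doteq> u) \<longleftrightarrow> ev e t = ev e u"
| "sat e (St \<tau> t) \<longleftrightarrow> st (ev e t)"
| "sat e Bot \<longleftrightarrow> False"
| "sat e (A \<^bold>\<longrightarrow> B) \<longleftrightarrow> (sat e A \<longrightarrow> sat e B)"
| "sat e (All \<tau> A) \<longleftrightarrow> (\<forall>a \<in> dom \<tau>. sat (case_nat a e) A)"

lemma ev_cong: "ty_of \<Gamma> t = Some \<tau> \<Longrightarrow> (\<And>i. i < length \<Gamma> \<Longrightarrow> e i = e' i) \<Longrightarrow> ev e t = ev e' t"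
proof (induction t arbitrary: \<tau>)
  case (Var x)
  then show ?case by (simp split: if_splits)
next
  case (App t1 t2)
  then show ?case unfolding ty_of_App ev.simps by metis
qed simp

lemma ev_closed: "ty_of [] t = Some \<tau> \<Longrightarrow> ev e t = ev e' t"
  using ev_cong[of "[]"] by simp

lemma sat_cong: "wf_fm \<D> \<Gamma> A \<Longrightarrow> (\<And>i. i < length \<Gamma> \<Longrightarrow> e i = e' i) \<Longrightarrow> sat e A = sat e' A"
proof (induction A arbitrary: \<Gamma> e e')
  case (Eq t u)
  then show ?case using ev_cong[of \<Gamma> _ Nat e e'] by (simp add: wt_def)
next
  case (St \<tau> t)
  then show ?case using ev_cong[of \<Gamma> _ \<tau> e e'] by (simp add: wt_def)
next
  case (Imp A B)
  then show ?case by (metis sat.simps(4) wf_fm.simps(4))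
next
  case (All \<tau> A)
  have "sat (case_nat a e) A = sat (case_nat a e') A" for a
    by (rule All.IH[of "\<tau> # \<Gamma>"]) (use All.prems in \<open>auto split: nat.split\<close>)
  then show ?case by simp
qed simp

lemma ev_tsub: "ev e (tsub s t) = ev (\<lambda>n. ev e (s n)) t"
  by (induction t) auto

lemma sat_fsub: "sat e (fsub s A) = sat (\<lambda>n. ev e (s n)) A"
proof (induction A arbitrary: e s)
  case (All \<tau> A)
  have "(\<lambda>n. ev (case_nat a e) (up s n)) = case_nat a (\<lambda>n. ev e (s n))" for a
    by (rule ext) (simp add: up_def ev_tsub split: nat.split)
  with All show ?case by simp
qed (auto simp: ev_tsub)

end

text \<open>Since extensional equality is identity, arguments in a model can rewrite with HOL
  equations instead of handling the formulas \<open>eq\<close>.\<close>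

locale ext_model = fm_structure U T ap con st
  for U :: "'a set" and T :: "'a \<Rightarrow> ty" and ap :: "'a \<Rightarrow> 'a \<Rightarrow> 'a" (infixl "\<bullet>" 90)
    and con :: "cst \<Rightarrow> 'a" and st :: "'a \<Rightarrow> bool" +
  fixes \<D> :: specs and Ax :: "ctx \<Rightarrow> fm set"
  assumes con_dom: "in_lang \<D> (Con c) \<Longrightarrow> con c \<in> dom (cty c)"
    and ap_dom: "f \<in> dom (\<sigma> \<rightarrow> \<tau>) \<Longrightarrow> a \<in> dom \<sigma> \<Longrightarrow> f \<bullet> a \<in> dom \<tau>"
    and eq_iff: "a \<in> dom \<tau> \<Longrightarrow> b \<in> dom \<tau> \<Longrightarrow> sat (case_nat b (case_nat a e)) (eq \<tau> (Var 1) (Var 0)) \<longleftrightarrow> a = b"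
    and sat_theorem: "proves \<D> Ax A \<Longrightarrow> sat e A"


section \<open>Completeness\<close>

lemma fsub_eq: "fsub s (eq \<tau> t u) = eq \<tau> (tsub s t) (tsub s u)"
proof (induction \<tau> arbitrary: s t u)
  case (Fun \<sigma> \<tau>)
  then show ?case by (simp add: tsub_tsub up_def)
next
  case (Star \<tau>)
  have "tsub (up s) subT = subT"
    by (rule tsub_closed[of _ "Nat \<rightarrow> Nat \<rightarrow> Nat"]) (simp add: subT_def predT_def numeral_2_eq_2)
  with Star show ?case by (simp add: tsub_tsub up_def lt_def)
qed simp

lemma ty_of_subT [simp]: "ty_of \<Gamma> subT = Some (Nat \<rightarrow> Nat \<rightarrow> Nat)"
  by (rule ty_of_closed) (simp add: subT_def predT_def numeral_2_eq_2)

lemma in_lang_subT [simp]: "in_lang \<D> subT"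
  by (simp add: subT_def predT_def numeral_2_eq_2)

lemma wf_lt: "wt \<D> \<Gamma> t Nat \<Longrightarrow> wt \<D> \<Gamma> u Nat \<Longrightarrow> wf_fm \<D> \<Gamma> (lt t u)"
  by (simp add: lt_def wt_def)

lemma wf_eq: "wt \<D> \<Gamma> t \<tau> \<Longrightarrow> wt \<D> \<Gamma> u \<tau> \<Longrightarrow> wf_fm \<D> \<Gamma> (eq \<tau> t u)"
proof (induction \<tau> arbitrary: \<Gamma> t u)
  case (Fun \<sigma> \<tau>)
  have "wt \<D> (\<sigma> # \<Gamma>) (tlift t \<cdot> Var 0) \<tau>" if "wt \<D> \<Gamma> t (\<sigma> \<rightarrow> \<tau>)" for t
    using wt_tlift[OF that, of \<sigma>] by (simp add: wt_def)
  with Fun show ?case by simp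
next
  case (Star \<sigma>)
  have 1: "wt \<D> (Nat # \<Gamma>) (Con (Ent \<sigma>) \<cdot> tlift t \<cdot> Var 0) \<sigma>"
    "wt \<D> (Nat # \<Gamma>) (Con (Len \<sigma>) \<cdot> tlift t) Nat" "wt \<D> \<Gamma> (Con (Len \<sigma>) \<cdot> t) Nat"
    if "wt \<D> \<Gamma> t (Star \<sigma>)" for t
    using wt_tlift[OF that, of Nat] that by (simp_all add: wt_def)
  from Star 1[OF Star.prems(1)] 1[OF Star.prems(2)] show ?case by (simp add: wf_lt)
qed simp

section \<open>Maximal consistent sets with Henkin witnesses\<close>

locale henkin =
  fixes \<D> :: specs and T\<^sub>0 :: "fm set"
  assumes T\<^sub>0_wf: "A \<in> T\<^sub>0 \<Longrightarrow> wf_fm \<D> [] A"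
    and T\<^sub>0_cons: "\<not> deriv \<D> (\<lambda>_. {}) [] T\<^sub>0 Bot"
begin

abbreviation der :: "ctx \<Rightarrow> fm set \<Rightarrow> fm \<Rightarrow> bool" where
  "der \<equiv> deriv \<D> (\<lambda>_. {})"

text \<open>
  Instead of adding Henkin constants, the variable \<open>n\<close> (of type \<open>vty n\<close>) of an infinite context serves
  as the witness for the formula \<open>vfm n\<close>; every formula has to occur infinitely often, since it is
  only witnessed once its own variables have been introduced.
\<close>

definition vwit :: "nat \<Rightarrow> ty \<times> fm" where "vwit n = from_nat (fst (prod_decode n))"
definition vty :: "nat \<Rightarrow> ty" where "vty n = fst (vwit n)"
definition vfm :: "nat \<Rightarrow> fm" where "vfm n = snd (vwit n)"
definition G :: "nat \<Rightarrow> ctx" where "G n = map vty [0..<n]"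

lemma vwit_inf: "\<exists>n \<ge> k. vty n = \<tau> \<and> vfm n = A"
  by (intro exI[of _ "prod_encode (to_nat (\<tau>, A), k)"])
    (simp add: vty_def vfm_def vwit_def le_prod_encode_2)

lemma G_Suc: "G (Suc n) = G n @ [vty n]"
  by (simp add: G_def)

lemma length_G [simp]: "length (G n) = n"
  by (simp add: G_def)

lemma nth_G [simp]: "i < n \<Longrightarrow> G n ! i = vty i"
  by (simp add: G_def)

lemma G_le: "n \<le> m \<Longrightarrow> \<exists>\<Delta>. G m = G n @ \<Delta>"
  unfolding G_def by (metis le_add_diff_inverse map_append upt_add_eq_append zero_le)

lemma der_G_le: "der (G n) H A \<Longrightarrow> n \<le> m \<Longrightarrow> der (G m) H A"
  using G_le deriv_append by metis

lemma wf_G_le: "wf_fm \<D> (G n) A \<Longrightarrow> n \<le> m \<Longrightarrow> wf_fm \<D> (G m) A"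
  using G_le wf_append by metis

lemma wt_G_le: "wt \<D> (G n) t \<tau> \<Longrightarrow> n \<le> m \<Longrightarrow> wt \<D> (G m) t \<tau>"
  using G_le wt_append by metis

text \<open>The variable \<open>n\<close> plays the part of a counterexample to
  \<open>vfm n\<close>, if there is one. A formula that is not well formed at this stage is passed
  over with a trivial axiom.\<close>

definition hk :: "nat \<Rightarrow> fm" where
  "hk n = (if wf_fm \<D> (vty n # G n) (vfm n) then inst (Var n) (vfm n) \<^bold>\<longrightarrow> All (vty n) (vfm n) else Bot \<^bold>\<longrightarrow> Bot)"

definition Hk :: "nat \<Rightarrow> fm set" where
  "Hk n = T\<^sub>0 \<union> hk ` {..<n}"

lemma wf_hk: "wf_fm \<D> (G (Suc n)) (hk n)"
proof (cases "wf_fm \<D> (vty n # G n) (vfm n)")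
  case True
  then have 1: "wf_fm \<D> (G (Suc n)) (All (vty n) (vfm n))"
    using wf_G_le[of n "All (vty n) (vfm n)" "Suc n"] by simp
  then have "wf_fm \<D> (G (Suc n)) (inst (Var n) (vfm n))"
    by (intro wf_inst[of _ "vty n"]) auto
  with 1 True show ?thesis by (simp add: hk_def)
qed (simp add: hk_def)

lemma wf_Hk: "A \<in> Hk n \<Longrightarrow> wf_fm \<D> (G n) A"
proof -
  assume "A \<in> Hk n"
  then consider "A \<in> T\<^sub>0" | i where "i < n" "A = hk i" by (auto simp: Hk_def)
  then show ?thesis
  proof cases
    case 1
    then show ?thesis using T\<^sub>0_wf[of A] wf_G_le[of 0 A n] by (simp add: G_def)
  next
    case 2
    then show ?thesis using wf_G_le[OF wf_hk, of i n] by simp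
  qed
qed

text \<open>The new variable is fresh. If adding the Henkin axiom were contradictory, then over
  \<open>H\<close> the implication from \<open>B\<close> to \<open>All \<tau> B\<close> would be
  refutable for a generic variable. This forces \<open>B\<close>, hence \<open>All \<tau> B\<close>
  by generalisation, hence the implication itself.\<close>

lemma henkin_step:
  assumes B: "wf_fm \<D> (\<tau> # \<Gamma>) B" and H: "\<And>A. A \<in> H \<Longrightarrow> wf_fm \<D> \<Gamma> A"
    and d: "der (\<Gamma> @ [\<tau>]) (insert (inst (Var (length \<Gamma>)) B \<^bold>\<longrightarrow> All \<tau> B) H) Bot"
  shows "der \<Gamma> H Bot"
proof -
  let ?n = "length \<Gamma>"
  \<comment> \<open>Moves the new variable from the end of the context to index 0, where it can be
    generalised.\<close>
  let ?s = "\<lambda>i. if i < ?n then Var (Suc i) else Var 0"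
  have s: "typed_sub \<D> (\<Gamma> @ [\<tau>]) (\<tau> # \<Gamma>) ?s"
    by (auto simp: typed_sub_def nth_append less_Suc_eq)
  have lift: "fsub ?s A = flift A" if "wf_fm \<D> \<Gamma> A" for A
    using that by (rule fsub_cong) simp
  have "fsub ?s ` H = flift ` H" using H lift by (intro image_cong) auto
  moreover have "fsub ?s (inst (Var ?n) B) = B"
  proof -
    have "fsub (\<lambda>n. tsub ?s (case_nat (Var ?n) Var n)) B = fsub Var B"
      by (rule fsub_cong[OF B]) (auto split: nat.split)
    then show ?thesis by (simp add: fsub_fsub)
  qed
  moreover have "fsub ?s (All \<tau> B) = flift (All \<tau> B)" using B by (intro lift) simp
  ultimately have d': "der (\<tau> # \<Gamma>) (insert (B \<^bold>\<longrightarrow> flift (All \<tau> B)) (flift ` H)) Bot"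
    using deriv_fsub[OF d s] by simp
  have wfB: "wf_fm \<D> (\<tau> # \<Gamma>) (flift (All \<tau> B))"
    using B by (intro wf_fsub[OF _ typed_sub_lift]) simp
  have d2: "der (\<tau> # \<Gamma>) H' Bot" if "der (\<tau> # \<Gamma>) H' (B \<^bold>\<longrightarrow> flift (All \<tau> B))" "flift ` H \<subseteq> H'" for H'
    by (rule deriv_cut[OF that(1)], rule deriv_weaken[OF d']) (use that in auto)
  have "der (\<tau> # \<Gamma>) (flift ` H) B"
  proof (rule deriv.Classical[OF B], rule d2)
    let ?H = "insert B (insert (\<^bold>\<not> B) (flift ` H))"
    have "der (\<tau> # \<Gamma>) ?H Bot"
      by (rule deriv.ImpE[of _ _ _ _ B]) (use B in \<open>auto intro: deriv.Hyp\<close>)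
    then show "der (\<tau> # \<Gamma>) (insert (\<^bold>\<not> B) (flift ` H)) (B \<^bold>\<longrightarrow> flift (All \<tau> B))"
      by (rule deriv.ImpI[OF B deriv_exfalso[OF _ wfB]])
  qed auto
  then have "der \<Gamma> H (All \<tau> B)" by (rule deriv.AllI)
  then have "der (\<tau> # \<Gamma>) (flift ` H) (flift (All \<tau> B))"
    using deriv_fsub[OF _ typed_sub_lift] by blast
  then have "der (\<tau> # \<Gamma>) (flift ` H) (B \<^bold>\<longrightarrow> flift (All \<tau> B))"
    by (intro deriv.ImpI[OF B]) (auto elim: deriv_weaken)
  \<comment> \<open>The contradiction is derived with an extra variable in the context; it is
    removed by instantiation, as every type has a closed term.\<close>
  then have "der \<Gamma> H (All \<tau> Bot)" by (intro deriv.AllI d2) auto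
  from deriv.AllE[OF this wt_zero_of] show ?thesis by simp
qed

lemma Hk_cons: "\<not> der (G n) (Hk n) Bot"
proof (induction n)
  case 0
  show ?case using T\<^sub>0_cons by (simp add: G_def Hk_def)
next
  case (Suc n)
  show ?case
  proof
    assume d: "der (G (Suc n)) (Hk (Suc n)) Bot"
    have H: "Hk (Suc n) = insert (hk n) (Hk n)" by (auto simp: Hk_def less_Suc_eq)
    show False
    proof (cases "wf_fm \<D> (vty n # G n) (vfm n)")
      case True
      from Suc henkin_step[OF True, of "Hk n"] wf_Hk d show False
        by (simp add: H G_Suc hk_def True)
    next
      case False
      have "der (G (Suc n)) (Hk n) (Bot \<^bold>\<longrightarrow> Bot)"
        by (rule deriv.ImpI) (auto intro: deriv.Hyp)
      with d have "der (G (Suc n)) (Hk n) Bot" by (auto simp: H hk_def False intro: deriv_cut)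
      moreover have "wf_fm \<D> (vty n # G n) Bot" by simp
      \<comment> \<open>The stage adds nothing of substance, but its variable must still be dropped
        from the context; \<open>henkin_step\<close> with \<open>Bot\<close> as the formula does
        this.\<close>
      moreover have "der (G n @ [vty n]) (insert (inst (Var (length (G n))) Bot \<^bold>\<longrightarrow> All (vty n) Bot) (Hk n)) Bot"
        using calculation(1) by (auto simp: G_Suc elim: deriv_weaken)
      ultimately show False using Suc henkin_step[of "vty n" "G n" Bot "Hk n"] wf_Hk by auto
    qed
  qed
qed

definition consistent :: "fm set \<Rightarrow> bool" where
  "consistent X \<longleftrightarrow> (\<forall>n. \<not> der (G n) X Bot)"

text \<open>A refutation uses finitely many formulas, all of which lie in one stage
  \<open>Hk m\<close>, and it can be moved to a longer context; so the union of the stages is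
  consistent. By the same finiteness unions of chains are consistent, and Zorn's lemma
  applies.\<close>

lemma ex_maximal:
  "\<exists>M. T\<^sub>0 \<union> range hk \<subseteq> M \<and> consistent M \<and> (\<forall>X. M \<subseteq> X \<and> consistent X \<longrightarrow> X = M)"
proof -
  let ?S = "T\<^sub>0 \<union> range hk"
  let ?A = "{X. ?S \<subseteq> X \<and> consistent X}"
  have "consistent ?S"
    unfolding consistent_def
  proof (intro allI notI)
    fix n assume d: "der (G n) ?S Bot"
    obtain F where F: "finite F" "F \<subseteq> ?S" "der (G n) F Bot" using deriv_finite[OF d] by blast
    have "\<exists>m. F \<subseteq> Hk m" using F(1,2)
    proof (induction F)
      case (insert A F)
      then obtain m where m: "F \<subseteq> Hk m" by auto
      show ?case
      proof (cases "A \<in> T\<^sub>0")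
        case True
        with m show ?thesis by (intro exI[of _ m]) (auto simp: Hk_def)
      next
        case False
        with insert obtain k where "A = hk k" by auto
        with m show ?thesis by (intro exI[of _ "max m (Suc k)"]) (auto simp: Hk_def)
      qed
    qed auto
    then obtain m where "F \<subseteq> Hk m" by blast
    then have "F \<subseteq> Hk (max n m)" by (auto simp: Hk_def)
    with der_G_le[OF F(3), of "max n m"] have "der (G (max n m)) (Hk (max n m)) Bot"
      by (auto elim: deriv_weaken)
    with Hk_cons show False by blast
  qed
  then have "?S \<in> ?A" by simp
  have "\<exists>M\<in>?A. \<forall>X\<in>?A. M \<subseteq> X \<longrightarrow> X = M"
  proof (rule subset_Zorn_nonempty)
    show "?A \<noteq> {}" using \<open>?S \<in> ?A\<close> by blast
  next
    fix C assume C: "C \<noteq> {}" "subset.chain ?A C"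
    have "consistent (\<Union>C)"
      unfolding consistent_def
    proof (intro allI notI)
      fix n assume d: "der (G n) (\<Union>C) Bot"
      obtain F where F: "finite F" "F \<subseteq> \<Union>C" "der (G n) F Bot" using deriv_finite[OF d] by blast
      obtain X where "X \<in> C" "F \<subseteq> X"
        using finite_subset_Union_chain[OF F(1,2) C] by blast
      then have "consistent X" "der (G n) X Bot"
        using C(2) deriv_weaken[OF F(3)] by (auto simp: subset.chain_def)
      then show False unfolding consistent_def by blast
    qed
    moreover have "?S \<subseteq> \<Union>C"
    proof -
      obtain X where "X \<in> C" using C(1) by blast
      moreover have "?S \<subseteq> X" using C(2) \<open>X \<in> C\<close> unfolding subset.chain_def by blast
      ultimately show ?thesis by blast
    qed
    ultimately show "\<Union>C \<in> ?A" by simp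
  qed
  then obtain M where M: "M \<in> ?A" "\<forall>X\<in>?A. M \<subseteq> X \<longrightarrow> X = M" by (elim bexE)
  have 1: "?S \<subseteq> M" "consistent M" using M(1) by simp_all
  have "X = M" if "M \<subseteq> X" "consistent X" for X
  proof -
    have "X \<in> ?A" using subset_trans[OF 1(1) that(1)] that(2) by simp
    with M(2) that(1) show ?thesis by blast
  qed
  with 1 show ?thesis by (intro exI[of _ M]) simp
qed

definition M :: "fm set" where
  "M = (SOME M. T\<^sub>0 \<union> range hk \<subseteq> M \<and> consistent M \<and> (\<forall>X. M \<subseteq> X \<and> consistent X \<longrightarrow> X = M))"

lemma M: "T\<^sub>0 \<subseteq> M" "hk n \<in> M" "\<not> der (G n) M Bot" "M \<subseteq> X \<Longrightarrow> consistent X \<Longrightarrow> X = M"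
proof -
  have *: "T\<^sub>0 \<union> range hk \<subseteq> M \<and> consistent M \<and> (\<forall>X. M \<subseteq> X \<and> consistent X \<longrightarrow> X = M)"
    unfolding M_def by (rule someI_ex[OF ex_maximal])
  show "T\<^sub>0 \<subseteq> M" "hk n \<in> M" using * by auto
  show "\<not> der (G n) M Bot" using * unfolding consistent_def by blast
  show "X = M" if "M \<subseteq> X" "consistent X" using * that by blast
qed

definition WF :: "fm \<Rightarrow> bool" where "WF A \<longleftrightarrow> (\<exists>n. wf_fm \<D> (G n) A)"

lemma not_in_M: "A \<notin> M \<Longrightarrow> \<exists>n. der (G n) (insert A M) Bot"
  using M(4)[of "insert A M"] by (auto simp: consistent_def)

lemma M_closed: "der (G n) M A \<Longrightarrow> A \<in> M"
proof (rule ccontr)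
  assume d: "der (G n) M A" and "A \<notin> M"
  from not_in_M[OF this(2)] obtain m where "der (G m) (insert A M) Bot" by blast
  then have "der (G (max n m)) (insert A M) Bot" by (rule der_G_le) simp
  moreover have "der (G (max n m)) M A" using d by (rule der_G_le) simp
  ultimately have "der (G (max n m)) M Bot" by (rule deriv_cut[rotated])
  with M(3) show False by blast
qed

lemma M_Hyp: "A \<in> M \<Longrightarrow> wf_fm \<D> (G n) A \<Longrightarrow> der (G n) M A"
  by (rule deriv.Hyp)

lemma M_Bot: "Bot \<notin> M"
  using M(3) M_Hyp[of Bot 0] by auto

lemma WF_both: "WF A \<Longrightarrow> WF B \<Longrightarrow> \<exists>n. wf_fm \<D> (G n) A \<and> wf_fm \<D> (G n) B"
  unfolding WF_def by (meson max.cobounded1 max.cobounded2 wf_G_le)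

lemma M_Imp:
  assumes "WF A" "WF B"
  shows "(A \<^bold>\<longrightarrow> B) \<in> M \<longleftrightarrow> (A \<in> M \<longrightarrow> B \<in> M)"
proof -
  obtain n where n: "wf_fm \<D> (G n) A" "wf_fm \<D> (G n) B" using WF_both[OF assms] by blast
  show ?thesis
  proof (intro iffI impI)
    assume "(A \<^bold>\<longrightarrow> B) \<in> M" "A \<in> M"
    then have "der (G n) M (A \<^bold>\<longrightarrow> B)" "der (G n) M A" using n by (auto intro: M_Hyp)
    then show "B \<in> M" using M_closed deriv.ImpE by blast
  next
    assume *: "A \<in> M \<longrightarrow> B \<in> M"
    show "(A \<^bold>\<longrightarrow> B) \<in> M"
    proof (cases "A \<in> M")
      case True
      with * have "der (G n) (insert A M) B" using n by (auto intro: deriv.Hyp)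
      then show ?thesis using n M_closed deriv.ImpI by blast
    next
      case False
      then obtain m where "der (G m) (insert A M) Bot" using not_in_M by blast
      then have "der (G (max n m)) (insert A M) B"
        using der_G_le[of m "insert A M" Bot "max n m"] wf_G_le[OF n(2), of "max n m"] deriv_exfalso by auto
      moreover have "wf_fm \<D> (G (max n m)) A" using n(1) by (rule wf_G_le) simp
      ultimately show ?thesis by (intro M_closed[OF deriv.ImpI])
    qed
  qed
qed

definition WT :: "tm \<Rightarrow> ty \<Rightarrow> bool" where "WT t \<tau> \<longleftrightarrow> (\<exists>n. wt \<D> (G n) t \<tau>)"

text \<open>From right to left, a stage is taken at which the variables of \<open>A\<close> are
  already present and \<open>A\<close> is the formula to be witnessed; the witness is one of the
  terms \<open>t\<close>.\<close>

lemma M_All: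
  assumes "WF (All \<tau> A)"
  shows "All \<tau> A \<in> M \<longleftrightarrow> (\<forall>t. WT t \<tau> \<longrightarrow> inst t A \<in> M)"
proof -
  obtain n where n: "wf_fm \<D> (G n) (All \<tau> A)" using assms by (auto simp: WF_def)
  show ?thesis
  proof (intro iffI allI impI)
    fix t assume *: "All \<tau> A \<in> M" and "WT t \<tau>"
    then obtain m where m: "wt \<D> (G m) t \<tau>" by (auto simp: WT_def)
    have "der (G (max n m)) M (All \<tau> A)" using * wf_G_le[OF n, of "max n m"] by (auto intro: M_Hyp)
    then show "inst t A \<in> M" by (rule M_closed[OF deriv.AllE[OF _ wt_G_le[OF m]]]) simp
  next
    assume *: "\<forall>t. WT t \<tau> \<longrightarrow> inst t A \<in> M"
    obtain k where k: "k \<ge> n" "vty k = \<tau>" "vfm k = A" using vwit_inf by blast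
    have wf: "wf_fm \<D> (G k) (All \<tau> A)" using wf_G_le[OF n k(1)] .
    then have hk: "hk k = (inst (Var k) A \<^bold>\<longrightarrow> All \<tau> A)" by (simp add: hk_def k)
    have "wt \<D> (G (Suc k)) (Var k) \<tau>" by (simp add: k)
    then have v: "WT (Var k) \<tau>" unfolding WT_def by blast
    have "WF (inst (Var k) A)" "WF (All \<tau> A)"
      using wf_hk[of k] wf unfolding WF_def hk by auto
    from M_Imp[OF this] M(2)[of k] * v show "All \<tau> A \<in> M" by (simp add: hk)
  qed
qed

lemma WT_unique: "WT t \<sigma> \<Longrightarrow> WT t \<tau> \<Longrightarrow> \<sigma> = \<tau>"
proof -
  assume "WT t \<sigma>" "WT t \<tau>"
  then obtain n m where "wt \<D> (G n) t \<sigma>" "wt \<D> (G m) t \<tau>" by (auto simp: WT_def)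
  then have "wt \<D> (G (max n m)) t \<sigma>" "wt \<D> (G (max n m)) t \<tau>" using wt_G_le by force+
  then show ?thesis by (simp add: wt_def)
qed

lemma WT_both: "WT t \<sigma> \<Longrightarrow> WT u \<tau> \<Longrightarrow> \<exists>n. wt \<D> (G n) t \<sigma> \<and> wt \<D> (G n) u \<tau>"
  unfolding WT_def by (meson max.cobounded1 max.cobounded2 wt_G_le)

lemma WT_App: "WT t (\<sigma> \<rightarrow> \<tau>) \<Longrightarrow> WT u \<sigma> \<Longrightarrow> WT (t \<cdot> u) \<tau>"
proof -
  assume "WT t (\<sigma> \<rightarrow> \<tau>)" "WT u \<sigma>"
  then obtain n where "wt \<D> (G n) t (\<sigma> \<rightarrow> \<tau>)" "wt \<D> (G n) u \<sigma>" using WT_both by blast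
  then have "wt \<D> (G n) (t \<cdot> u) \<tau>" by (simp add: wt_def)
  then show ?thesis unfolding WT_def by blast
qed

lemma WT_closed: "wt \<D> [] t \<tau> \<Longrightarrow> WT t \<tau>"
  unfolding WT_def by (rule exI[of _ 0]) (simp add: G_def)

lemma WT_Con: "in_lang \<D> (Con c) \<Longrightarrow> WT (Con c) (cty c)"
  by (rule WT_closed) (simp add: wt_def)

lemma WT_Len: "WT s (Star \<sigma>) \<Longrightarrow> WT (Con (Len \<sigma>) \<cdot> s) Nat"
  by (rule WT_App[of _ "Star \<sigma>"]) (use WT_Con[of "Len \<sigma>"] in simp_all)

lemma WT_Ent: "WT s (Star \<sigma>) \<Longrightarrow> WT z Nat \<Longrightarrow> WT (Con (Ent \<sigma>) \<cdot> s \<cdot> z) \<sigma>"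
  by (rule WT_App[of _ Nat], rule WT_App[of _ "Star \<sigma>"]) (use WT_Con[of "Ent \<sigma>"] in simp_all)

definition EQ :: "ty \<Rightarrow> tm \<Rightarrow> tm \<Rightarrow> bool" where
  "EQ \<tau> t u \<longleftrightarrow> eq \<tau> t u \<in> M"

lemma WF_eq: "WT t \<tau> \<Longrightarrow> WT u \<tau> \<Longrightarrow> WF (eq \<tau> t u)"
  using WT_both[of t \<tau> u \<tau>] wf_eq unfolding WF_def by blast

lemma WF_lt: "WT t Nat \<Longrightarrow> WT u Nat \<Longrightarrow> WF (lt t u)"
  using WT_both[of t Nat u Nat] wf_lt unfolding WF_def by blast

lemma WF_Imp [simp]: "WF (A \<^bold>\<longrightarrow> B) \<longleftrightarrow> WF A \<and> WF B"
  using WF_both by (auto simp: WF_def)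

lemma WF_Bot [simp]: "WF Bot"
  by (simp add: WF_def)

lemma EQ_Fun:
  assumes "WT t (\<sigma> \<rightarrow> \<tau>)" "WT u (\<sigma> \<rightarrow> \<tau>)"
  shows "EQ (\<sigma> \<rightarrow> \<tau>) t u \<longleftrightarrow> (\<forall>z. WT z \<sigma> \<longrightarrow> EQ \<tau> (t \<cdot> z) (u \<cdot> z))"
  using M_All[of \<sigma> "eq \<tau> (tlift t \<cdot> Var 0) (tlift u \<cdot> Var 0)"] WF_eq[OF assms]
  by (simp add: EQ_def fsub_eq tsub_tsub)

lemma fsub_lt: "fsub s (lt t u) = lt (tsub s t) (tsub s u)"
  by (simp add: lt_def tsub_closed[OF ty_of_subT])

lemma EQ_Star:
  assumes "WT t (Star \<sigma>)" "WT u (Star \<sigma>)"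
  shows "EQ (Star \<sigma>) t u \<longleftrightarrow> EQ Nat (Con (Len \<sigma>) \<cdot> t) (Con (Len \<sigma>) \<cdot> u) \<and>
    (\<forall>z. WT z Nat \<longrightarrow> lt z (Con (Len \<sigma>) \<cdot> t) \<in> M \<longrightarrow> EQ \<sigma> (Con (Ent \<sigma>) \<cdot> t \<cdot> z) (Con (Ent \<sigma>) \<cdot> u \<cdot> z))"
proof -
  let ?A = "lt (Var 0) (Con (Len \<sigma>) \<cdot> tlift t) \<^bold>\<longrightarrow>
        eq \<sigma> (Con (Ent \<sigma>) \<cdot> tlift t \<cdot> Var 0) (Con (Ent \<sigma>) \<cdot> tlift u \<cdot> Var 0)"
  note L = WT_Len WT_Ent
  have wf: "WF (eq (Star \<sigma>) t u)" by (rule WF_eq[OF assms])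
  then have wA: "WF (All Nat ?A)" and wE: "WF (Con (Len \<sigma>) \<cdot> t \<doteq> Con (Len \<sigma>) \<cdot> u)" by auto
  have "EQ (Star \<sigma>) t u \<longleftrightarrow> (Con (Len \<sigma>) \<cdot> t \<doteq> Con (Len \<sigma>) \<cdot> u) \<in> M \<and> All Nat ?A \<in> M"
    using wA wE M_Bot by (simp add: EQ_def M_Imp)
  also have "All Nat ?A \<in> M \<longleftrightarrow> (\<forall>z. WT z Nat \<longrightarrow> inst z ?A \<in> M)" by (rule M_All[OF wA])
  also have "\<dots> \<longleftrightarrow> (\<forall>z. WT z Nat \<longrightarrow> lt z (Con (Len \<sigma>) \<cdot> t) \<in> M \<longrightarrow>
      EQ \<sigma> (Con (Ent \<sigma>) \<cdot> t \<cdot> z) (Con (Ent \<sigma>) \<cdot> u \<cdot> z))"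
    using L[OF assms(1)] L[OF assms(2)]
    by (auto simp: fsub_lt fsub_eq tsub_tsub M_Imp WF_lt WF_eq EQ_def)
  finally show ?thesis by (simp add: EQ_def)
qed

lemma M_subst:
  assumes "EQ Nat t u" "WT t Nat" "WT u Nat" "wf_fm \<D> (Nat # G n) A" "inst t A \<in> M"
  shows "inst u A \<in> M"
proof -
  obtain m where m: "wt \<D> (G m) t Nat" "wt \<D> (G m) u Nat" using WT_both assms(2,3) by blast
  define k where "k = max n m"
  have tk: "wt \<D> (G k) t Nat" and uk: "wt \<D> (G k) u Nat"
    using m wt_G_le[of m _ Nat k] by (auto simp: k_def)
  have wf: "wf_fm \<D> (Nat # G k) A"
    using wf_G_le[of n "All Nat A" k] assms(4) by (simp add: k_def)
  have "der (G k) M (t \<doteq> u)" using assms(1) tk uk by (intro M_Hyp) (auto simp: EQ_def)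
  moreover have "der (G k) M (inst t A)" using assms(5) wf tk by (intro M_Hyp) (auto simp: wf_inst)
  ultimately show ?thesis using wf M_closed deriv.EqE by blast
qed

lemma EQ_refl: "WT t \<tau> \<Longrightarrow> EQ \<tau> t t"
proof (induction \<tau> arbitrary: t)
  case Nat
  then obtain n where "wt \<D> (G n) t Nat" by (auto simp: WT_def)
  then show ?case using M_closed[OF deriv.EqI] by (simp add: EQ_def)
next
  case (Fun \<sigma> \<tau>)
  then show ?case by (auto simp: EQ_Fun intro: WT_App)
next
  case (Star \<sigma>)
  note L = WT_Len[OF Star.prems] WT_Ent[OF Star.prems]
  obtain n where "wt \<D> (G n) (Con (Len \<sigma>) \<cdot> t) Nat" using L by (auto simp: WT_def)
  then have "EQ Nat (Con (Len \<sigma>) \<cdot> t) (Con (Len \<sigma>) \<cdot> t)" using M_closed[OF deriv.EqI] by (simp add: EQ_def)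
  with Star L show ?case by (auto simp: EQ_Star)
qed

lemma EQ_Nat_sym: "EQ Nat t u \<Longrightarrow> WT t Nat \<Longrightarrow> WT u Nat \<Longrightarrow> EQ Nat u t"
proof -
  assume *: "EQ Nat t u" "WT t Nat" "WT u Nat"
  then obtain n where n: "wt \<D> (G n) t Nat" by (auto simp: WT_def)
  have "inst u (Var 0 \<doteq> tlift t) \<in> M"
    by (rule M_subst[OF *, of n]) (use n EQ_refl[OF *(2)] wt_tlift[OF n] in \<open>auto simp: EQ_def tsub_tsub\<close>)
  then show ?thesis by (simp add: EQ_def tsub_tsub)
qed

lemma EQ_Nat_trans: "EQ Nat t u \<Longrightarrow> EQ Nat u v \<Longrightarrow> WT t Nat \<Longrightarrow> WT u Nat \<Longrightarrow> WT v Nat \<Longrightarrow> EQ Nat t v"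
proof -
  assume *: "EQ Nat t u" "EQ Nat u v" "WT t Nat" "WT u Nat" "WT v Nat"
  then obtain n where n: "wt \<D> (G n) t Nat" by (auto simp: WT_def)
  have "inst v (tlift t \<doteq> Var 0) \<in> M"
    by (rule M_subst[OF *(2) *(4,5), of n]) (use n * wt_tlift[OF n] in \<open>auto simp: EQ_def tsub_tsub\<close>)
  then show ?thesis by (simp add: EQ_def tsub_tsub)
qed

lemma lt_subst: "EQ Nat t u \<Longrightarrow> WT t Nat \<Longrightarrow> WT u Nat \<Longrightarrow> WT z Nat \<Longrightarrow> lt z t \<in> M \<Longrightarrow> lt z u \<in> M"
proof -
  assume *: "EQ Nat t u" "WT t Nat" "WT u Nat" "WT z Nat" "lt z t \<in> M"
  then obtain n where n: "wt \<D> (G n) z Nat" by (auto simp: WT_def)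
  have "inst u (lt (tlift z) (Var 0)) \<in> M"
    by (rule M_subst[OF *(1-3), of n]) (use n * wt_tlift[OF n] in \<open>auto simp: fsub_lt tsub_tsub wf_lt\<close>)
  then show ?thesis by (simp add: fsub_lt tsub_tsub)
qed

lemma EQ_sym: "EQ \<tau> t u \<Longrightarrow> WT t \<tau> \<Longrightarrow> WT u \<tau> \<Longrightarrow> EQ \<tau> u t"
proof (induction \<tau> arbitrary: t u)
  case Nat
  then show ?case by (rule EQ_Nat_sym)
next
  case (Fun \<sigma> \<tau>)
  show ?case unfolding EQ_Fun[OF Fun.prems(3,2)]
  proof (intro allI impI)
    fix z assume z: "WT z \<sigma>"
    show "EQ \<tau> (u \<cdot> z) (t \<cdot> z)"
      by (rule Fun.IH(2)) (use Fun.prems z in \<open>auto simp: EQ_Fun intro: WT_App\<close>)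
  qed
next
  case (Star \<sigma>)
  note L = WT_Len WT_Ent
  note s = Star.prems(1)[unfolded EQ_Star[OF Star.prems(2,3)]]
  note L' = L(1)[OF Star.prems(2)] L(1)[OF Star.prems(3)]
  show ?case unfolding EQ_Star[OF Star.prems(3,2)]
  proof (intro conjI allI impI)
    show *: "EQ Nat (Con (Len \<sigma>) \<cdot> u) (Con (Len \<sigma>) \<cdot> t)"
      by (rule EQ_Nat_sym[OF conjunct1[OF s] L'])
    fix z assume z: "WT z Nat" "lt z (Con (Len \<sigma>) \<cdot> u) \<in> M"
    then have z': "lt z (Con (Len \<sigma>) \<cdot> t) \<in> M" by (intro lt_subst[OF * L'(2,1)])
    show "EQ \<sigma> (Con (Ent \<sigma>) \<cdot> u \<cdot> z) (Con (Ent \<sigma>) \<cdot> t \<cdot> z)"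
      by (rule Star.IH[OF conjunct2[OF s, rule_format, OF z(1) z']])
        (fact L(2)[OF Star.prems(2) z(1)] L(2)[OF Star.prems(3) z(1)])+
  qed
qed

lemma EQ_trans: "EQ \<tau> t u \<Longrightarrow> EQ \<tau> u v \<Longrightarrow> WT t \<tau> \<Longrightarrow> WT u \<tau> \<Longrightarrow> WT v \<tau> \<Longrightarrow> EQ \<tau> t v"
proof (induction \<tau> arbitrary: t u v)
  case Nat
  then show ?case by (auto intro: EQ_Nat_trans)
next
  case (Fun \<sigma> \<tau>)
  show ?case unfolding EQ_Fun[OF Fun.prems(3,5)]
  proof (intro allI impI)
    fix z assume z: "WT z \<sigma>"
    show "EQ \<tau> (t \<cdot> z) (v \<cdot> z)"
      by (rule Fun.IH(2)[of _ "u \<cdot> z"]) (use Fun.prems z in \<open>auto simp: EQ_Fun intro: WT_App\<close>)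
  qed
next
  case (Star \<sigma>)
  note L = WT_Len WT_Ent
  note s = Star.prems(1)[unfolded EQ_Star[OF Star.prems(3,4)]]
    Star.prems(2)[unfolded EQ_Star[OF Star.prems(4,5)]]
  show ?case unfolding EQ_Star[OF Star.prems(3,5)]
  proof (intro conjI allI impI)
    note L' = L(1)[OF Star.prems(3)] L(1)[OF Star.prems(4)] L(1)[OF Star.prems(5)]
    show "EQ Nat (Con (Len \<sigma>) \<cdot> t) (Con (Len \<sigma>) \<cdot> v)"
      by (rule EQ_Nat_trans[OF conjunct1[OF s(1)] conjunct1[OF s(2)] L'])
    fix z assume z: "WT z Nat" "lt z (Con (Len \<sigma>) \<cdot> t) \<in> M"
    then have z': "lt z (Con (Len \<sigma>) \<cdot> u) \<in> M"
      by (intro lt_subst[OF conjunct1[OF s(1)] L'(1,2)])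
    show "EQ \<sigma> (Con (Ent \<sigma>) \<cdot> t \<cdot> z) (Con (Ent \<sigma>) \<cdot> v \<cdot> z)"
      by (rule Star.IH[OF conjunct2[OF s(1), rule_format, OF z] conjunct2[OF s(2), rule_format, OF z(1) z']])
        (fact L(2)[OF Star.prems(3) z(1)] L(2)[OF Star.prems(4) z(1)] L(2)[OF Star.prems(5) z(1)])+
  qed
qed

definition senv :: "ctx \<Rightarrow> (nat \<Rightarrow> tm) \<Rightarrow> bool" where
  "senv \<Gamma> s \<longleftrightarrow> (\<forall>i < length \<Gamma>. WT (s i) (\<Gamma> ! i))"

lemma senv_Cons: "WT t \<tau> \<Longrightarrow> senv \<Gamma> s \<Longrightarrow> senv (\<tau> # \<Gamma>) (case_nat t s)"
  by (auto simp: senv_def less_Suc_eq_0_disj)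

lemma senv_typed_sub: "senv \<Gamma> s \<Longrightarrow> \<exists>n. typed_sub \<D> \<Gamma> (G n) s"
proof (induction \<Gamma> arbitrary: s)
  case (Cons \<tau> \<Gamma>)
  then have "WT (s 0) \<tau>" "senv \<Gamma> (\<lambda>i. s (Suc i))" by (force simp: senv_def)+
  moreover obtain m where "typed_sub \<D> \<Gamma> (G m) (\<lambda>i. s (Suc i))"
    using Cons.IH[OF calculation(2)] by blast
  ultimately obtain n m where nm: "wt \<D> (G n) (s 0) \<tau>" "typed_sub \<D> \<Gamma> (G m) (\<lambda>i. s (Suc i))"
    by (auto simp: WT_def)
  have "typed_sub \<D> (\<tau> # \<Gamma>) (G (max n m)) s"
    unfolding typed_sub_def
  proof (intro allI impI)
    fix i assume "i < length (\<tau> # \<Gamma>)"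
    then show "wt \<D> (G (max n m)) (s i) ((\<tau> # \<Gamma>) ! i)"
      using nm wt_G_le[of n _ _ "max n m"] wt_G_le[of m _ _ "max n m"]
      by (cases i) (auto simp: typed_sub_def)
  qed
  then show ?case by blast
qed (simp add: typed_sub_def)

lemma WT_tsub: "wt \<D> \<Gamma> t \<tau> \<Longrightarrow> senv \<Gamma> s \<Longrightarrow> WT (tsub s t) \<tau>"
  using senv_typed_sub[of \<Gamma> s] wt_tsub[of \<D> \<Gamma> t \<tau>] by (auto simp: WT_def)

lemma WF_fsub: "wf_fm \<D> \<Gamma> A \<Longrightarrow> senv \<Gamma> s \<Longrightarrow> WF (fsub s A)"
  using senv_typed_sub[of \<Gamma> s] wf_fsub[of \<D> \<Gamma> A] by (auto simp: WF_def)

lemma M_All_fsub: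
  assumes "wf_fm \<D> \<Gamma> (All \<tau> A)" "senv \<Gamma> s"
  shows "fsub s (All \<tau> A) \<in> M \<longleftrightarrow> (\<forall>t. WT t \<tau> \<longrightarrow> fsub (case_nat t s) A \<in> M)"
  using M_All[of \<tau> "fsub (up s) A"] WF_fsub[OF assms] by (simp add: inst_up)

lemma M_All_closed:
  assumes "wf_fm \<D> [] (All \<tau> A)"
  shows "All \<tau> A \<in> M \<longleftrightarrow> (\<forall>t. WT t \<tau> \<longrightarrow> inst t A \<in> M)"
  using M_All_fsub[OF assms, of Var] by (simp add: senv_def)

end

section \<open>The term model modulo extensional equality\<close>

locale henkin_ext = henkin +
  assumes Ext_T\<^sub>0: "All (\<rho> \<rightarrow> \<tau>) (All \<rho> (All \<rho>
      (eq \<rho> (Var 1) (Var 0) \<^bold>\<longrightarrow> eq \<tau> (Var 2 \<cdot> Var 1) (Var 2 \<cdot> Var 0)))) \<in> T\<^sub>0"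
    and St_eq_T\<^sub>0: "All \<tau> (All \<tau> (St \<tau> (Var 1) \<^bold>\<and> eq \<tau> (Var 1) (Var 0) \<^bold>\<longrightarrow> St \<tau> (Var 0))) \<in> T\<^sub>0"
begin

text \<open>This half of the congruence property is exactly the extensionality axiom; the half for
  the function is built into the definition of \<open>eq\<close>.\<close>

lemma EQ_arg:
  assumes f: "WT f (\<rho> \<rightarrow> \<tau>)" and a: "WT a \<rho>" and b: "WT b \<rho>" and "EQ \<rho> a b"
  shows "EQ \<tau> (f \<cdot> a) (f \<cdot> b)"
proof -
  let ?A = "eq \<rho> (Var 1) (Var 0) \<^bold>\<longrightarrow> eq \<tau> (Var 2 \<cdot> Var 1) (Var 2 \<cdot> Var 0)"
  have wf: "wf_fm \<D> [] (All (\<rho> \<rightarrow> \<tau>) (All \<rho> (All \<rho> ?A)))" by (rule T\<^sub>0_wf[OF Ext_T\<^sub>0])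
  have s: "senv [\<rho> \<rightarrow> \<tau>] (case_nat f Var)" "senv [\<rho>, \<rho> \<rightarrow> \<tau>] (case_nat a (case_nat f Var))"
    using f a by (auto simp: senv_def less_Suc_eq_0_disj)
  have "fsub (case_nat b (case_nat a (case_nat f Var))) ?A \<in> M"
    using Ext_T\<^sub>0[of \<rho> \<tau>] M(1) wf f a b M_All_closed[OF wf] M_All_fsub[OF _ s(1), of \<rho> "All \<rho> ?A"]
      M_All_fsub[OF _ s(2), of \<rho> ?A] by auto
  moreover have "WF (eq \<rho> a b)" "WF (eq \<tau> (f \<cdot> a) (f \<cdot> b))"
    using f a b by (auto intro!: WF_eq WT_App)
  ultimately show ?thesis using assms(4) by (simp add: fsub_eq M_Imp EQ_def)
qed

lemma EQ_App:
  assumes f: "WT f (\<rho> \<rightarrow> \<tau>)" "WT g (\<rho> \<rightarrow> \<tau>)" and a: "WT a \<rho>" "WT b \<rho>"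
    and "EQ (\<rho> \<rightarrow> \<tau>) f g" "EQ \<rho> a b"
  shows "EQ \<tau> (f \<cdot> a) (g \<cdot> b)"
proof (rule EQ_trans)
  show "EQ \<tau> (f \<cdot> a) (f \<cdot> b)" by (rule EQ_arg[OF f(1) a assms(6)])
  show "EQ \<tau> (f \<cdot> b) (g \<cdot> b)" using assms by (simp add: EQ_Fun)
qed (use assms in \<open>auto intro: WT_App\<close>)

lemma WF_St: "WT t \<tau> \<Longrightarrow> WF (St \<tau> t)"
  by (auto simp: WF_def WT_def)

lemma St_EQ:
  assumes a: "WT a \<tau>" and b: "WT b \<tau>" and "EQ \<tau> a b" "St \<tau> a \<in> M"
  shows "St \<tau> b \<in> M"
proof -
  let ?A = "St \<tau> (Var 1) \<^bold>\<and> eq \<tau> (Var 1) (Var 0) \<^bold>\<longrightarrow> St \<tau> (Var 0)"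
  have wf: "wf_fm \<D> [] (All \<tau> (All \<tau> ?A))" by (rule T\<^sub>0_wf[OF St_eq_T\<^sub>0])
  have s: "senv [\<tau>] (case_nat a Var)"
    using a by (auto simp: senv_def less_Suc_eq_0_disj)
  have "fsub (case_nat b (case_nat a Var)) ?A \<in> M"
    using St_eq_T\<^sub>0[of \<tau>] M(1) wf a b M_All_closed[OF wf] M_All_fsub[OF _ s(1), of \<tau> ?A] by auto
  moreover have "WF (eq \<tau> a b)" "WF (St \<tau> a)" "WF (St \<tau> b)"
    using a b by (auto intro!: WF_eq WF_St)
  ultimately show ?thesis using assms(3,4) M_Bot by (simp add: fsub_eq M_Imp EQ_def)
qed

definition Tt :: "tm \<Rightarrow> ty" where
  "Tt t = (THE \<tau>. WT t \<tau>)"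

lemma Tt: "WT t \<tau> \<Longrightarrow> Tt t = \<tau>"
  unfolding Tt_def using WT_unique by blast

text \<open>Chosen representatives in place of equivalence classes keep the universe a set of terms,
  the type over which \<open>completeness\<close> quantifies its models.\<close>

definition rep :: "tm \<Rightarrow> tm" where
  "rep t = (SOME u. WT u (Tt t) \<and> EQ (Tt t) t u)"

lemma rep:
  assumes "WT t \<tau>" shows "WT (rep t) \<tau>" "EQ \<tau> t (rep t)"
proof -
  have "WT t (Tt t) \<and> EQ (Tt t) t t" using assms Tt EQ_refl by metis
  then have "WT (rep t) (Tt t) \<and> EQ (Tt t) t (rep t)" unfolding rep_def by (rule someI)
  then show "WT (rep t) \<tau>" "EQ \<tau> t (rep t)" using Tt[OF assms] by auto
qed

lemma rep_eq_iff:
  assumes "WT t \<tau>" "WT u \<tau>" shows "rep t = rep u \<longleftrightarrow> EQ \<tau> t u"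
proof
  assume "rep t = rep u"
  then show "EQ \<tau> t u" using rep[OF assms(1)] rep[OF assms(2)] assms EQ_sym EQ_trans by metis
next
  assume *: "EQ \<tau> t u"
  have "(WT v \<tau> \<and> EQ \<tau> t v) \<longleftrightarrow> (WT v \<tau> \<and> EQ \<tau> u v)" for v
    using assms * EQ_sym EQ_trans by metis
  then show "rep t = rep u" unfolding rep_def Tt[OF assms(1)] Tt[OF assms(2)] by simp
qed

lemma rep_rep: "WT t \<tau> \<Longrightarrow> rep (rep t) = rep t"
  using rep_eq_iff[of "rep t" \<tau> t] rep[of t \<tau>] EQ_sym[of \<tau> t "rep t"] by simp

definition univ :: "tm set" where "univ = {t. rep t = t \<and> (\<exists>\<tau>. WT t \<tau>)}"
definition rap :: "tm \<Rightarrow> tm \<Rightarrow> tm" where "rap t u = rep (t \<cdot> u)"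
definition rcon :: "cst \<Rightarrow> tm" where "rcon c = rep (Con c)"
definition rst :: "tm \<Rightarrow> bool" where "rst t \<longleftrightarrow> St (Tt t) t \<in> M"

sublocale fm_structure univ Tt rap rcon rst .

lemma dom_iff: "t \<in> dom \<tau> \<longleftrightarrow> WT t \<tau> \<and> rep t = t"
  unfolding dom_def by (auto simp: univ_def dest: Tt)

lemma rep_dom: "WT t \<tau> \<Longrightarrow> rep t \<in> dom \<tau>"
  using rep rep_rep by (simp add: dom_iff)

lemma rap_rep: "WT t (\<sigma> \<rightarrow> \<tau>) \<Longrightarrow> WT u \<sigma> \<Longrightarrow> rap (rep t) (rep u) = rep (t \<cdot> u)"
proof -
  assume *: "WT t (\<sigma> \<rightarrow> \<tau>)" "WT u \<sigma>"
  note r = rep[OF *(1)] rep[OF *(2)]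
  have "EQ \<tau> (rep t \<cdot> rep u) (t \<cdot> u)"
    using r * by (intro EQ_App[of _ \<sigma> \<tau>] EQ_sym[of _ t] EQ_sym[of _ u]) auto
  then show ?thesis unfolding rap_def
    using r * by (subst rep_eq_iff[of _ \<tau>]) (auto intro: WT_App)
qed

lemma ev_rep: "wt \<D> \<Gamma> t \<tau> \<Longrightarrow> senv \<Gamma> s \<Longrightarrow> ev (\<lambda>i. rep (s i)) t = rep (tsub s t)"
proof (induction t arbitrary: \<tau>)
  case (App t u)
  then obtain \<sigma> where *: "wt \<D> \<Gamma> t (\<sigma> \<rightarrow> \<tau>)" "wt \<D> \<Gamma> u \<sigma>"
    unfolding wt_def ty_of_App by auto
  then have "WT (tsub s t) (\<sigma> \<rightarrow> \<tau>)" "WT (tsub s u) \<sigma>" using WT_tsub App.prems by blast+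
  with App * show ?case by (simp add: rap_rep)
qed (auto simp: rcon_def)

lemma truth: "wf_fm \<D> \<Gamma> A \<Longrightarrow> senv \<Gamma> s \<Longrightarrow> sat (\<lambda>i. rep (s i)) A \<longleftrightarrow> fsub s A \<in> M"
proof (induction A arbitrary: \<Gamma> s)
  case (Eq t u)
  then have "WT (tsub s t) Nat" "WT (tsub s u) Nat" using WT_tsub by auto
  with Eq show ?case
    by (simp add: ev_rep[of \<Gamma> _ Nat] rep_eq_iff[of _ Nat]) (simp add: EQ_def)
next
  case (St \<tau> t)
  then have *: "WT (tsub s t) \<tau>" using WT_tsub by auto
  note r = rep[OF *]
  have "rst (rep (tsub s t)) \<longleftrightarrow> St \<tau> (tsub s t) \<in> M"
    unfolding rst_def Tt[OF r(1)] using r * St_EQ EQ_sym by blast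
  with St show ?case by (simp add: ev_rep)
next
  case Bot
  then show ?case by (simp add: M_Bot)
next
  case (Imp A B)
  then have "WF (fsub s A)" "WF (fsub s B)" using WF_fsub by auto
  with Imp.IH[of \<Gamma> s] Imp.prems show ?case by (simp add: M_Imp)
next
  case (All \<tau> A)
  have wf: "wf_fm \<D> (\<tau> # \<Gamma>) A" using All.prems by simp
  have r: "(\<lambda>i. rep (case_nat t s i)) = case_nat (rep t) (\<lambda>i. rep (s i))" for t
    by (auto split: nat.split)
  have "sat (\<lambda>i. rep (s i)) (All \<tau> A) \<longleftrightarrow> (\<forall>t. WT t \<tau> \<longrightarrow> sat (case_nat (rep t) (\<lambda>i. rep (s i))) A)"
    using rep_dom by (auto simp: dom_iff)
  also have "\<dots> \<longleftrightarrow> (\<forall>t. WT t \<tau> \<longrightarrow> fsub (case_nat t s) A \<in> M)"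
    using All.IH[OF wf senv_Cons[OF _ All.prems(2)]] by (simp add: r)
  also have "\<dots> \<longleftrightarrow> fsub s (All \<tau> A) \<in> M" using M_All_fsub[OF All.prems] by simp
  finally show ?case .
qed

lemma sat_closed: "wf_fm \<D> [] A \<Longrightarrow> sat e A \<longleftrightarrow> A \<in> M"
  using sat_cong[of \<D> "[]" A e "\<lambda>i. rep (Var i)"] truth[of "[]" A Var] by (simp add: senv_def)

end

text \<open>If \<open>A\<close> were not derivable, its negation would be consistent with all closed
  theorems, and the term model would refute \<open>A\<close>. That \<open>Ax\<close> contains
  \<open>RCAOmega\<close> provides extensionality and the invariance of standardness under equality,
  on which the identification of terms rests.\<close>

theorem completeness:
  assumes wf: "wf_fm \<D> [] A"
    and Ax: "\<And>\<Gamma>. RCAOmega \<D> \<Gamma> \<subseteq> Ax \<Gamma>"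
    and models: "\<And>(U :: tm set) T ap con st e. ext_model U T ap con st \<D> Ax \<Longrightarrow> fm_structure.sat U T ap con st e A"
  shows "proves \<D> Ax A"
proof (rule ccontr)
  assume not: "\<not> proves \<D> Ax A"
  define T\<^sub>0 where "T\<^sub>0 = insert (\<^bold>\<not> A) {B. proves \<D> Ax B}"
  have ax: "B \<in> T\<^sub>0" if "B \<in> RCAOmega \<D> []" "wf_fm \<D> [] B" for B
    using that Ax unfolding T\<^sub>0_def proves_def by (auto intro: deriv.Axiom)
  interpret henkin_ext \<D> T\<^sub>0
  proof
    show "wf_fm \<D> [] B" if "B \<in> T\<^sub>0" for B
      using that wf by (auto simp: T\<^sub>0_def proves_def dest: deriv_wf)
    show "\<not> deriv \<D> (\<lambda>_. {}) [] T\<^sub>0 Bot"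
    proof
      assume "deriv \<D> (\<lambda>_. {}) [] T\<^sub>0 Bot"
      then have "deriv \<D> (\<lambda>_. {}) [] {B. proves \<D> Ax B} A"
        unfolding T\<^sub>0_def by (rule deriv.Classical[OF wf])
      then have "proves \<D> Ax A"
        unfolding proves_def by (rule deriv_theorems) simp
      with not show False ..
    qed
    fix \<rho> \<tau>
    show "All (\<rho> \<rightarrow> \<tau>) (All \<rho> (All \<rho>
      (eq \<rho> (Var 1) (Var 0) \<^bold>\<longrightarrow> eq \<tau> (Var 2 \<cdot> Var 1) (Var 2 \<cdot> Var 0)))) \<in> T\<^sub>0"
      by (rule ax, rule RCAOmega.Base, rule RCAw.Ext) (auto intro!: wf_eq simp: wt_def)
    show "All \<tau> (All \<tau> (St \<tau> (Var 1) \<^bold>\<and> eq \<tau> (Var 1) (Var 0) \<^bold>\<longrightarrow> St \<tau> (Var 0))) \<in> T\<^sub>0"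
      by (rule ax, rule RCAOmega.St_eq) (auto intro!: wf_eq simp: wt_def)
  qed
  interpret ext_model univ Tt rap rcon rst \<D> Ax
  proof
    show "rcon c \<in> dom (cty c)" if "in_lang \<D> (Con c)" for c
      unfolding rcon_def by (rule rep_dom[OF WT_Con[OF that]])
    show "rap f a \<in> dom \<tau>" if "f \<in> dom (\<sigma> \<rightarrow> \<tau>)" "a \<in> dom \<sigma>" for f a \<sigma> \<tau>
      unfolding rap_def using that by (auto simp: dom_iff[of f] dom_iff[of a] intro: rep_dom WT_App)
    show "sat e B" if "proves \<D> Ax B" for e B
    proof -
      have "B \<in> T\<^sub>0" using that by (simp add: T\<^sub>0_def)
      then show ?thesis using sat_closed[OF T\<^sub>0_wf] M(1) by blast
    qed
    fix a b \<tau> e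
    assume "a \<in> dom \<tau>" "b \<in> dom \<tau>"
    then have wt: "WT a \<tau>" "WT b \<tau>" and r: "rep a = a" "rep b = b" by (simp_all add: dom_iff)
    have wf: "wf_fm \<D> [\<tau>, \<tau>] (eq \<tau> (Var 1) (Var 0))" by (rule wf_eq) simp_all
    have "sat (case_nat b (case_nat a e)) (eq \<tau> (Var 1) (Var 0)) \<longleftrightarrow>
        sat (\<lambda>i. rep (case_nat b (case_nat a Var) i)) (eq \<tau> (Var 1) (Var 0))"
      by (rule sat_cong[OF wf]) (use r in \<open>auto simp: less_Suc_eq\<close>)
    also have "\<dots> \<longleftrightarrow> EQ \<tau> a b"
      using wt by (subst truth[OF wf]) (auto simp: senv_def less_Suc_eq fsub_eq EQ_def)
    also have "\<dots> \<longleftrightarrow> a = b" using rep_eq_iff[OF wt] r by simp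
    finally show "sat (case_nat b (case_nat a e)) (eq \<tau> (Var 1) (Var 0)) \<longleftrightarrow> a = b" .
  qed
  have "sat Var A" by (rule models) (rule ext_model_axioms)
  moreover have "\<^bold>\<not> A \<in> M" using M(1) by (auto simp: T\<^sub>0_def)
  ultimately show False using sat_closed[of "\<^bold>\<not> A" Var] wf by simp
qed

section \<open>Evaluation of combinatory terms\<close>

text \<open>\<open>app_ok\<close> and \<open>res\<close> are computable forms of the typing
  conditions, which the simplifier can discharge for concrete types.\<close>

fun app_ok :: "ty \<Rightarrow> ty \<Rightarrow> bool" where
  "app_ok (\<sigma> \<rightarrow> \<tau>) \<rho> \<longleftrightarrow> \<sigma> = \<rho>"
| "app_ok _ _ \<longleftrightarrow> False"

fun res :: "ty \<Rightarrow> ty" where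
  "res (\<sigma> \<rightarrow> \<tau>) = \<tau>"
| "res \<tau> = \<tau>"

declare lam.simps [simp del]

lemma in_lang_lam [simp]: "in_lang \<D> (lam \<Gamma> \<sigma> t) \<longleftrightarrow> in_lang \<D> t"
proof (induction t)
  case (App t u)
  have "in_lang \<D> (tsub (\<lambda>n. Var (n - 1)) t) = in_lang \<D> t" for t
  proof (induction t)
    case (Con c)
    then show ?case by (cases c) auto
  qed auto
  with App show ?case by (simp add: lam.simps)
qed (auto simp: lam.simps split: nat.split)

lemma not_occurs0_tsub:
  "\<not> occurs0 t \<Longrightarrow> ty_of (\<sigma> # \<Gamma>) t = Some \<tau> \<Longrightarrow> ty_of \<Gamma> (tsub (\<lambda>n. Var (n - 1)) t) = Some \<tau>"
proof (induction t arbitrary: \<tau>)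
  case (Var n)
  then show ?case by (cases n) (auto split: if_splits)
next
  case (App t u)
  then show ?case unfolding ty_of_App tsub.simps by auto
qed simp

lemma ty_of_lam_Some: "ty_of (\<sigma> # \<Gamma>) t = Some \<tau> \<Longrightarrow> ty_of \<Gamma> (lam \<Gamma> \<sigma> t) = Some (\<sigma> \<rightarrow> \<tau>)"
proof (induction t arbitrary: \<tau>)
  case (Var n)
  then show ?case by (cases n) (auto simp: lam.simps split: if_splits)
next
  case (App t u)
  obtain \<rho> where *: "ty_of (\<sigma> # \<Gamma>) t = Some (\<rho> \<rightarrow> \<tau>)" "ty_of (\<sigma> # \<Gamma>) u = Some \<rho>"
    using App.prems unfolding ty_of_App by blast
  show ?case
  proof (cases "occurs0 (t \<cdot> u)")
    case True
    with * App.IH show ?thesis by (simp add: lam.simps)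
  next
    case False
    note not_occurs0_tsub[OF False App.prems]
    with False App.prems show ?thesis by (simp only: lam.simps if_False) simp
  qed
qed (simp add: lam.simps)

lemma ty_of_lam [simp]:
  "ty_of (\<sigma> # \<Gamma>) t \<noteq> None \<Longrightarrow> ty_of \<Gamma> (lam \<Gamma> \<sigma> t) = Some (\<sigma> \<rightarrow> the (ty_of (\<sigma> # \<Gamma>) t))"
  using ty_of_lam_Some by auto

primrec occ :: "nat \<Rightarrow> tm \<Rightarrow> bool" where
  "occ n (Var m) \<longleftrightarrow> n = m"
| "occ n (Con c) \<longleftrightarrow> False"
| "occ n (t \<cdot> u) \<longleftrightarrow> occ n t \<or> occ n u"

lemma occ_closed: "ty_of [] t = Some \<tau> \<Longrightarrow> \<not> occ n t"
proof (induction t arbitrary: \<tau>)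
  case (App t u)
  then show ?case unfolding ty_of_App by auto
qed simp_all

lemma occ_lam [simp]: "occ n (lam \<Gamma> \<sigma> t) \<longleftrightarrow> occ (Suc n) t"
proof (induction t)
  case (App t u)
  have "\<not> occurs0 t \<Longrightarrow> occ n (tsub (\<lambda>n. Var (n - 1)) t) \<longleftrightarrow> occ (Suc n) t" for t
    by (induction t) auto
  with App show ?case by (simp add: lam.simps)
qed (auto simp: lam.simps split: nat.split)

section \<open>Models of the nonstandard theory\<close>

locale omega_model = ext_model U T ap con st \<D> Ax
  for U :: "'a set" and T :: "'a \<Rightarrow> ty" and ap :: "'a \<Rightarrow> 'a \<Rightarrow> 'a" (infixl "\<bullet>" 90)
    and con :: "cst \<Rightarrow> 'a" and st :: "'a \<Rightarrow> bool" and \<D> :: specs and Ax :: "ctx \<Rightarrow> fm set" +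
  assumes Ax: "RCAOmega \<D> \<Gamma> \<subseteq> Ax \<Gamma>"
begin

lemma dom_iff [simp]: "a \<in> dom \<tau> \<longleftrightarrow> a \<in> U \<and> T a = \<tau>"
  by (simp add: dom_def)

lemma ap_U [simp]: "f \<in> U \<Longrightarrow> a \<in> U \<Longrightarrow> app_ok (T f) (T a) \<Longrightarrow> f \<bullet> a \<in> U"
  and T_ap [simp]: "f \<in> U \<Longrightarrow> a \<in> U \<Longrightarrow> app_ok (T f) (T a) \<Longrightarrow> T (f \<bullet> a) = res (T f)"
  using ap_dom[of f "T a" "res (T f)" a] by (cases "T f"; simp)+

definition env :: "ctx \<Rightarrow> (nat \<Rightarrow> 'a) \<Rightarrow> bool" where
  "env \<Gamma> e \<longleftrightarrow> (\<forall>i < length \<Gamma>. e i \<in> dom (\<Gamma> ! i))"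

lemma env_Nil [simp]: "env [] e"
  by (simp add: env_def)

lemma env_Cons [simp]: "env (\<tau> # \<Gamma>) (case_nat a e) \<longleftrightarrow> a \<in> dom \<tau> \<and> env \<Gamma> e"
  by (auto simp: env_def less_Suc_eq_0_disj)

text \<open>\<open>sat_theorem\<close> is about closed theorems. The free variables are generalised
  one after the other, which is possible because there are no hypotheses.\<close>

lemma sat_deriv: "deriv \<D> Ax \<Gamma> {} A \<Longrightarrow> env \<Gamma> e \<Longrightarrow> sat e A"
proof (induction \<Gamma> arbitrary: A e)
  case Nil
  then show ?case by (intro sat_theorem) (simp add: proves_def)
next
  case (Cons \<tau> \<Gamma>)
  have e: "e = case_nat (e 0) (\<lambda>i. e (Suc i))" by (rule ext) (simp split: nat.split)
  then have "env (\<tau> # \<Gamma>) (case_nat (e 0) (\<lambda>i. e (Suc i)))" using Cons.prems(2) by simp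
  then have *: "e 0 \<in> dom \<tau>" "env \<Gamma> (\<lambda>i. e (Suc i))" by simp_all
  have "deriv \<D> Ax \<Gamma> {} (All \<tau> A)" using Cons.prems(1) by (intro deriv.AllI) simp
  from Cons.IH[OF this *(2)] *(1) have "sat (case_nat (e 0) (\<lambda>i. e (Suc i))) A" by simp
  with e show ?case by simp
qed

lemma sat_Ax: "A \<in> RCAOmega \<D> \<Gamma> \<Longrightarrow> wf_fm \<D> \<Gamma> A \<Longrightarrow> env \<Gamma> e \<Longrightarrow> sat e A"
  using Ax by (intro sat_deriv deriv.Axiom) auto

lemma sat_Base: "A \<in> RCAw \<D> \<Gamma> \<Longrightarrow> wf_fm \<D> \<Gamma> A \<Longrightarrow> env \<Gamma> e \<Longrightarrow> sat e A"
  by (rule sat_Ax[OF RCAOmega.Base])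

lemma ev_dom: "wt \<D> \<Gamma> t \<tau> \<Longrightarrow> env \<Gamma> e \<Longrightarrow> ev e t \<in> dom \<tau>"
proof (induction t arbitrary: \<tau>)
  case (Con c)
  then show ?case using con_dom[of c] by (auto simp: wt_def)
next
  case (App t u)
  from App.prems obtain \<sigma> where "wt \<D> \<Gamma> t (\<sigma> \<rightarrow> \<tau>)" "wt \<D> \<Gamma> u \<sigma>"
    unfolding wt_def ty_of_App by auto
  with App show ?case using ap_dom by fastforce
qed (auto simp: env_def)

lemma sat_eq: "wt \<D> \<Gamma> t \<tau> \<Longrightarrow> wt \<D> \<Gamma> u \<tau> \<Longrightarrow> env \<Gamma> e \<Longrightarrow> sat e (eq \<tau> t u) \<longleftrightarrow> ev e t = ev e u"
proof -
  assume *: "wt \<D> \<Gamma> t \<tau>" "wt \<D> \<Gamma> u \<tau>" "env \<Gamma> e"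
  have 1: "eq \<tau> t u = fsub (case_nat u (case_nat t Var)) (eq \<tau> (Var 1) (Var 0))"
    by (simp add: fsub_eq)
  have 2: "(\<lambda>n. ev e (case_nat u (case_nat t Var) n)) = case_nat (ev e u) (case_nat (ev e t) e)"
    by (rule ext) (simp split: nat.split)
  show ?thesis unfolding 1 sat_fsub 2 using eq_iff ev_dom * by blast
qed

lemma fun_ext:
  assumes "f \<in> dom (\<sigma> \<rightarrow> \<tau>)" "g \<in> dom (\<sigma> \<rightarrow> \<tau>)" "\<And>a. a \<in> dom \<sigma> \<Longrightarrow> f \<bullet> a = g \<bullet> a"
  shows "f = g"
proof -
  let ?e = "case_nat g (case_nat f (\<lambda>_. f))"
  have "sat (case_nat a ?e) (eq \<tau> (Var 2 \<cdot> Var 0) (Var 1 \<cdot> Var 0))" if "a \<in> dom \<sigma>" for a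
    by (subst sat_eq[of "[\<sigma>, \<sigma> \<rightarrow> \<tau>, \<sigma> \<rightarrow> \<tau>]"]) (use assms that in \<open>auto simp: wt_def\<close>)
  then have "sat ?e (eq (\<sigma> \<rightarrow> \<tau>) (Var 1) (Var 0))" by (simp add: numeral_2_eq_2)
  with assms show ?thesis using eq_iff by blast
qed

lemma con_U [simp]: "in_lang \<D> (Con c) \<Longrightarrow> con c \<in> U" "in_lang \<D> (Con c) \<Longrightarrow> T (con c) = cty c"
  using con_dom by auto

lemma K_eq [simp]: "a \<in> U \<Longrightarrow> T a = \<sigma> \<Longrightarrow> b \<in> U \<Longrightarrow> T b = \<tau> \<Longrightarrow> con (KC \<sigma> \<tau>) \<bullet> a \<bullet> b = a"
proof -
  assume *: "a \<in> U" "T a = \<sigma>" "b \<in> U" "T b = \<tau>"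
  let ?A = "eq \<sigma> (Con (KC \<sigma> \<tau>) \<cdot> Var 1 \<cdot> Var 0) (Var 1)"
  have wf: "wf_fm \<D> [] (All \<sigma> (All \<tau> ?A))"
    by (auto intro!: wf_eq simp: wt_def)
  have "sat (case_nat b (case_nat a (\<lambda>_. a))) ?A"
    using sat_Base[OF RCAw.K wf, of "\<lambda>_. a"] * by simp
  then show ?thesis by (subst (asm) sat_eq[of "[\<tau>, \<sigma>]"]) (use * in \<open>auto simp: wt_def\<close>)
qed

lemma S_eq [simp]:
  "f \<in> U \<Longrightarrow> T f = (\<rho> \<rightarrow> \<sigma> \<rightarrow> \<tau>) \<Longrightarrow> g \<in> U \<Longrightarrow> T g = (\<rho> \<rightarrow> \<sigma>) \<Longrightarrow> a \<in> U \<Longrightarrow> T a = \<rho> \<Longrightarrow>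
    con (SC \<rho> \<sigma> \<tau>) \<bullet> f \<bullet> g \<bullet> a = f \<bullet> a \<bullet> (g \<bullet> a)"
proof -
  assume *: "f \<in> U" "T f = (\<rho> \<rightarrow> \<sigma> \<rightarrow> \<tau>)" "g \<in> U" "T g = (\<rho> \<rightarrow> \<sigma>)" "a \<in> U" "T a = \<rho>"
  let ?A = "eq \<tau> (Con (SC \<rho> \<sigma> \<tau>) \<cdot> Var 2 \<cdot> Var 1 \<cdot> Var 0) (Var 2 \<cdot> Var 0 \<cdot> (Var 1 \<cdot> Var 0))"
  have wf: "wf_fm \<D> [] (All (\<rho> \<rightarrow> \<sigma> \<rightarrow> \<tau>) (All (\<rho> \<rightarrow> \<sigma>) (All \<rho> ?A)))"
    by (auto intro!: wf_eq simp: wt_def)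
  have "sat (case_nat a (case_nat g (case_nat f (\<lambda>_. a)))) ?A"
    using sat_Base[OF RCAw.S wf, of "\<lambda>_. a"] * by simp
  then show ?thesis by (subst (asm) sat_eq[of "[\<rho>, \<rho> \<rightarrow> \<sigma>, \<rho> \<rightarrow> \<sigma> \<rightarrow> \<tau>]"]) (use * in \<open>auto simp: wt_def\<close>)
qed

lemma ev_not_occurs0: "\<not> occurs0 t \<Longrightarrow> ev e (tsub (\<lambda>n. Var (n - 1)) t) = ev (case_nat a e) t"
proof (induction t)
  case (Var n)
  then show ?case by (cases n) auto
qed auto

lemma ev_lam_Some:
  "wt \<D> (\<sigma> # \<Gamma>) t \<tau> \<Longrightarrow> env \<Gamma> e \<Longrightarrow> a \<in> dom \<sigma> \<Longrightarrow> ev e (lam \<Gamma> \<sigma> t) \<bullet> a = ev (case_nat a e) t"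
proof (induction t arbitrary: \<tau>)
  case (Var n)
  show ?case
  proof (cases n)
    case 0
    with Var show ?thesis by (simp add: lam.simps)
  next
    case (Suc m)
    with Var show ?thesis by (simp add: lam.simps env_def)
  qed
next
  case (Con c)
  then have "con c \<in> dom (cty c)" by (intro con_dom) (simp add: wt_def)
  with Con show ?case by (simp add: lam.simps)
next
  case (App t u)
  from App.prems obtain \<rho> where *: "wt \<D> (\<sigma> # \<Gamma>) t (\<rho> \<rightarrow> \<tau>)" "wt \<D> (\<sigma> # \<Gamma>) u \<rho>"
    unfolding wt_def ty_of_App by auto
  then have ty: "ty_of (\<sigma> # \<Gamma>) t = Some (\<rho> \<rightarrow> \<tau>)" "ty_of (\<sigma> # \<Gamma>) u = Some \<rho>"
    by (simp_all add: wt_def)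
  show ?case
  proof (cases "occurs0 (t \<cdot> u)")
    case True
    have "wt \<D> \<Gamma> (lam \<Gamma> \<sigma> t) (\<sigma> \<rightarrow> \<rho> \<rightarrow> \<tau>)" "wt \<D> \<Gamma> (lam \<Gamma> \<sigma> u) (\<sigma> \<rightarrow> \<rho>)"
      using * by (auto simp: wt_def intro!: ty_of_lam_Some)
    from ev_dom[OF this(1) App.prems(2)] ev_dom[OF this(2) App.prems(2)] App.IH(1)[OF *(1)] App.IH(2)[OF *(2)] App.prems(2,3)
    show ?thesis by (simp add: lam.simps ty True[simplified])
  next
    case False
    have "ev (case_nat a e) (t \<cdot> u) \<in> dom \<tau>" using App.prems by (intro ev_dom) auto
    moreover have "ev e (tsub (\<lambda>n. Var (n - 1)) (t \<cdot> u)) = ev (case_nat a e) (t \<cdot> u)"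
      by (rule ev_not_occurs0[OF False])
    moreover have "lam \<Gamma> \<sigma> (t \<cdot> u) = Con (KC \<tau> \<sigma>) \<cdot> tsub (\<lambda>n. Var (n - 1)) (t \<cdot> u)"
      using App.prems(1) False by (simp only: lam.simps if_False wt_def) simp
    ultimately show ?thesis using App.prems(3) by simp
  qed
qed

lemma ev_lam [simp]:
  "ty_of (\<sigma> # \<Gamma>) t \<noteq> None \<Longrightarrow> in_lang \<D> t \<Longrightarrow> env \<Gamma> e \<Longrightarrow> a \<in> U \<Longrightarrow> T a = \<sigma> \<Longrightarrow>
    ev e (lam \<Gamma> \<sigma> t) \<bullet> a = ev (case_nat a e) t"
  by (rule ev_lam_Some[of _ _ _ "the (ty_of (\<sigma> # \<Gamma>) t)"]) (auto simp: wt_def)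

lemma ev_lam_dom [simp]:
  assumes "ty_of (\<sigma> # \<Gamma>) t \<noteq> None" "in_lang \<D> t" "env \<Gamma> e"
  shows "ev e (lam \<Gamma> \<sigma> t) \<in> U" "T (ev e (lam \<Gamma> \<sigma> t)) = (\<sigma> \<rightarrow> the (ty_of (\<sigma> # \<Gamma>) t))"
proof -
  have "ev e (lam \<Gamma> \<sigma> t) \<in> dom (\<sigma> \<rightarrow> the (ty_of (\<sigma> # \<Gamma>) t))"
    using assms by (intro ev_dom[of \<Gamma>]) (auto simp: wt_def)
  then show "ev e (lam \<Gamma> \<sigma> t) \<in> U" "T (ev e (lam \<Gamma> \<sigma> t)) = (\<sigma> \<rightarrow> the (ty_of (\<sigma> # \<Gamma>) t))" by auto
qed

lemma ev_occ: "(\<And>n. occ n t \<Longrightarrow> e n = e' n) \<Longrightarrow> ev e t = ev e' t"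
  by (induction t) auto

text \<open>
  The step of a recursion on the innermost variable does not refer to it, so that both sides of a
  recursion equation contain the same step function.
\<close>
lemma ev_unused [simp]: "\<not> occ 0 t \<Longrightarrow> ev (case_nat (con Succ \<bullet> n) e) t = ev (case_nat n e) t"
  by (rule ev_occ) (metis not0_implies_Suc old.nat.simps(5))

definition cl :: "tm \<Rightarrow> 'a" where
  "cl t = ev (\<lambda>_. con Zero) t"

lemma st_closed_term: "wt \<D> [] t \<tau> \<Longrightarrow> st (cl t)"
  using sat_Ax[OF RCAOmega.St_closed[of \<D> t \<tau> "[]"], of "\<lambda>_. con Zero"] by (simp add: cl_def)

text \<open>To be instantiated with the closed terms introduced below. Such a term then acts as an
  opaque standard constant, whose definition is unfolded only to obtain its equations.\<close>

lemma closed_simps: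
  assumes "wt \<D> [] t \<tau>"
  shows "ty_of \<Gamma> t = Some \<tau>" "in_lang \<D> t" "tsub s t = t" "ev e t = cl t"
    "cl t \<in> U" "T (cl t) = \<tau>" "st (cl t)" "\<not> occ n t"
proof -
  have t: "ty_of [] t = Some \<tau>" using assms by (simp add: wt_def)
  show "ty_of \<Gamma> t = Some \<tau>" by (rule ty_of_closed[OF t])
  show "in_lang \<D> t" using assms by (simp add: wt_def)
  show "tsub s t = t" by (rule tsub_closed[OF t])
  show "ev e t = cl t" unfolding cl_def by (rule ev_closed[OF t])
  show "cl t \<in> U" "T (cl t) = \<tau>" using ev_dom[OF assms] by (simp_all add: cl_def)
  show "st (cl t)" by (rule st_closed_term[OF assms])
  show "\<not> occ n t" by (rule occ_closed[OF t])
qed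

lemma st_ap: "f \<in> U \<Longrightarrow> a \<in> U \<Longrightarrow> app_ok (T f) (T a) \<Longrightarrow> st f \<Longrightarrow> st a \<Longrightarrow> st (f \<bullet> a)"
proof -
  assume *: "f \<in> U" "a \<in> U" "app_ok (T f) (T a)" "st f" "st a"
  then obtain \<tau> where "T f = (T a \<rightarrow> \<tau>)" by (cases "T f") auto
  then show ?thesis
    using * sat_Ax[OF RCAOmega.St_app[of "T a" \<tau>], of "[]" "\<lambda>_. a"] by (simp add: wt_def)
qed

lemma st_con [simp]: "in_lang \<D> (Con c) \<Longrightarrow> st (con c)"
  using st_closed_term[of "Con c" "cty c"] by (simp add: cl_def wt_def)

abbreviation N :: "'a set" where "N \<equiv> dom Nat"
abbreviation Z :: 'a where "Z \<equiv> con Zero"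
abbreviation Sc :: "'a \<Rightarrow> 'a" where "Sc n \<equiv> con Succ \<bullet> n"

lemma Sc_neq [simp]: "n \<in> U \<Longrightarrow> T n = Nat \<Longrightarrow> Sc n \<noteq> Z" "n \<in> U \<Longrightarrow> T n = Nat \<Longrightarrow> Z \<noteq> Sc n"
  using sat_Base[OF RCAw.Succ_nonzero, of "[]" "\<lambda>_. n"] by (auto simp: wt_def)

lemma Sc_inj [simp]: "n \<in> U \<Longrightarrow> T n = Nat \<Longrightarrow> m \<in> U \<Longrightarrow> T m = Nat \<Longrightarrow> Sc n = Sc m \<longleftrightarrow> n = m"
proof -
  assume *: "n \<in> U" "T n = Nat" "m \<in> U" "T m = Nat"
  have "sat (\<lambda>_. Z) (All Nat (All Nat ((Con Succ \<cdot> Var 1 \<doteq> Con Succ \<cdot> Var 0) \<^bold>\<longrightarrow> (Var 1 \<doteq> Var 0))))"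
    by (rule sat_Base[OF RCAw.Succ_inj, of "[]"]) (simp_all add: wt_def)
  then have "\<forall>n \<in> N. \<forall>m \<in> N. Sc n = Sc m \<longrightarrow> n = m"
    by (simp only: sat.simps ev.simps nat.case One_nat_def)
  from bspec[OF bspec[OF this, of n], of m] * show ?thesis by auto
qed

lemma Rec_Z [simp]: "a \<in> U \<Longrightarrow> T a = Nat \<Longrightarrow> g \<in> U \<Longrightarrow> T g = (Nat \<rightarrow> Nat \<rightarrow> Nat) \<Longrightarrow> con Rec \<bullet> Z \<bullet> a \<bullet> g = a"
proof -
  assume *: "a \<in> U" "T a = Nat" "g \<in> U" "T g = (Nat \<rightarrow> Nat \<rightarrow> Nat)"
  have "sat (\<lambda>_. Z) (All Nat (All (Nat \<rightarrow> Nat \<rightarrow> Nat) (Con Rec \<cdot> zero \<cdot> Var 1 \<cdot> Var 0 \<doteq> Var 1)))"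
    by (rule sat_Base[OF RCAw.Rec_zero, of "[]"]) (simp_all add: wt_def)
  then have "\<forall>a \<in> N. \<forall>g \<in> dom (Nat \<rightarrow> ty1). con Rec \<bullet> Z \<bullet> a \<bullet> g = a" by simp
  from bspec[OF bspec[OF this, of a], of g] * show ?thesis by auto
qed

lemma Rec_Sc [simp]: "a \<in> U \<Longrightarrow> T a = Nat \<Longrightarrow> g \<in> U \<Longrightarrow> T g = (Nat \<rightarrow> Nat \<rightarrow> Nat) \<Longrightarrow> n \<in> U \<Longrightarrow> T n = Nat \<Longrightarrow>
    con Rec \<bullet> Sc n \<bullet> a \<bullet> g = g \<bullet> (con Rec \<bullet> n \<bullet> a \<bullet> g) \<bullet> n"
proof -
  assume *: "a \<in> U" "T a = Nat" "g \<in> U" "T g = (Nat \<rightarrow> Nat \<rightarrow> Nat)" "n \<in> U" "T n = Nat"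
  have "sat (\<lambda>_. Z) (All Nat (All Nat (All (Nat \<rightarrow> Nat \<rightarrow> Nat)
      (Con Rec \<cdot> (Con Succ \<cdot> Var 2) \<cdot> Var 1 \<cdot> Var 0 \<doteq> Var 0 \<cdot> (Con Rec \<cdot> Var 2 \<cdot> Var 1 \<cdot> Var 0) \<cdot> Var 2))))"
    by (rule sat_Base[OF RCAw.Rec_Succ, of "[]"]) (simp_all add: wt_def)
  then have "\<forall>n \<in> N. \<forall>a \<in> N. \<forall>g \<in> dom (Nat \<rightarrow> ty1).
      con Rec \<bullet> Sc n \<bullet> a \<bullet> g = g \<bullet> (con Rec \<bullet> n \<bullet> a \<bullet> g) \<bullet> n" by simp
  from bspec[OF bspec[OF bspec[OF this, of n], of a], of g] * show ?thesis by auto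
qed


section \<open>Quantifier-free induction\<close>

definition fn :: "('a \<Rightarrow> 'a) \<Rightarrow> bool" where
  "fn F \<longleftrightarrow> (\<exists>h \<in> dom ty1. \<forall>x \<in> N. h \<bullet> x = F x)"

text \<open>The predicates of HOL to which induction inside the model applies. Their parameters may
  be arbitrary, also nonstandard, elements, but the predicate itself cannot mention
  standardness.\<close>

definition dec :: "('a \<Rightarrow> bool) \<Rightarrow> bool" where
  "dec P \<longleftrightarrow> (\<exists>A \<Gamma> e. qfree A \<and> wf_fm \<D> (Nat # \<Gamma>) A \<and> env \<Gamma> e \<and> (\<forall>x \<in> N. sat (case_nat x e) A \<longleftrightarrow> P x))"

lemma fn_id: "fn (\<lambda>x. x)"
  unfolding fn_def by (rule bexI[of _ "ev (\<lambda>_. Z) (lam [] Nat (Var 0))"]) simp_all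

lemma fn_const: "c \<in> N \<Longrightarrow> fn (\<lambda>x. c)"
  unfolding fn_def by (rule bexI[of _ "ev (case_nat c (\<lambda>_. Z)) (lam [Nat] Nat (Var 1))"]) simp_all

lemma fn_ap1: "k \<in> dom ty1 \<Longrightarrow> fn F \<Longrightarrow> fn (\<lambda>x. k \<bullet> F x)"
  unfolding fn_def
proof (elim bexE)
  fix f assume *: "k \<in> dom ty1" "f \<in> dom ty1" "\<forall>x\<in>N. f \<bullet> x = F x"
  then show "\<exists>h\<in>dom ty1. \<forall>x\<in>N. h \<bullet> x = k \<bullet> F x"
    by (intro bexI[of _ "ev (case_nat k (case_nat f (\<lambda>_. Z))) (lam [ty1, ty1] Nat (Var 1 \<cdot> (Var 2 \<cdot> Var 0)))"])
      simp_all
qed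

lemma fn_ap2: "k \<in> dom (Nat \<rightarrow> ty1) \<Longrightarrow> fn F \<Longrightarrow> fn G \<Longrightarrow> fn (\<lambda>x. k \<bullet> F x \<bullet> G x)"
  unfolding fn_def
proof (elim bexE)
  fix f g assume *: "k \<in> dom (Nat \<rightarrow> ty1)" "f \<in> dom ty1" "\<forall>x\<in>N. f \<bullet> x = F x" "g \<in> dom ty1" "\<forall>x\<in>N. g \<bullet> x = G x"
  then show "\<exists>h\<in>dom ty1. \<forall>x\<in>N. h \<bullet> x = k \<bullet> F x \<bullet> G x"
    by (intro bexI[of _ "ev (case_nat k (case_nat f (case_nat g (\<lambda>_. Z))))
        (lam [Nat \<rightarrow> ty1, ty1, ty1] Nat (Var 1 \<cdot> (Var 2 \<cdot> Var 0) \<cdot> (Var 3 \<cdot> Var 0)))"]) simp_all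
qed

lemma fn_ap3: "k \<in> dom (Nat \<rightarrow> Nat \<rightarrow> ty1) \<Longrightarrow> fn F \<Longrightarrow> fn G \<Longrightarrow> fn H \<Longrightarrow> fn (\<lambda>x. k \<bullet> F x \<bullet> G x \<bullet> H x)"
  unfolding fn_def
proof (elim bexE)
  fix f g h assume *: "k \<in> dom (Nat \<rightarrow> Nat \<rightarrow> ty1)" "f \<in> dom ty1" "\<forall>x\<in>N. f \<bullet> x = F x"
    "g \<in> dom ty1" "\<forall>x\<in>N. g \<bullet> x = G x" "h \<in> dom ty1" "\<forall>x\<in>N. h \<bullet> x = H x"
  then show "\<exists>h\<in>dom ty1. \<forall>x\<in>N. h \<bullet> x = k \<bullet> F x \<bullet> G x \<bullet> H x"
    by (intro bexI[of _ "ev (case_nat k (case_nat f (case_nat g (case_nat h (\<lambda>_. Z)))))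
        (lam [Nat \<rightarrow> Nat \<rightarrow> ty1, ty1, ty1, ty1] Nat (Var 1 \<cdot> (Var 2 \<cdot> Var 0) \<cdot> (Var 3 \<cdot> Var 0) \<cdot> (Var 4 \<cdot> Var 0)))"]) simp_all
qed

lemma dec_eq: "fn F \<Longrightarrow> fn G \<Longrightarrow> dec (\<lambda>x. F x = G x)"
  unfolding fn_def
proof (elim bexE)
  fix f g assume *: "f \<in> dom ty1" "\<forall>x\<in>N. f \<bullet> x = F x" "g \<in> dom ty1" "\<forall>x\<in>N. g \<bullet> x = G x"
  then show ?thesis unfolding dec_def
    by (intro exI[of _ "Var 1 \<cdot> Var 0 \<doteq> Var 2 \<cdot> Var 0"] exI[of _ "[ty1, ty1]"]
        exI[of _ "case_nat f (case_nat g (\<lambda>_. Z))"]) (simp add: wt_def)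
qed

lemma qfree_fsub [simp]: "qfree (fsub s A) \<longleftrightarrow> qfree A"
  by (induction A arbitrary: s) auto

text \<open>The two formulas come with separate lists of parameters; these are appended, and the
  indices of the second formula are shifted past the parameters of the first.\<close>

lemma dec_imp:
  assumes "dec P" "dec Q" shows "dec (\<lambda>x. P x \<longrightarrow> Q x)"
proof -
  from assms(1) obtain A \<Gamma> e where A: "qfree A" "wf_fm \<D> (Nat # \<Gamma>) A" "env \<Gamma> e"
    "\<forall>x \<in> N. sat (case_nat x e) A \<longleftrightarrow> P x" unfolding dec_def by blast
  from assms(2) obtain B \<Delta> d where B: "qfree B" "wf_fm \<D> (Nat # \<Delta>) B" "env \<Delta> d"
    "\<forall>x \<in> N. sat (case_nat x d) B \<longleftrightarrow> Q x" unfolding dec_def by blast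
  let ?n = "length \<Gamma>"
  let ?r = "case_nat (Var 0) (\<lambda>i. Var (Suc (i + ?n)))"
  let ?e = "\<lambda>i. if i < ?n then e i else d (i - ?n)"
  show ?thesis unfolding dec_def
  proof (intro exI conjI ballI)
    show "qfree (A \<^bold>\<longrightarrow> fsub ?r B)" using A B by simp
    have "typed_sub \<D> (Nat # \<Delta>) (Nat # (\<Gamma> @ \<Delta>)) ?r"
      by (auto simp: typed_sub_def less_Suc_eq_0_disj nth_append)
    then show "wf_fm \<D> (Nat # (\<Gamma> @ \<Delta>)) (A \<^bold>\<longrightarrow> fsub ?r B)"
      using wf_append[OF A(2), of \<Delta>] wf_fsub[OF B(2)] by simp
    show "env (\<Gamma> @ \<Delta>) ?e" using A(3) B(3) by (auto simp: env_def nth_append)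
    fix x assume x: "x \<in> N"
    have "sat (case_nat x ?e) A = sat (case_nat x e) A"
      by (rule sat_cong[OF A(2)]) (auto simp: less_Suc_eq_0_disj)
    moreover have "sat (case_nat x ?e) (fsub ?r B) = sat (case_nat x d) B"
      unfolding sat_fsub by (rule sat_cong[OF B(2)]) (auto simp: less_Suc_eq_0_disj)
    ultimately show "sat (case_nat x ?e) (A \<^bold>\<longrightarrow> fsub ?r B) \<longleftrightarrow> (P x \<longrightarrow> Q x)"
      using A(4) B(4) x by simp
  qed
qed

lemma dec_const: "dec (\<lambda>x. c)"
proof (cases c)
  case True
  have "dec (\<lambda>x. Z = Z)" by (intro dec_eq fn_const) simp_all
  with True show ?thesis by simp
next
  case False
  have "dec (\<lambda>x. Z = Sc Z)" by (intro dec_eq fn_const) simp_all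
  with False show ?thesis by simp
qed

lemma dec_not: "dec P \<Longrightarrow> dec (\<lambda>x. \<not> P x)"
  using dec_imp[OF _ dec_const[of False], of P] by simp

lemma dec_or: "dec P \<Longrightarrow> dec Q \<Longrightarrow> dec (\<lambda>x. P x \<or> Q x)"
  using dec_imp[OF dec_not, of P Q] by (simp add: imp_conv_disj)

lemma dec_and: "dec P \<Longrightarrow> dec Q \<Longrightarrow> dec (\<lambda>x. P x \<and> Q x)"
  using dec_not[OF dec_imp[OF _ dec_not, of P Q]] by simp

lemmas fn_intros = fn_const fn_id fn_ap1 fn_ap2 fn_ap3
lemmas dec_intros = dec_const dec_eq dec_imp dec_not dec_or dec_and fn_intros

lemma qf_induct [consumes 1, case_names dec zero Suc]:
  assumes "n \<in> N" "dec P" "P Z" "\<And>n. n \<in> N \<Longrightarrow> P n \<Longrightarrow> P (Sc n)"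
  shows "P n"
proof -
  from assms(2) obtain A \<Gamma> e where A: "qfree A" "wf_fm \<D> (Nat # \<Gamma>) A" "env \<Gamma> e"
    "\<forall>x \<in> N. sat (case_nat x e) A \<longleftrightarrow> P x" unfolding dec_def by blast
  let ?s = "case_nat (Con Succ \<cdot> Var 0) (\<lambda>n. Var (Suc n))"
  have "wf_fm \<D> \<Gamma> (inst zero A)" using A(2) by (rule wf_inst) (simp add: wt_def)
  moreover have "wf_fm \<D> (Nat # \<Gamma>) (fsub ?s A)"
    by (rule wf_fsub[OF A(2)]) (auto simp: typed_sub_def wt_def less_Suc_eq_0_disj)
  ultimately have sat: "sat e (inst zero A \<^bold>\<and> All Nat (A \<^bold>\<longrightarrow> fsub ?s A) \<^bold>\<longrightarrow> All Nat A)"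
    using A by (intro sat_Base[OF RCAw.QFInd[OF A(1,2)]]) auto
  have 1: "(\<lambda>n. ev e (case_nat zero Var n)) = case_nat Z e"
    by (rule ext) (simp split: nat.split)
  have 2: "(\<lambda>n. ev (case_nat x e) (?s n)) = case_nat (Sc x) e" for x
    by (rule ext) (simp split: nat.split)
  show ?thesis using sat assms(1,3,4) A(4) by (simp add: sat_fsub 1 2)
qed

end

section \<open>Arithmetic\<close>

lemma closed_typing:
  assumes "wt \<D> [] t \<tau>"
  shows "ty_of \<Gamma> t = Some \<tau>" "in_lang \<D> t" "tsub s t = t"
  using assms ty_of_closed[of t \<tau> \<Gamma>] tsub_closed[of t \<tau> s] by (simp_all add: wt_def)

lemma predT_wt: "wt \<D> [] predT ty1" by (simp add: predT_def wt_def)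
lemmas [simp] = closed_typing[OF predT_wt]
lemma subT_wt: "wt \<D> [] subT (Nat \<rightarrow> ty1)" by (simp add: subT_def wt_def)
lemmas [simp] = closed_typing[OF subT_wt]
lemma addT_wt: "wt \<D> [] addT (Nat \<rightarrow> ty1)" by (simp add: addT_def wt_def)
lemmas [simp] = closed_typing[OF addT_wt]
lemma triT_wt: "wt \<D> [] triT ty1" by (simp add: triT_def wt_def)
lemmas [simp] = closed_typing[OF triT_wt]
lemma pairT_wt: "wt \<D> [] pairT (Nat \<rightarrow> ty1)" by (simp add: pairT_def wt_def)
lemmas [simp] = closed_typing[OF pairT_wt]
lemma snocT_wt: "wt \<D> [] snocT (Nat \<rightarrow> ty1)" by (simp add: snocT_def wt_def)
lemmas [simp] = closed_typing[OF snocT_wt]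
lemma initT_wt: "wt \<D> [] initT (ty1 \<rightarrow> ty1)" by (simp add: initT_def wt_def)
lemmas [simp] = closed_typing[OF initT_wt]
lemma condT_wt: "wt \<D> [] condT (Nat \<rightarrow> Nat \<rightarrow> ty1)" by (simp add: condT_def wt_def)
lemmas [simp] = closed_typing[OF condT_wt]
lemma parT_wt: "wt \<D> [] parT ty1" by (simp add: parT_def wt_def)
lemmas [simp] = closed_typing[OF parT_wt]
lemma posT_wt: "wt \<D> [] posT (ty1 \<rightarrow> ty1 \<rightarrow> ty1)" by (simp add: posT_def wt_def)
lemmas [simp] = closed_typing[OF posT_wt]
lemma playT_wt: "wt \<D> [] playT (ty1 \<rightarrow> ty1 \<rightarrow> ty1)" by (simp add: playT_def wt_def)
lemmas [simp] = closed_typing[OF playT_wt]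

context omega_model
begin

lemma cl_lam: "cl (lam \<Gamma> \<sigma> t) = ev (\<lambda>_. Z) (lam \<Gamma> \<sigma> t)"
  by (simp add: cl_def)

lemmas [simp] = closed_simps[OF predT_wt]
  closed_simps[OF subT_wt]
  closed_simps[OF addT_wt]
  closed_simps[OF triT_wt]
  closed_simps[OF pairT_wt]
  closed_simps[OF snocT_wt]
  closed_simps[OF initT_wt]
  closed_simps[OF condT_wt]
  closed_simps[OF parT_wt]
  closed_simps[OF posT_wt]
  closed_simps[OF playT_wt]

abbreviation Pred :: "'a \<Rightarrow> 'a" where "Pred n \<equiv> cl predT \<bullet> n"
abbreviation Add :: "'a \<Rightarrow> 'a \<Rightarrow> 'a" (infixl "\<oplus>" 65) where "a \<oplus> b \<equiv> cl addT \<bullet> a \<bullet> b"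
abbreviation Sub :: "'a \<Rightarrow> 'a \<Rightarrow> 'a" (infixl "\<ominus>" 65) where "a \<ominus> b \<equiv> cl subT \<bullet> a \<bullet> b"
abbreviation Le :: "'a \<Rightarrow> 'a \<Rightarrow> bool" (infix "\<preceq>" 50) where "a \<preceq> b \<equiv> a \<ominus> b = Z"
abbreviation Lt :: "'a \<Rightarrow> 'a \<Rightarrow> bool" (infix "\<prec>" 50) where "a \<prec> b \<equiv> Sc a \<ominus> b = Z"
abbreviation Cond :: "'a \<Rightarrow> 'a \<Rightarrow> 'a \<Rightarrow> 'a" where "Cond n a b \<equiv> cl condT \<bullet> n \<bullet> a \<bullet> b"
abbreviation One :: 'a where "One \<equiv> Sc Z"

lemma Pred_Z [simp]: "Pred Z = Z"
  by (simp add: predT_def cl_lam)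

lemma Pred_Sc [simp]: "n \<in> N \<Longrightarrow> Pred (Sc n) = n"
  by (simp add: predT_def cl_lam)

lemma Add_Z [simp]: "a \<in> N \<Longrightarrow> a \<oplus> Z = a"
  by (simp add: addT_def cl_lam)

lemma Add_Sc [simp]: "a \<in> N \<Longrightarrow> b \<in> N \<Longrightarrow> a \<oplus> Sc b = Sc (a \<oplus> b)"
  by (simp add: addT_def cl_lam)

lemma Sub_Z [simp]: "a \<in> N \<Longrightarrow> a \<ominus> Z = a"
  by (simp add: subT_def cl_lam)

lemma Sub_Sc: "a \<in> N \<Longrightarrow> b \<in> N \<Longrightarrow> a \<ominus> Sc b = Pred (a \<ominus> b)"
  by (simp add: subT_def cl_lam)

lemma nat_cases:
  assumes "n \<in> N" obtains "n = Z" | m where "m \<in> N" "n = Sc m"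
proof -
  have "n = Z \<or> n = Sc (Pred n)" using assms
  proof (induction rule: qf_induct)
    show "dec (\<lambda>n. n = Z \<or> n = Sc (Pred n))" by (intro dec_intros) simp_all
  qed simp_all
  with assms that(1) that(2)[of "Pred n"] show thesis by auto
qed

lemma Cond_eq [simp]: "n \<in> N \<Longrightarrow> a \<in> N \<Longrightarrow> b \<in> N \<Longrightarrow> Cond n a b = (if n = Z then a else b)"
  by (erule nat_cases[of n]) (simp_all add: condT_def cl_lam)

lemma Z_Add [simp]: "a \<in> N \<Longrightarrow> Z \<oplus> a = a"
proof (induction rule: qf_induct)
  case dec show ?case by (intro dec_intros) simp_all
qed simp_all

lemma Sc_Add [simp]:
  assumes "a \<in> N" "b \<in> N" shows "Sc a \<oplus> b = Sc (a \<oplus> b)"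
  using assms(2)
proof (induction rule: qf_induct)
  case dec show ?case using assms(1) by (intro dec_intros) simp_all
qed (use assms(1) in simp_all)

lemma Add_commute:
  assumes "a \<in> N" "b \<in> N" shows "a \<oplus> b = b \<oplus> a"
  using assms(2)
proof (induction rule: qf_induct)
  case dec show ?case using assms(1) by (intro dec_intros) simp_all
qed (use assms(1) in simp_all)

lemma Add_assoc:
  assumes "a \<in> N" "b \<in> N" "c \<in> N" shows "a \<oplus> b \<oplus> c = a \<oplus> (b \<oplus> c)"
  using assms(3)
proof (induction rule: qf_induct)
  case dec show ?case using assms(1,2) by (intro dec_intros) simp_all
qed (use assms(1,2) in simp_all)

lemma Add_left_commute: "a \<in> N \<Longrightarrow> b \<in> N \<Longrightarrow> c \<in> N \<Longrightarrow> a \<oplus> (b \<oplus> c) = b \<oplus> (a \<oplus> c)"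
  using Add_assoc[of a b c] Add_assoc[of b a c] Add_commute[of a b] by simp

lemma Sub_Sc_Sc [simp]:
  assumes "a \<in> N" "b \<in> N" shows "Sc a \<ominus> Sc b = a \<ominus> b"
  using assms(2)
proof (induction rule: qf_induct)
  case dec show ?case using assms(1) by (intro dec_intros) simp_all
qed (use assms(1) in \<open>simp_all add: Sub_Sc\<close>)

lemma Z_Sub [simp]: "a \<in> N \<Longrightarrow> Z \<ominus> a = Z"
proof (induction rule: qf_induct)
  case dec show ?case by (intro dec_intros) simp_all
qed (simp_all add: Sub_Sc)

lemma Sub_self [simp]: "a \<in> N \<Longrightarrow> a \<ominus> a = Z"
proof (induction rule: qf_induct)
  case dec show ?case by (intro dec_intros) simp_all
qed simp_all

lemma Add_Sub_cancel_left [simp]: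
  assumes "a \<in> N" "b \<in> N" "c \<in> N" shows "(a \<oplus> b) \<ominus> (a \<oplus> c) = b \<ominus> c"
  using assms(1)
proof (induction rule: qf_induct)
  case dec show ?case using assms(2,3) by (intro dec_intros) simp_all
qed (use assms(2,3) in simp_all)

lemma Add_Sub [simp]: "a \<in> N \<Longrightarrow> b \<in> N \<Longrightarrow> (a \<oplus> b) \<ominus> a = b"
  using Add_Sub_cancel_left[of a b Z] by simp

lemma Add_Sub' [simp]: "a \<in> N \<Longrightarrow> b \<in> N \<Longrightarrow> (a \<oplus> b) \<ominus> b = a"
  using Add_Sub[of b a] by (simp add: Add_commute)

lemma Sub_Add [simp]: "a \<in> N \<Longrightarrow> b \<in> N \<Longrightarrow> a \<ominus> (a \<oplus> b) = Z"
  using Add_Sub_cancel_left[of a Z b] by simp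

lemma Sub_Add' [simp]: "a \<in> N \<Longrightarrow> b \<in> N \<Longrightarrow> b \<ominus> (a \<oplus> b) = Z"
  using Sub_Add[of b a] by (simp add: Add_commute)

lemma Sub_dichotomy:
  assumes "a \<in> N" "b \<in> N" shows "a \<ominus> b = Z \<or> a = (a \<ominus> b) \<oplus> b"
  using assms(2)
proof (induction rule: qf_induct)
  case dec show ?case using assms(1) by (intro dec_intros) simp_all
next
  case (Suc b)
  have ab: "a \<ominus> b \<in> N" using Suc assms by simp
  from Suc(2) show ?case
  proof
    assume *: "a = (a \<ominus> b) \<oplus> b"
    show ?thesis
    proof (rule nat_cases[OF ab])
      fix c assume c: "c \<in> N" "a \<ominus> b = Sc c"
      with * Suc assms have "a = Sc (c \<oplus> b)" by simp
      with c Suc assms show ?thesis by (simp add: Sub_Sc)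
    qed (use Suc assms in \<open>simp add: Sub_Sc\<close>)
  qed (use Suc assms in \<open>simp add: Sub_Sc\<close>)
qed (use assms in simp)

text \<open>The explicit difference makes the claim quantifier-free and so accessible to induction;
  the existential description of the order in \<open>Le_iff\<close> is a consequence.\<close>

lemma Le_diff:
  assumes "a \<in> N" "b \<in> N" shows "\<not> a \<preceq> b \<or> a \<oplus> (b \<ominus> a) = b"
  using assms(2)
proof (induction rule: qf_induct)
  case dec show ?case using assms(1) by (intro dec_intros) simp_all
next
  case (Suc b)
  have ab: "a \<ominus> b \<in> N" "b \<ominus> a \<in> N" using Suc assms by simp_all
  show ?case
  proof (cases "a \<preceq> b")
    case True
    then have b: "b = a \<oplus> (b \<ominus> a)" using Suc by simp
    have "Sc (a \<oplus> (b \<ominus> a)) \<ominus> a = Sc (b \<ominus> a)"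
      using ab assms by (simp flip: Add_Sc)
    then have "Sc b \<ominus> a = Sc (b \<ominus> a)" using b by simp
    with b ab assms show ?thesis by simp
  next
    case False
    then obtain c where c: "c \<in> N" "a \<ominus> b = Sc c" using nat_cases[OF ab(1)] by metis
    with Sub_dichotomy[of a b] Suc assms have a: "a = Sc (c \<oplus> b)" by simp
    have e: "a \<ominus> Sc b = c" using c Suc assms by (simp add: Sub_Sc)
    show ?thesis
    proof (cases "c = Z")
      case True
      with a Suc assms show ?thesis by simp
    qed (use e in simp)
  qed
qed (use assms in simp)

lemma Le_iff: "a \<in> N \<Longrightarrow> b \<in> N \<Longrightarrow> a \<preceq> b \<longleftrightarrow> (\<exists>c \<in> N. b = a \<oplus> c)"
  using Le_diff[of a b] by (auto intro!: bexI[of _ "b \<ominus> a"])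

lemma LeE: "a \<preceq> b \<Longrightarrow> a \<in> N \<Longrightarrow> b \<in> N \<Longrightarrow> (\<And>c. c \<in> N \<Longrightarrow> b = a \<oplus> c \<Longrightarrow> P) \<Longrightarrow> P"
  using Le_iff[of a b] by blast

lemma Lt_iff_not_Le: "a \<in> N \<Longrightarrow> b \<in> N \<Longrightarrow> b \<prec> a \<longleftrightarrow> \<not> a \<preceq> b"
proof
  assume *: "a \<in> N" "b \<in> N" "b \<prec> a"
  then obtain c where c: "c \<in> N" "a = Sc b \<oplus> c" using LeE[of "Sc b" a] by auto
  then have "a = b \<oplus> Sc c" using * by simp
  then have "a \<ominus> b = Sc c" using * c Add_Sub[of b "Sc c"] by simp
  then show "\<not> a \<preceq> b" using c by simp
next
  assume *: "a \<in> N" "b \<in> N" "\<not> a \<preceq> b"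
  then have "a \<ominus> b \<in> N" by simp
  then obtain c where c: "c \<in> N" "a \<ominus> b = Sc c" using nat_cases * by metis
  with Sub_dichotomy[of a b] * have a: "a = Sc b \<oplus> c" by (simp add: Add_commute)
  then show "b \<prec> a" using * c Sub_Add[of "Sc b" c] by (simp del: Sc_Add)
qed

lemma Le_trans: "a \<preceq> b \<Longrightarrow> b \<preceq> c \<Longrightarrow> a \<in> N \<Longrightarrow> b \<in> N \<Longrightarrow> c \<in> N \<Longrightarrow> a \<preceq> c"
  by (elim LeE) (auto simp: Add_assoc)

lemma Le_antisym: "a \<preceq> b \<Longrightarrow> b \<preceq> a \<Longrightarrow> a \<in> N \<Longrightarrow> b \<in> N \<Longrightarrow> a = b"
  using Le_diff[of a b] by simp

lemma Le_Sc [simp]: "a \<in> N \<Longrightarrow> a \<preceq> Sc a"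
  using Sub_Add[of a One] by simp

lemma Le_SucI: "a \<preceq> b \<Longrightarrow> a \<in> N \<Longrightarrow> b \<in> N \<Longrightarrow> a \<preceq> Sc b"
  by (rule Le_trans[of a b]) simp_all

lemma Lt_imp_Le: "a \<prec> b \<Longrightarrow> a \<in> N \<Longrightarrow> b \<in> N \<Longrightarrow> a \<preceq> b"
  by (rule Le_trans[of a "Sc a"]) simp_all

lemma Le_Add_mono: "a \<preceq> b \<Longrightarrow> c \<preceq> d \<Longrightarrow> a \<in> N \<Longrightarrow> b \<in> N \<Longrightarrow> c \<in> N \<Longrightarrow> d \<in> N \<Longrightarrow> a \<oplus> c \<preceq> b \<oplus> d"
proof (elim LeE)
  fix x y assume *: "a \<in> N" "c \<in> N" "x \<in> N" "y \<in> N" "b = a \<oplus> x" "d = c \<oplus> y"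
  then have "b \<oplus> d = (a \<oplus> c) \<oplus> (x \<oplus> y)"
    by (simp add: Add_assoc Add_left_commute[of x c y])
  with * show "a \<oplus> c \<preceq> b \<oplus> d" by simp
qed assumption+

section \<open>Coding of pairs and sequences\<close>

abbreviation Tri :: "'a \<Rightarrow> 'a" where "Tri n \<equiv> cl triT \<bullet> n"
abbreviation Pr :: "'a \<Rightarrow> 'a \<Rightarrow> 'a" where "Pr a b \<equiv> cl pairT \<bullet> a \<bullet> b"
abbreviation Snoc :: "'a \<Rightarrow> 'a \<Rightarrow> 'a" where "Snoc a b \<equiv> cl snocT \<bullet> a \<bullet> b"
abbreviation Init :: "'a \<Rightarrow> 'a \<Rightarrow> 'a" where "Init h k \<equiv> cl initT \<bullet> h \<bullet> k"

lemma Tri_Z [simp]: "Tri Z = Z"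
  by (simp add: triT_def cl_lam)

lemma Tri_Sc [simp]: "n \<in> N \<Longrightarrow> Tri (Sc n) = Sc (Tri n \<oplus> n)"
  by (simp add: triT_def cl_lam)

lemma Pr_eq: "a \<in> N \<Longrightarrow> b \<in> N \<Longrightarrow> Pr a b = Tri (a \<oplus> b) \<oplus> b"
  by (simp add: pairT_def cl_lam)

lemma Snoc_eq: "a \<in> N \<Longrightarrow> b \<in> N \<Longrightarrow> Snoc a b = Sc (Pr a b)"
  by (simp add: snocT_def cl_lam)

lemma Init_Z [simp]: "h \<in> dom ty1 \<Longrightarrow> Init h Z = Z"
  by (simp add: initT_def cl_lam)

lemma Init_Sc [simp]: "h \<in> dom ty1 \<Longrightarrow> k \<in> N \<Longrightarrow> Init h (Sc k) = Snoc (Init h k) (h \<bullet> k)"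
  by (simp add: initT_def cl_lam)

lemma Tri_mono_Add:
  assumes "a \<in> N" "b \<in> N" shows "Tri a \<preceq> Tri (a \<oplus> b)"
  using assms(2)
proof (induction rule: qf_induct)
  case dec show ?case using assms(1) by (intro dec_intros) simp_all
next
  case (Suc b)
  have "Tri a \<preceq> Tri (a \<oplus> b) \<oplus> (a \<oplus> b)"
    by (rule Le_trans[OF Suc(2)]) (use assms Suc in simp_all)
  with Suc assms show ?case by (simp add: Le_SucI)
qed (use assms in simp)

lemma Tri_mono: "a \<preceq> b \<Longrightarrow> a \<in> N \<Longrightarrow> b \<in> N \<Longrightarrow> Tri a \<preceq> Tri b"
  by (elim LeE) (simp_all add: Tri_mono_Add)

lemma Le_Tri: "a \<in> N \<Longrightarrow> a \<preceq> Tri a"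
  by (erule nat_cases) simp_all

text \<open>The inverse of the triangular numbers: the greatest \<open>w\<close> with
  \<open>Tri w \<preceq> z\<close>. It grows by at most one from \<open>z\<close> to its successor,
  so the recursion only has to test the next triangular number.\<close>

definition rootT :: tm where
  "rootT = lams [] [Nat] (Con Rec \<cdot> Var 0 \<cdot> zero \<cdot> lams [Nat] [Nat, Nat]
     (condT \<cdot> (subT \<cdot> (triT \<cdot> (Con Succ \<cdot> Var 1)) \<cdot> (Con Succ \<cdot> Var 0)) \<cdot> (Con Succ \<cdot> Var 1) \<cdot> Var 1))"

lemma rootT_wt: "wt \<D> [] rootT ty1" by (simp add: rootT_def wt_def)
lemmas [simp] = closed_simps[OF rootT_wt]

abbreviation Root :: "'a \<Rightarrow> 'a" where "Root z \<equiv> cl rootT \<bullet> z"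

lemma Root_Z [simp]: "Root Z = Z"
  by (simp add: rootT_def cl_lam)

lemma Root_Sc: "z \<in> N \<Longrightarrow> Root (Sc z) = (if Tri (Sc (Root z)) \<preceq> Sc z then Sc (Root z) else Root z)"
proof -
  assume z: "z \<in> N"
  have "Root (Sc z) = Cond (Tri (Sc (Root z)) \<ominus> Sc z) (Sc (Root z)) (Root z)"
    using z by (simp add: rootT_def cl_lam del: Cond_eq Tri_Sc Sub_Sc_Sc)
  with z show ?thesis by simp
qed

lemma Root_spec: "z \<in> N \<Longrightarrow> Tri (Root z) \<preceq> z \<and> z \<prec> Tri (Sc (Root z))"
proof (induction rule: qf_induct)
  case dec show ?case by (intro dec_intros) simp_all
next
  case (Suc z)
  show ?case
  proof (cases "Tri (Sc (Root z)) \<preceq> Sc z")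
    case True
    have "z \<preceq> Tri (Root z) \<oplus> Root z" using Suc by simp
    then have "z \<preceq> Tri (Root z) \<oplus> Root z \<oplus> Root z"
      by (rule Le_trans) (use Suc in simp_all)
    with True Suc show ?thesis by (simp add: Root_Sc Le_SucI)
  next
    case False
    with Suc have "Sc z \<prec> Tri (Sc (Root z))" by (subst Lt_iff_not_Le) simp_all
    with False Suc show ?thesis by (simp add: Root_Sc Le_SucI)
  qed
qed simp

lemma Tri_unique:
  assumes "v \<in> N" "w \<in> N" "z \<in> N" "Tri v \<preceq> z" "z \<prec> Tri (Sc v)" "Tri w \<preceq> z" "z \<prec> Tri (Sc w)"
  shows "v = w"
proof -
  have False if "v \<in> N" "w \<in> N" "v \<prec> w" "z \<prec> Tri (Sc v)" "Tri w \<preceq> z" for v w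
  proof -
    have "Tri (Sc v) \<preceq> Tri w" by (rule Tri_mono) (use that in simp_all)
    then have "Tri (Sc v) \<preceq> z" by (rule Le_trans) (use that assms(3) in simp_all)
    then show False using that(4) Lt_iff_not_Le[of "Tri (Sc v)" z] that(1) assms(3)
      by (simp del: Tri_Sc)
  qed
  from this[of v w] this[of w v] have "\<not> v \<prec> w" "\<not> w \<prec> v" using assms by blast+
  then show ?thesis using assms(1,2) Lt_iff_not_Le Le_antisym by blast
qed

definition sndT :: tm where
  "sndT = lams [] [Nat] (subT \<cdot> Var 0 \<cdot> (triT \<cdot> (rootT \<cdot> Var 0)))"
definition fstT :: tm where
  "fstT = lams [] [Nat] (subT \<cdot> (rootT \<cdot> Var 0) \<cdot> (sndT \<cdot> Var 0))"

lemma sndT_wt: "wt \<D> [] sndT ty1" by (simp add: sndT_def wt_def)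
lemmas [simp] = closed_simps[OF sndT_wt]
lemma fstT_wt: "wt \<D> [] fstT ty1" by (simp add: fstT_def wt_def)
lemmas [simp] = closed_simps[OF fstT_wt]

abbreviation Fst :: "'a \<Rightarrow> 'a" where "Fst z \<equiv> cl fstT \<bullet> z"
abbreviation Snd :: "'a \<Rightarrow> 'a" where "Snd z \<equiv> cl sndT \<bullet> z"

lemma Snd_eq: "z \<in> N \<Longrightarrow> Snd z = z \<ominus> Tri (Root z)"
  by (simp add: sndT_def cl_lam)

lemma Fst_eq: "z \<in> N \<Longrightarrow> Fst z = Root z \<ominus> Snd z"
  by (simp add: fstT_def cl_lam)

lemma Root_Pr: "a \<in> N \<Longrightarrow> b \<in> N \<Longrightarrow> Root (Pr a b) = a \<oplus> b"
proof -
  assume *: "a \<in> N" "b \<in> N"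
  show ?thesis
  proof (rule Tri_unique[of _ _ "Pr a b"])
    show "Tri (Root (Pr a b)) \<preceq> Pr a b" "Pr a b \<prec> Tri (Sc (Root (Pr a b)))"
      using Root_spec[of "Pr a b"] * by auto
  qed (use * in \<open>simp_all add: Pr_eq\<close>)
qed

lemma Snd_Pr [simp]: "a \<in> N \<Longrightarrow> b \<in> N \<Longrightarrow> Snd (Pr a b) = b"
  by (simp add: Snd_eq Root_Pr) (simp add: Pr_eq)

lemma Fst_Pr [simp]: "a \<in> N \<Longrightarrow> b \<in> N \<Longrightarrow> Fst (Pr a b) = a"
  by (simp add: Fst_eq Root_Pr)

lemma Sub_Le [simp]: "a \<in> N \<Longrightarrow> b \<in> N \<Longrightarrow> a \<ominus> b \<preceq> a"
proof -
  assume *: "a \<in> N" "b \<in> N"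
  then have le: "a \<ominus> b \<preceq> (a \<ominus> b) \<oplus> b" by simp
  from Sub_dichotomy[OF *] show ?thesis
  proof
    assume "a = (a \<ominus> b) \<oplus> b"
    with le show ?thesis by (simp only: \<open>a = (a \<ominus> b) \<oplus> b\<close>[symmetric])
  qed (use * in simp)
qed

lemma Fst_Le: "z \<in> N \<Longrightarrow> Fst z \<preceq> z"
proof -
  assume z: "z \<in> N"
  have "Fst z \<preceq> Root z" using z by (simp add: Fst_eq)
  moreover have "Root z \<preceq> Tri (Root z)" using z by (simp add: Le_Tri)
  ultimately have "Fst z \<preceq> Tri (Root z)" by (rule Le_trans) (use z in simp_all)
  then show ?thesis by (rule Le_trans) (use z Root_spec in simp_all)
qed

lemma Le_Pr1: "a \<in> N \<Longrightarrow> b \<in> N \<Longrightarrow> a \<preceq> Pr a b"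
  using Fst_Le[of "Pr a b"] by simp

lemma Le_Pr2: "a \<in> N \<Longrightarrow> b \<in> N \<Longrightarrow> b \<preceq> Pr a b"
  by (simp add: Pr_eq)

lemma Snd_Z [simp]: "Snd Z = Z" by (simp add: Snd_eq)
lemma Fst_Z [simp]: "Fst Z = Z" by (simp add: Fst_eq)

definition lastT :: tm where "lastT = lams [] [Nat] (sndT \<cdot> (predT \<cdot> Var 0))"
definition blT :: tm where "blT = lams [] [Nat] (fstT \<cdot> (predT \<cdot> Var 0))"

lemma lastT_wt: "wt \<D> [] lastT ty1" by (simp add: lastT_def wt_def)
lemmas [simp] = closed_simps[OF lastT_wt]
lemma blT_wt: "wt \<D> [] blT ty1" by (simp add: blT_def wt_def)
lemmas [simp] = closed_simps[OF blT_wt]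

abbreviation Last :: "'a \<Rightarrow> 'a" where "Last s \<equiv> cl lastT \<bullet> s"
abbreviation Butl :: "'a \<Rightarrow> 'a" where "Butl s \<equiv> cl blT \<bullet> s"

lemma Last_Snoc [simp]: "s \<in> N \<Longrightarrow> n \<in> N \<Longrightarrow> Last (Snoc s n) = n"
  by (simp add: lastT_def cl_lam Snoc_eq)

lemma Butl_Snoc [simp]: "s \<in> N \<Longrightarrow> n \<in> N \<Longrightarrow> Butl (Snoc s n) = s"
  by (simp add: blT_def cl_lam Snoc_eq)

lemma Last_Z [simp]: "Last Z = Z" by (simp add: lastT_def cl_lam)
lemma Butl_Z [simp]: "Butl Z = Z" by (simp add: blT_def cl_lam)

lemma Snoc_neq [simp]: "s \<in> N \<Longrightarrow> n \<in> N \<Longrightarrow> Snoc s n \<noteq> Z"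
  by (simp add: Snoc_eq)

lemma Butl_less: "s \<in> N \<Longrightarrow> s = Z \<or> Butl s \<prec> s"
  by (erule nat_cases) (simp_all add: blT_def cl_lam Fst_Le)

definition iterT :: tm where
  "iterT = lams [] [Nat, Nat] (Con Rec \<cdot> Var 0 \<cdot> Var 1 \<cdot> lams [Nat, Nat] [Nat, Nat] (blT \<cdot> Var 1))"
text \<open>In place of a course-of-values recursion, the length of \<open>s\<close> is found by
  counting the \<open>j\<close> below a bound for which \<open>j\<close> deletions at the end leave
  a nonempty sequence. As each deletion lowers the code, \<open>s\<close> itself can serve as the
  bound.\<close>

definition cntT :: tm where
  "cntT = lams [] [Nat, Nat] (Con Rec \<cdot> Var 0 \<cdot> zero \<cdot> lams [Nat, Nat] [Nat, Nat]
     (condT \<cdot> (iterT \<cdot> Var 3 \<cdot> Var 0) \<cdot> Var 1 \<cdot> (Con Succ \<cdot> Var 1)))"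
definition lenT :: tm where "lenT = lams [] [Nat] (cntT \<cdot> Var 0 \<cdot> Var 0)"
text \<open>Entry \<open>i\<close> is the last one of the initial segment of length
  \<open>i + 1\<close>, which remains when the later entries are deleted.\<close>

definition entT :: tm where
  "entT = lams [] [Nat, Nat] (lastT \<cdot> (iterT \<cdot> Var 1 \<cdot> (subT \<cdot> (lenT \<cdot> Var 1) \<cdot> (Con Succ \<cdot> Var 0))))"

lemma iterT_wt: "wt \<D> [] iterT (Nat \<rightarrow> ty1)" by (simp add: iterT_def wt_def)
lemmas [simp] = closed_simps[OF iterT_wt]
lemma cntT_wt: "wt \<D> [] cntT (Nat \<rightarrow> ty1)" by (simp add: cntT_def wt_def)
lemmas [simp] = closed_simps[OF cntT_wt]
lemma lenT_wt: "wt \<D> [] lenT ty1" by (simp add: lenT_def wt_def)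
lemmas [simp] = closed_simps[OF lenT_wt]
lemma entT_wt: "wt \<D> [] entT (Nat \<rightarrow> ty1)" by (simp add: entT_def wt_def)
lemmas [simp] = closed_simps[OF entT_wt]

abbreviation Iter :: "'a \<Rightarrow> 'a \<Rightarrow> 'a" where "Iter s j \<equiv> cl iterT \<bullet> s \<bullet> j"
abbreviation Cnt :: "'a \<Rightarrow> 'a \<Rightarrow> 'a" where "Cnt s m \<equiv> cl cntT \<bullet> s \<bullet> m"
abbreviation Len :: "'a \<Rightarrow> 'a" where "Len s \<equiv> cl lenT \<bullet> s"
abbreviation Ent :: "'a \<Rightarrow> 'a \<Rightarrow> 'a" where "Ent s i \<equiv> cl entT \<bullet> s \<bullet> i"

lemma Iter_Z [simp]: "s \<in> N \<Longrightarrow> Iter s Z = s"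
  by (simp add: iterT_def cl_lam)

lemma Iter_Sc: "s \<in> N \<Longrightarrow> j \<in> N \<Longrightarrow> Iter s (Sc j) = Butl (Iter s j)"
  by (simp add: iterT_def cl_lam)

lemma Cnt_Z [simp]: "s \<in> N \<Longrightarrow> Cnt s Z = Z"
  by (simp add: cntT_def cl_lam)

lemma Cnt_Sc: "s \<in> N \<Longrightarrow> j \<in> N \<Longrightarrow> Cnt s (Sc j) = (if Iter s j = Z then Cnt s j else Sc (Cnt s j))"
proof -
  assume *: "s \<in> N" "j \<in> N"
  have "Cnt s (Sc j) = Cond (Iter s j) (Cnt s j) (Sc (Cnt s j))"
    using * by (simp add: cntT_def cl_lam del: Cond_eq)
  with * show ?thesis by simp
qed

lemma Len_eq: "s \<in> N \<Longrightarrow> Len s = Cnt s s"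
  by (simp add: lenT_def cl_lam)

lemma Ent_eq: "s \<in> N \<Longrightarrow> i \<in> N \<Longrightarrow> Ent s i = Last (Iter s (Len s \<ominus> Sc i))"
  by (simp add: entT_def cl_lam)

lemma Iter_Sc':
  assumes "s \<in> N" "j \<in> N" shows "Iter s (Sc j) = Iter (Butl s) j"
  using assms(2)
proof (induction rule: qf_induct)
  case dec show ?case using assms(1) by (intro dec_intros) simp_all
qed (use assms(1) in \<open>simp_all add: Iter_Sc\<close>)

lemma Iter_bound:
  assumes "s \<in> N" "j \<in> N" shows "Iter s j = Z \<or> Iter s j \<oplus> j \<preceq> s"
  using assms(2)
proof (induction rule: qf_induct)
  case dec show ?case using assms(1) by (intro dec_intros) simp_all
next
  case (Suc j)
  show ?case
  proof (cases "Iter s j = Z")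
    case False
    have "Sc (Butl (Iter s j)) \<preceq> Iter s j" using Butl_less[of "Iter s j"] False assms Suc by simp
    then have "Sc (Butl (Iter s j)) \<oplus> j \<preceq> Iter s j \<oplus> j" by (rule Le_Add_mono) (use assms Suc in simp_all)
    then have "Sc (Butl (Iter s j)) \<oplus> j \<preceq> s" by (rule Le_trans) (use assms Suc False in simp_all)
    with assms Suc show ?thesis by (simp add: Iter_Sc)
  qed (use assms Suc in \<open>simp add: Iter_Sc\<close>)
qed (use assms in simp)

lemma Iter_large: "s \<in> N \<Longrightarrow> k \<in> N \<Longrightarrow> Iter s (s \<oplus> k) = Z"
proof -
  assume *: "s \<in> N" "k \<in> N"
  show ?thesis
  proof (rule nat_cases[of "Iter s (s \<oplus> k)"])
    fix m assume m: "m \<in> N" "Iter s (s \<oplus> k) = Sc m"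
    with Iter_bound[of s "s \<oplus> k"] * have "Sc m \<oplus> (s \<oplus> k) \<preceq> s" by simp
    moreover have "s \<preceq> m \<oplus> (s \<oplus> k)"
      by (rule Le_trans[of _ "s \<oplus> k"]) (use * m in simp_all)
    ultimately show ?thesis using Lt_iff_not_Le[of s "m \<oplus> (s \<oplus> k)"] * m by simp
  qed (use * in simp_all)
qed

text \<open>Beyond \<open>s\<close> nothing is left to count. This reconciles the different bounds
  in the lengths of \<open>s\<close> and of its extensions, whose codes are larger.\<close>

lemma Cnt_large:
  assumes "s \<in> N" "k \<in> N" shows "Cnt s (s \<oplus> k) = Cnt s s"
  using assms(2)
proof (induction rule: qf_induct)
  case dec show ?case using assms(1) by (intro dec_intros) simp_all
qed (use assms(1) in \<open>simp_all add: Cnt_Sc Iter_large\<close>)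

lemma Cnt_Snoc:
  assumes "s \<in> N" "n \<in> N" "m \<in> N" shows "Cnt (Snoc s n) (Sc m) = Sc (Cnt s m)"
  using assms(3)
proof (induction rule: qf_induct)
  case dec show ?case using assms(1,2) by (intro dec_intros) simp_all
qed (use assms(1,2) in \<open>simp_all add: Cnt_Sc Iter_Sc'\<close>)

lemma Len_Z [simp]: "Len Z = Z"
  by (simp add: Len_eq)

lemma Len_Snoc [simp]: "s \<in> N \<Longrightarrow> n \<in> N \<Longrightarrow> Len (Snoc s n) = Sc (Len s)"
proof -
  assume *: "s \<in> N" "n \<in> N"
  obtain c where c: "c \<in> N" "Pr s n = s \<oplus> c" by (rule LeE[OF Le_Pr1[OF *]]) (use * in simp_all)
  have "Len (Snoc s n) = Cnt (Snoc s n) (Sc (Pr s n))" using * by (simp add: Len_eq) (simp add: Snoc_eq)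
  also have "\<dots> = Sc (Cnt s (Pr s n))" using * by (simp add: Cnt_Snoc)
  also have "\<dots> = Sc (Len s)" using * c by (simp add: Cnt_large Len_eq)
  finally show ?thesis .
qed

lemma Len_Init [simp]:
  assumes "h \<in> dom ty1" "k \<in> N" shows "Len (Init h k) = k"
  using assms(2)
proof (induction rule: qf_induct)
  case dec show ?case using assms(1) by (intro dec_intros) simp_all
qed (use assms(1) in simp_all)

lemma Iter_Init:
  assumes "h \<in> dom ty1" "k \<in> N" "j \<in> N" shows "Iter (Init h (k \<oplus> j)) j = Init h k"
  using assms(3)
proof (induction rule: qf_induct)
  case dec show ?case using assms(1,2) by (intro dec_intros) simp_all
qed (use assms(1,2) in \<open>simp_all add: Iter_Sc'\<close>)

lemma Ent_Init:
  assumes "h \<in> dom ty1" "k \<in> N" "i \<in> N" "i \<prec> k" shows "Ent (Init h k) i = h \<bullet> i"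
proof -
  obtain c where c: "c \<in> N" "k = Sc i \<oplus> c" by (rule LeE[OF assms(4)]) (use assms in simp_all)
  then have "Iter (Init h k) (k \<ominus> Sc i) = Init h (Sc i)"
    using Iter_Init[of h "Sc i" c] assms by (simp del: Sc_Add Init_Sc)
  then show ?thesis using assms by (simp add: Ent_eq)
qed

section \<open>Decidable predicates\<close>

lemma Add_eq_Z [simp]: "a \<in> N \<Longrightarrow> b \<in> N \<Longrightarrow> a \<oplus> b = Z \<longleftrightarrow> a = Z \<and> b = Z"
  by (erule nat_cases[of b]) auto

definition eqT :: tm where
  "eqT = lams [] [Nat, Nat] (addT \<cdot> (subT \<cdot> Var 1 \<cdot> Var 0) \<cdot> (subT \<cdot> Var 0 \<cdot> Var 1))"
lemma eqT_wt: "wt \<D> [] eqT (Nat \<rightarrow> ty1)" by (simp add: eqT_def wt_def)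
lemmas [simp] = closed_simps[OF eqT_wt]

lemma eqT_eq [simp]: "a \<in> N \<Longrightarrow> b \<in> N \<Longrightarrow> cl eqT \<bullet> a \<bullet> b = Z \<longleftrightarrow> a = b"
  using Le_antisym[of a b] by (auto simp: eqT_def cl_lam)

text \<open>Zero stands for truth. The characteristic function is needed where a functional of the
  model has to refer to the predicate.\<close>

lemma qfree_char:
  "qfree A \<Longrightarrow> wf_fm \<D> (Nat # \<Gamma>) A \<Longrightarrow> env \<Gamma> e \<Longrightarrow> \<exists>h \<in> dom ty1. \<forall>x \<in> N. h \<bullet> x = Z \<longleftrightarrow> sat (case_nat x e) A"
proof (induction A)
  case (Eq t u)
  let ?h = "ev e (lam \<Gamma> Nat (eqT \<cdot> t \<cdot> u))"
  show ?case
  proof (intro bexI ballI)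
    show "?h \<in> dom ty1" using Eq by (auto simp: wt_def)
    fix x assume "x \<in> N"
    moreover have "ev (case_nat x e) t \<in> N" "ev (case_nat x e) u \<in> N"
      by (rule ev_dom[of "Nat # \<Gamma>"]; use Eq \<open>x \<in> N\<close> in simp)+
    ultimately show "?h \<bullet> x = Z \<longleftrightarrow> sat (case_nat x e) (t \<doteq> u)"
      using Eq by (simp add: wt_def)
  qed
next
  case Bot
  then show ?case by (intro bexI[of _ "con (KC Nat Nat) \<bullet> One"]) simp_all
next
  case (Imp A B)
  then obtain a b where *: "a \<in> dom ty1" "\<forall>x \<in> N. a \<bullet> x = Z \<longleftrightarrow> sat (case_nat x e) A"
    "b \<in> dom ty1" "\<forall>x \<in> N. b \<bullet> x = Z \<longleftrightarrow> sat (case_nat x e) B" by auto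
  let ?h = "ev (case_nat a (case_nat b (\<lambda>_. Z))) (lam [ty1, ty1] Nat (condT \<cdot> (Var 1 \<cdot> Var 0) \<cdot> (Var 2 \<cdot> Var 0) \<cdot> zero))"
  show ?case by (intro bexI[of _ ?h]) (use * in simp_all)
qed simp_all

lemma dec_char:
  assumes "dec P" obtains h where "h \<in> dom ty1" "\<And>x. x \<in> N \<Longrightarrow> h \<bullet> x = Z \<longleftrightarrow> P x"
proof -
  from assms obtain A \<Gamma> e where "qfree A" "wf_fm \<D> (Nat # \<Gamma>) A" "env \<Gamma> e"
    "\<forall>x \<in> N. sat (case_nat x e) A \<longleftrightarrow> P x" unfolding dec_def by blast
  with qfree_char[of A \<Gamma> e] that show thesis by auto
qed

text \<open>Zero stands for truth; its companion \<open>witT\<close> returns the last hit below the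
  bound, and 0 if there is none.\<close>

definition bexT :: tm where
  "bexT = lams [] [ty1, Nat] (Con Rec \<cdot> Var 0 \<cdot> one \<cdot> lams [Nat, ty1] [Nat, Nat] (condT \<cdot> (Var 3 \<cdot> Var 0) \<cdot> zero \<cdot> Var 1))"
definition witT :: tm where
  "witT = lams [] [ty1, Nat] (Con Rec \<cdot> Var 0 \<cdot> zero \<cdot> lams [Nat, ty1] [Nat, Nat] (condT \<cdot> (Var 3 \<cdot> Var 0) \<cdot> Var 0 \<cdot> Var 1))"
lemma bexT_wt: "wt \<D> [] bexT (ty1 \<rightarrow> ty1)" by (simp add: bexT_def wt_def)
lemmas [simp] = closed_simps[OF bexT_wt]
lemma witT_wt: "wt \<D> [] witT (ty1 \<rightarrow> ty1)" by (simp add: witT_def wt_def)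
lemmas [simp] = closed_simps[OF witT_wt]

lemma bexT_Z: "p \<in> dom ty1 \<Longrightarrow> cl bexT \<bullet> p \<bullet> Z = One"
  by (simp add: bexT_def cl_lam)

lemma bexT_Sc: "p \<in> dom ty1 \<Longrightarrow> n \<in> N \<Longrightarrow> cl bexT \<bullet> p \<bullet> Sc n = (if p \<bullet> n = Z then Z else cl bexT \<bullet> p \<bullet> n)"
proof -
  assume *: "p \<in> dom ty1" "n \<in> N"
  then have "cl bexT \<bullet> p \<bullet> Sc n = Cond (p \<bullet> n) Z (cl bexT \<bullet> p \<bullet> n)"
    by (simp add: bexT_def cl_lam del: Cond_eq)
  with * show ?thesis by simp
qed

lemma witT_Sc: "p \<in> dom ty1 \<Longrightarrow> n \<in> N \<Longrightarrow> cl witT \<bullet> p \<bullet> Sc n = (if p \<bullet> n = Z then n else cl witT \<bullet> p \<bullet> n)"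
proof -
  assume *: "p \<in> dom ty1" "n \<in> N"
  then have "cl witT \<bullet> p \<bullet> Sc n = Cond (p \<bullet> n) n (cl witT \<bullet> p \<bullet> n)"
    by (simp add: witT_def cl_lam del: Cond_eq)
  with * show ?thesis by simp
qed

text \<open>With the computed witness in place of an existential quantifier, the claim can be proved
  by quantifier-free induction.\<close>

lemma bexT_witT:
  assumes "p \<in> dom ty1" "b \<in> N" "cl bexT \<bullet> p \<bullet> b = Z"
  shows "cl witT \<bullet> p \<bullet> b \<prec> b \<and> p \<bullet> (cl witT \<bullet> p \<bullet> b) = Z"
proof -
  have "cl bexT \<bullet> p \<bullet> b = Z \<longrightarrow> cl witT \<bullet> p \<bullet> b \<prec> b \<and> p \<bullet> (cl witT \<bullet> p \<bullet> b) = Z"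
    using assms(2)
  proof (induction rule: qf_induct)
    case dec show ?case using assms(1) by (intro dec_intros) simp_all
  next
    case (Suc b)
    with assms(1) bexT_Sc[of p b] witT_Sc[of p b] Lt_imp_Le[of "cl witT \<bullet> p \<bullet> b" b] show ?case by auto
  qed (use assms(1) bexT_Z in simp)
  with assms(3) show ?thesis by blast
qed

lemma bexT_eq [simp]:
  assumes "p \<in> dom ty1" "b \<in> N"
  shows "cl bexT \<bullet> p \<bullet> b = Z \<longleftrightarrow> (\<exists>i \<in> N. i \<prec> b \<and> p \<bullet> i = Z)"
proof -
  have "p \<bullet> i = Z \<longrightarrow> i \<prec> b \<longrightarrow> cl bexT \<bullet> p \<bullet> b = Z" if "i \<in> N" for i
    using assms(2)
  proof (induction rule: qf_induct)
    case dec show ?case using assms(1) that by (intro dec_intros) simp_all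
  next
    case (Suc b)
    with that assms(1) bexT_Sc[of p b] Le_antisym[of i b] Lt_iff_not_Le[of i b] Lt_iff_not_Le[of b i] show ?case
      by auto
  qed (use that in simp)
  moreover have "cl witT \<bullet> p \<bullet> b \<in> N" using assms by simp
  ultimately show ?thesis using bexT_witT[OF assms] by blast
qed

lemma witT_eq: "p \<in> dom ty1 \<Longrightarrow> b \<in> N \<Longrightarrow> i \<in> N \<Longrightarrow> i \<prec> b \<Longrightarrow> p \<bullet> i = Z \<Longrightarrow> p \<bullet> (cl witT \<bullet> p \<bullet> b) = Z"
  using bexT_witT[of p b] bexT_eq[of p b] by blast


section \<open>Plays\<close>

abbreviation Par :: "'a \<Rightarrow> 'a" where "Par n \<equiv> cl parT \<bullet> n"
abbreviation Pos :: "'a \<Rightarrow> 'a \<Rightarrow> 'a \<Rightarrow> 'a" where "Pos S\<^sub>0 S\<^sub>1 n \<equiv> cl posT \<bullet> S\<^sub>0 \<bullet> S\<^sub>1 \<bullet> n"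
abbreviation Even :: "'a \<Rightarrow> bool" where "Even s \<equiv> Par (Len s) = Z"

lemma Par_Z [simp]: "Par Z = Z"
  by (simp add: parT_def cl_lam)

lemma Par_Sc0: "n \<in> N \<Longrightarrow> Par (Sc n) = One \<ominus> Par n"
  by (simp add: parT_def cl_lam)

lemma Par_cases: "n \<in> N \<Longrightarrow> Par n = Z \<or> Par n = One"
proof (induction rule: qf_induct)
  case dec show ?case by (intro dec_intros) simp_all
qed (auto simp: Par_Sc0)

lemma Par_Sc [simp]: "n \<in> N \<Longrightarrow> Par (Sc n) = (if Par n = Z then One else Z)"
  using Par_cases[of n] by (auto simp: Par_Sc0)

lemma Pos_Z [simp]: "S\<^sub>0 \<in> dom ty1 \<Longrightarrow> S\<^sub>1 \<in> dom ty1 \<Longrightarrow> Pos S\<^sub>0 S\<^sub>1 Z = Z"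
  by (simp add: posT_def cl_lam)

lemma Pos_Sc0: "S\<^sub>0 \<in> dom ty1 \<Longrightarrow> S\<^sub>1 \<in> dom ty1 \<Longrightarrow> n \<in> N \<Longrightarrow>
    Pos S\<^sub>0 S\<^sub>1 (Sc n) = Snoc (Pos S\<^sub>0 S\<^sub>1 n) (if Par n = Z then S\<^sub>0 \<bullet> Pos S\<^sub>0 S\<^sub>1 n else S\<^sub>1 \<bullet> Pos S\<^sub>0 S\<^sub>1 n)"
proof -
  assume *: "S\<^sub>0 \<in> dom ty1" "S\<^sub>1 \<in> dom ty1" "n \<in> N"
  have "Pos S\<^sub>0 S\<^sub>1 (Sc n) = Snoc (Pos S\<^sub>0 S\<^sub>1 n) (Cond (Par n) (S\<^sub>0 \<bullet> Pos S\<^sub>0 S\<^sub>1 n) (S\<^sub>1 \<bullet> Pos S\<^sub>0 S\<^sub>1 n))"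
    using * by (simp add: posT_def cl_lam del: Cond_eq)
  with * show ?thesis by simp
qed

lemma Len_Pos [simp]:
  assumes "S\<^sub>0 \<in> dom ty1" "S\<^sub>1 \<in> dom ty1" "n \<in> N" shows "Len (Pos S\<^sub>0 S\<^sub>1 n) = n"
  using assms(3)
proof (induction rule: qf_induct)
  case dec show ?case using assms(1,2) by (intro dec_intros) simp_all
qed (use assms(1,2) in \<open>simp_all add: Pos_Sc0\<close>)

lemma Pos_Sc: "S\<^sub>0 \<in> dom ty1 \<Longrightarrow> S\<^sub>1 \<in> dom ty1 \<Longrightarrow> n \<in> N \<Longrightarrow>
    Pos S\<^sub>0 S\<^sub>1 (Sc n) = Snoc (Pos S\<^sub>0 S\<^sub>1 n)
      (if Even (Pos S\<^sub>0 S\<^sub>1 n) then S\<^sub>0 \<bullet> Pos S\<^sub>0 S\<^sub>1 n else S\<^sub>1 \<bullet> Pos S\<^sub>0 S\<^sub>1 n)"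
  by (simp add: Pos_Sc0)

lemma Init_Play [simp]:
  assumes "S\<^sub>0 \<in> dom ty1" "S\<^sub>1 \<in> dom ty1" "n \<in> N"
  shows "Init (cl playT \<bullet> S\<^sub>0 \<bullet> S\<^sub>1) n = Pos S\<^sub>0 S\<^sub>1 n"
proof -
  have play: "cl playT \<bullet> S\<^sub>0 \<bullet> S\<^sub>1 \<bullet> n = (if Par n = Z then S\<^sub>0 \<bullet> Pos S\<^sub>0 S\<^sub>1 n else S\<^sub>1 \<bullet> Pos S\<^sub>0 S\<^sub>1 n)"
    if "n \<in> N" for n
    using assms that by (simp add: playT_def cl_lam)
  show ?thesis using assms(3)
  proof (induction rule: qf_induct)
    case dec show ?case using assms(1,2) by (intro dec_intros) simp_all
  qed (use assms(1,2) play in \<open>simp_all add: Pos_Sc0\<close>)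
qed

definition Win :: "'a \<Rightarrow> 'a \<Rightarrow> 'a \<Rightarrow> bool" where
  "Win S\<^sub>0 S\<^sub>1 f \<longleftrightarrow> (\<exists>k \<in> N. f \<bullet> Pos S\<^sub>0 S\<^sub>1 k = Z)"
definition sWin :: "'a \<Rightarrow> 'a \<Rightarrow> 'a \<Rightarrow> bool" where
  "sWin S\<^sub>0 S\<^sub>1 f \<longleftrightarrow> (\<exists>k \<in> N. st k \<and> f \<bullet> Pos S\<^sub>0 S\<^sub>1 k = Z)"

text \<open>The two existential quantifiers of \<open>DETstar\<close> are merged into one over
  strategies that win for either side, so that \<open>HACint\<close> can be applied to a single
  formula.\<close>

definition good :: "'a \<Rightarrow> 'a \<Rightarrow> bool" where
  "good f S \<longleftrightarrow> (\<forall>S' \<in> dom ty1. Win S S' f) \<or> (\<forall>S' \<in> dom ty1. \<not> Win S' S f)"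

lemma sat_DETstar: "sat e DETstar \<longleftrightarrow> (\<forall>f \<in> dom ty1. st f \<longrightarrow> (\<exists>S \<in> dom ty1. st S \<and> good f S))"
  by (simp add: DETstar_def win_def Win_def good_def) (intro ball_cong imp_cong refl; blast)

lemma sat_UDET: "sat e (rel UDET) \<longleftrightarrow> (\<exists>F \<in> dom (ty1 \<rightarrow> ty1). st F \<and> (\<exists>G \<in> dom (ty1 \<rightarrow> ty1). st G \<and>
    (\<forall>f \<in> dom ty1. st f \<longrightarrow> (\<forall>S \<in> dom ty1. st S \<longrightarrow> sWin (F \<bullet> f) S f) \<or> (\<forall>S \<in> dom ty1. st S \<longrightarrow> \<not> sWin S (G \<bullet> f) f))))"
  by (simp add: UDET_def win_def sWin_def)

definition sPath :: "'a \<Rightarrow> bool" where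
  "sPath f \<longleftrightarrow> (\<exists>g \<in> dom ty1. st g \<and> (\<forall>x \<in> N. st x \<longrightarrow> f \<bullet> Init g x \<noteq> Z))"

lemma sat_S2: "sat e (rel S2) \<longleftrightarrow> (\<exists>S \<in> dom ty2. st S \<and> (\<forall>f \<in> dom ty1. st f \<longrightarrow> (S \<bullet> f = Z \<longleftrightarrow> sPath f)))"
  by (simp add: S2_def has_path_def sPath_def)
    (intro bex_cong ball_cong imp_cong refl conj_cong; blast)

section \<open>From determinacy to the Suslin functional\<close>

text \<open>In \<open>G1 h\<close> player 0 wins iff his first move is a zero of \<open>h\<close>.\<close>
definition g1T :: tm where
  "g1T = lams [] [ty1, Nat] (condT \<cdot> Var 0 \<cdot> one \<cdot> (condT \<cdot> (blT \<cdot> Var 0) \<cdot> (Var 1 \<cdot> (lastT \<cdot> Var 0)) \<cdot> one))"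

text \<open>
  In \<open>G2 f\<close> player 1 has to play the codes of longer and longer initial segments of a path through
  \<open>f\<close>, so that it suffices to compare two successive moves of his; the moves of player 0 are ignored.
\<close>
definition g2T :: tm where
  "g2T = lams [] [ty1, Nat] (condT \<cdot> Var 0 \<cdot> (Var 1 \<cdot> zero) \<cdot> (condT \<cdot> (parT \<cdot> (lenT \<cdot> Var 0))
     \<cdot> (condT \<cdot> (eqT \<cdot> (lastT \<cdot> Var 0) \<cdot> (snocT \<cdot> (lastT \<cdot> (blT \<cdot> (blT \<cdot> Var 0))) \<cdot> (lastT \<cdot> (lastT \<cdot> Var 0))))
          \<cdot> (Var 1 \<cdot> (lastT \<cdot> Var 0)) \<cdot> zero)
     \<cdot> one))"

text \<open>The strategy for player 1 in \<open>G2 f\<close> that follows the path \<open>g\<close>.\<close>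
definition psT :: tm where
  "psT = lams [] [ty1, Nat] (snocT \<cdot> (lastT \<cdot> (blT \<cdot> Var 0)) \<cdot> (Var 1 \<cdot> (lenT \<cdot> (lastT \<cdot> (blT \<cdot> Var 0)))))"

text \<open>The positions of even length in the play of a strategy for player 1 against constant zero.\<close>
definition evT :: tm where
  "evT = lams [] [ty1, Nat] (Con Rec \<cdot> Var 0 \<cdot> zero \<cdot> lams [Nat, ty1] [Nat, Nat]
     (snocT \<cdot> (snocT \<cdot> Var 1 \<cdot> zero) \<cdot> (Var 3 \<cdot> (snocT \<cdot> Var 1 \<cdot> zero))))"
text \<open>Value \<open>n\<close> is taken from move number \<open>n + 1\<close> of player 1, the
  first one whose segment has an entry with index \<open>n\<close>.\<close>

definition pathT :: tm where
  "pathT = lams [] [ty1, Nat] (lastT \<cdot> (lastT \<cdot> (evT \<cdot> Var 1 \<cdot> (Con Succ \<cdot> Var 0))))"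

lemma g1T_wt: "wt \<D> [] g1T (ty1 \<rightarrow> ty1)" by (simp add: g1T_def wt_def)
lemmas [simp] = closed_simps[OF g1T_wt]
lemma g2T_wt: "wt \<D> [] g2T (ty1 \<rightarrow> ty1)" by (simp add: g2T_def wt_def)
lemmas [simp] = closed_simps[OF g2T_wt]
lemma psT_wt: "wt \<D> [] psT (ty1 \<rightarrow> ty1)" by (simp add: psT_def wt_def)
lemmas [simp] = closed_simps[OF psT_wt]
lemma evT_wt: "wt \<D> [] evT (ty1 \<rightarrow> ty1)" by (simp add: evT_def wt_def)
lemmas [simp] = closed_simps[OF evT_wt]
lemma pathT_wt: "wt \<D> [] pathT (ty1 \<rightarrow> ty1)" by (simp add: pathT_def wt_def)
lemmas [simp] = closed_simps[OF pathT_wt]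

abbreviation K0 :: 'a where "K0 \<equiv> con (KC Nat Nat) \<bullet> Z"

lemma Pos_eq_Z [simp]: "S\<^sub>0 \<in> dom ty1 \<Longrightarrow> S\<^sub>1 \<in> dom ty1 \<Longrightarrow> k \<in> N \<Longrightarrow> Pos S\<^sub>0 S\<^sub>1 k = Z \<longleftrightarrow> k = Z"
  by (metis Len_Pos Len_Z Pos_Z)

lemma G1_Pos:
  assumes "h \<in> dom ty1" "S\<^sub>0 \<in> dom ty1" "S\<^sub>1 \<in> dom ty1" "k \<in> N"
  shows "cl g1T \<bullet> h \<bullet> Pos S\<^sub>0 S\<^sub>1 k = Z \<longleftrightarrow> k = One \<and> h \<bullet> (S\<^sub>0 \<bullet> Z) = Z"
proof -
  have G1: "cl g1T \<bullet> h \<bullet> s = (if s = Z then One else if Butl s = Z then h \<bullet> Last s else One)" if "s \<in> N" for s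
    using assms that by (simp add: g1T_def cl_lam)
  show ?thesis
    by (rule nat_cases[OF assms(4)]) (use assms in \<open>auto simp: G1 Pos_Sc\<close>)
qed

lemma Win_G1: "h \<in> dom ty1 \<Longrightarrow> S\<^sub>0 \<in> dom ty1 \<Longrightarrow> S\<^sub>1 \<in> dom ty1 \<Longrightarrow> Win S\<^sub>0 S\<^sub>1 (cl g1T \<bullet> h) \<longleftrightarrow> h \<bullet> (S\<^sub>0 \<bullet> Z) = Z"
  unfolding Win_def by (auto simp: G1_Pos)

lemma sWin_G1: "h \<in> dom ty1 \<Longrightarrow> S\<^sub>0 \<in> dom ty1 \<Longrightarrow> S\<^sub>1 \<in> dom ty1 \<Longrightarrow> sWin S\<^sub>0 S\<^sub>1 (cl g1T \<bullet> h) \<longleftrightarrow> h \<bullet> (S\<^sub>0 \<bullet> Z) = Z"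
  unfolding sWin_def by (auto simp: G1_Pos st_ap)

lemma G2_eq: "f \<in> dom ty1 \<Longrightarrow> s \<in> N \<Longrightarrow> cl g2T \<bullet> f \<bullet> s =
   (if s = Z then f \<bullet> Z else if Even s then
      (if Last s = Snoc (Last (Butl (Butl s))) (Last (Last s)) then f \<bullet> Last s else Z) else One)"
  by (simp add: g2T_def cl_lam)

lemma PS_eq: "g \<in> dom ty1 \<Longrightarrow> s \<in> N \<Longrightarrow> cl psT \<bullet> g \<bullet> s = Snoc (Last (Butl s)) (g \<bullet> Len (Last (Butl s)))"
  by (simp add: psT_def cl_lam)

text \<open>Against this strategy the moves of player 1 are initial segments of \<open>g\<close>,
  each extending the previous one. So he never loses by an illegal move, and player 0 can win only
  through a zero of \<open>f\<close> along \<open>g\<close>.\<close>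

lemma G2_path:
  assumes "f \<in> dom ty1" "g \<in> dom ty1" "S \<in> dom ty1" "k \<in> N" "cl g2T \<bullet> f \<bullet> Pos S (cl psT \<bullet> g) k = Z"
  shows "f \<bullet> Init g (Len (Last (Pos S (cl psT \<bullet> g) k))) = Z"
proof -
  let ?p = "\<lambda>k. Pos S (cl psT \<bullet> g) k"
  have dom: "cl psT \<bullet> g \<in> dom ty1" using assms by simp
  \<comment> \<open>Both parities are tracked, since at odd positions the latest move of player 1 is
    the entry before the last. At the start the default 0 of \<open>Last\<close> stands for it,
    which codes the empty segment.\<close>
  have *: "(Even (?p k) \<longrightarrow> Last (?p k) = Init g (Len (Last (?p k)))) \<and>
      (\<not> Even (?p k) \<longrightarrow> Last (Butl (?p k)) = Init g (Len (Last (Butl (?p k)))))" if "k \<in> N" for k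
    using that
  proof (induction rule: qf_induct)
    case dec show ?case using assms(1-3) by (intro dec_intros) simp_all
  next
    case (Suc k)
    then have "?p k \<in> N" using assms by simp
    then show ?case using Suc assms(1-3) dom by (auto simp: Pos_Sc PS_eq)
  qed (use assms dom in simp)
  show ?thesis
  proof (rule nat_cases[OF assms(4)])
    assume "k = Z"
    then show ?thesis using assms dom by (simp add: G2_eq)
  next
    fix m assume m: "m \<in> N" "k = Sc m"
    show ?thesis
    proof (cases "Even (?p m)")
      case True
      then show ?thesis using assms m dom by (simp add: G2_eq Pos_Sc)
    next
      case False
      then show ?thesis using assms m dom *[of m] by (simp add: G2_eq Pos_Sc PS_eq split: if_splits)
    qed
  qed
qed

text \<open>As long as player 1 has not lost, his moves are nested segments, so that their last
  entries form a path. The bound on \<open>m\<close> confines the hypothesis to standard positions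
  when \<open>n\<close> is standard.\<close>

lemma G2_won:
  assumes f: "f \<in> dom ty1" and S: "S \<in> dom ty1" and n: "n \<in> N"
    and won: "\<And>m. m \<in> N \<Longrightarrow> m \<preceq> n \<oplus> n \<Longrightarrow> cl g2T \<bullet> f \<bullet> Pos K0 S m \<noteq> Z"
  shows "f \<bullet> Init (cl pathT \<bullet> S) n \<noteq> Z"
proof -
  let ?E = "\<lambda>n. cl evT \<bullet> S \<bullet> n"
  let ?g = "cl pathT \<bullet> S"
  have E0: "?E Z = Z" using S by (simp add: evT_def cl_lam)
  have ESc: "?E (Sc m) = Snoc (Snoc (?E m) Z) (S \<bullet> Snoc (?E m) Z)" if "m \<in> N" for m
    using S that by (simp add: evT_def cl_lam)
  have g: "?g \<bullet> m = Last (Last (?E (Sc m)))" if "m \<in> N" for m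
    using S that by (simp add: pathT_def cl_lam)
  have par: "Par (m \<oplus> m) = Z" if "m \<in> N" for m
    using that
  proof (induction rule: qf_induct)
    case dec show ?case by (intro dec_intros) simp_all
  qed simp_all
  have EPos: "?E m = Pos K0 S (m \<oplus> m)" if "m \<in> N" for m
    using that
  proof (induction rule: qf_induct)
    case dec show ?case using S by (intro dec_intros) simp_all
  qed (use S E0 ESc par in \<open>simp_all add: Pos_Sc\<close>)
  have legal: "Last (?E (Sc m)) = Snoc (Last (?E m)) (?g \<bullet> m) \<and> f \<bullet> Last (?E (Sc m)) \<noteq> Z"
    if m: "m \<in> N" "Sc m \<preceq> n" for m
  proof -
    have "Sc m \<oplus> Sc m \<preceq> n \<oplus> n" by (rule Le_Add_mono) (use m n in simp_all)
    with won[of "Sc m \<oplus> Sc m"] m have "cl g2T \<bullet> f \<bullet> ?E (Sc m) \<noteq> Z" by (simp add: EPos)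
    moreover have "?E m \<in> N" "S \<bullet> Snoc (?E m) Z \<in> N" using S m by simp_all
    moreover have "Even (?E m)" using S m par[of m] by (simp add: EPos)
    ultimately show ?thesis using m f S
      by (simp add: ESc g G2_eq split: if_splits)
  qed
  have "m \<preceq> n \<longrightarrow> Init ?g m = Last (?E m)" if "m \<in> N" for m
    using that
  proof (induction rule: qf_induct)
    case dec show ?case using S n by (intro dec_intros) simp_all
  next
    case (Suc m)
    then show ?case using legal[of m] Lt_imp_Le[of m n] n S by auto
  qed (use S E0 in simp)
  then have Init: "Init ?g n = Last (?E n)" using n by simp
  show ?thesis
  proof (rule nat_cases[OF n])
    assume "n = Z"
    then show ?thesis using won[of Z] f S by (simp add: G2_eq)
  next
    fix m assume "m \<in> N" "n = Sc m"
    then show ?thesis using legal[of m] Init by auto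
  qed
qed

lemma st_below: "n \<in> N \<Longrightarrow> m \<in> N \<Longrightarrow> st n \<Longrightarrow> m \<prec> n \<Longrightarrow> st m"
proof -
  assume *: "n \<in> N" "m \<in> N" "st n" "m \<prec> n"
  have "sat (\<lambda>_. Z) (All Nat (All Nat (St Nat (Var 1) \<^bold>\<and> lt (Var 0) (Var 1) \<^bold>\<longrightarrow> St Nat (Var 0))))"
    by (rule sat_Ax[OF RCAOmega.St_below, of "[]"]) (simp_all add: wt_def lt_def)
  from bspec[OF bspec[OF this[simplified lt_def, simplified], of n], of m] * show ?thesis by simp
qed

definition hT :: tm where
  "hT = lams [] [ty1, ty1, Nat] (Var 2 \<cdot> (posT \<cdot> (Con (KC Nat Nat) \<cdot> zero) \<cdot> Var 1 \<cdot> Var 0))"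
definition zT :: tm where
  "zT = lams [] [ty1 \<rightarrow> Nat \<rightarrow> ty1, ty1, Nat] (Var 1 \<cdot> (Var 2 \<cdot> (g1T \<cdot> Var 1) \<cdot> Var 0 \<cdot> zero))"
text \<open>Zero iff no candidate strategy for the game of \<open>g1T\<close> opens with a zero of
  \<open>h\<close>. Under the hypotheses of \<open>Suslin_from_strategies\<close> this says, for
  standard \<open>h\<close>, that \<open>h\<close> has no standard zero.\<close>

definition nzT :: tm where
  "nzT = lams [] [ty1 \<rightarrow> Nat \<rightarrow> ty1, ty2, ty1]
     (condT \<cdot> (bexT \<cdot> (zT \<cdot> Var 2 \<cdot> Var 0) \<cdot> (Var 1 \<cdot> (g1T \<cdot> Var 0))) \<cdot> one \<cdot> zero)"
definition jT :: tm where
  "jT = lams [] [ty1 \<rightarrow> Nat \<rightarrow> ty1, ty2, ty1, Nat]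
     (nzT \<cdot> Var 3 \<cdot> Var 2 \<cdot> (hT \<cdot> (g2T \<cdot> Var 1) \<cdot> (Var 3 \<cdot> (g2T \<cdot> Var 1) \<cdot> Var 0)))"
definition suT :: tm where
  "suT = lams [] [ty1 \<rightarrow> Nat \<rightarrow> ty1, ty2, ty1] (bexT \<cdot> (jT \<cdot> Var 2 \<cdot> Var 1 \<cdot> Var 0) \<cdot> (Var 1 \<cdot> (g2T \<cdot> Var 0)))"

lemma hT_wt: "wt \<D> [] hT (ty1 \<rightarrow> ty1 \<rightarrow> ty1)" by (simp add: hT_def wt_def)
lemmas [simp] = closed_simps[OF hT_wt]
lemma zT_wt: "wt \<D> [] zT ((ty1 \<rightarrow> Nat \<rightarrow> ty1) \<rightarrow> ty1 \<rightarrow> ty1)" by (simp add: zT_def wt_def)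
lemmas [simp] = closed_simps[OF zT_wt]
lemma nzT_wt: "wt \<D> [] nzT ((ty1 \<rightarrow> Nat \<rightarrow> ty1) \<rightarrow> ty2 \<rightarrow> ty2)" by (simp add: nzT_def wt_def)
lemmas [simp] = closed_simps[OF nzT_wt]
lemma jT_wt: "wt \<D> [] jT ((ty1 \<rightarrow> Nat \<rightarrow> ty1) \<rightarrow> ty2 \<rightarrow> ty1 \<rightarrow> ty1)" by (simp add: jT_def wt_def)
lemmas [simp] = closed_simps[OF jT_wt]
lemma suT_wt: "wt \<D> [] suT ((ty1 \<rightarrow> Nat \<rightarrow> ty1) \<rightarrow> ty2 \<rightarrow> ty2)" by (simp add: suT_def wt_def)
lemmas [simp] = closed_simps[OF suT_wt]

text \<open>
  The hypotheses say that, for the two games above, one of the finitely many strategies \<open>F g i\<close>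
  with \<open>i < b g\<close> is a winning one; \<open>(S\<^sup>2)\<close> is then decided by two bounded searches.
\<close>
lemma Suslin_from_strategies:
  assumes F: "F \<in> dom (ty1 \<rightarrow> Nat \<rightarrow> ty1)" "st F" and b: "b \<in> dom ty2" "st b"
    and zero: "\<And>h x. h \<in> dom ty1 \<Longrightarrow> st h \<Longrightarrow> x \<in> N \<Longrightarrow> st x \<Longrightarrow> h \<bullet> x = Z \<Longrightarrow>
      \<exists>i \<in> N. i \<prec> b \<bullet> (cl g1T \<bullet> h) \<and> h \<bullet> (F \<bullet> (cl g1T \<bullet> h) \<bullet> i \<bullet> Z) = Z"
    and path: "\<And>f. f \<in> dom ty1 \<Longrightarrow> st f \<Longrightarrow> sPath f \<Longrightarrow>
      \<exists>i \<in> N. i \<prec> b \<bullet> (cl g2T \<bullet> f) \<and>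
        (\<forall>k \<in> N. st k \<longrightarrow> cl g2T \<bullet> f \<bullet> Pos K0 (F \<bullet> (cl g2T \<bullet> f) \<bullet> i) k \<noteq> Z)"
  shows "sat e (rel S2)"
  unfolding sat_S2
proof (intro bexI conjI ballI impI)
  show S: "cl suT \<bullet> F \<bullet> b \<in> dom ty2" using F b by simp
  show "st (cl suT \<bullet> F \<bullet> b)" using F b by (simp add: st_ap)
  fix f assume f: "f \<in> dom ty1" "st f"
  let ?g = "cl g2T \<bullet> f"
  let ?h = "\<lambda>j. cl hT \<bullet> ?g \<bullet> (F \<bullet> ?g \<bullet> j)"
  have h: "?h j \<in> dom ty1" if "j \<in> N" for j using that F f by simp
  have h_eq: "?h j \<bullet> x = ?g \<bullet> Pos K0 (F \<bullet> ?g \<bullet> j) x" if "j \<in> N" "x \<in> N" for j x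
    using that F f by (simp add: hT_def cl_lam)
  have nz: "cl nzT \<bullet> F \<bullet> b \<bullet> h = Z \<longleftrightarrow> \<not> (\<exists>i \<in> N. i \<prec> b \<bullet> (cl g1T \<bullet> h) \<and> h \<bullet> (F \<bullet> (cl g1T \<bullet> h) \<bullet> i \<bullet> Z) = Z)"
    if "h \<in> dom ty1" for h
  proof -
    have "cl zT \<bullet> F \<bullet> h \<bullet> i = h \<bullet> (F \<bullet> (cl g1T \<bullet> h) \<bullet> i \<bullet> Z)" if "i \<in> N" for i
      using that \<open>h \<in> dom ty1\<close> F by (simp add: zT_def cl_lam)
    with that F b show ?thesis by (simp add: nzT_def cl_lam)
  qed
  have su: "cl suT \<bullet> F \<bullet> b \<bullet> f = Z \<longleftrightarrow> (\<exists>j \<in> N. j \<prec> b \<bullet> ?g \<and> cl nzT \<bullet> F \<bullet> b \<bullet> ?h j = Z)"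
  proof -
    have "cl jT \<bullet> F \<bullet> b \<bullet> f \<bullet> j = cl nzT \<bullet> F \<bullet> b \<bullet> ?h j" if "j \<in> N" for j
      using that F b f by (simp add: jT_def cl_lam)
    with F b f show ?thesis by (simp add: suT_def cl_lam)
  qed
  have st_g: "st ?g" using f by (simp add: st_ap)
  have st_j: "st (F \<bullet> ?g \<bullet> j)" "st (?h j)" if "j \<in> N" "j \<prec> b \<bullet> ?g" for j
  proof -
    have "st (b \<bullet> ?g)" using f b st_g by (simp add: st_ap)
    then have "st j" using st_below[of "b \<bullet> ?g" j] that b f by simp
    then show "st (F \<bullet> ?g \<bullet> j)" "st (?h j)" using that F f st_g by (simp_all add: st_ap)
  qed
  show "cl suT \<bullet> F \<bullet> b \<bullet> f = Z \<longleftrightarrow> sPath f"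
    unfolding su
  proof
    assume "\<exists>j \<in> N. j \<prec> b \<bullet> ?g \<and> cl nzT \<bullet> F \<bullet> b \<bullet> ?h j = Z"
    then obtain j where j: "j \<in> N" "j \<prec> b \<bullet> ?g" "cl nzT \<bullet> F \<bullet> b \<bullet> ?h j = Z" by blast
    \<comment> \<open>The inner search finds no candidate that opens with a zero of
      \<open>?h j\<close>. By the hypothesis \<open>zero\<close> there is then no standard zero at
      all: candidate \<open>j\<close> survives every standard stage against constant zero.\<close>
    have pos: "?g \<bullet> Pos K0 (F \<bullet> ?g \<bullet> j) x \<noteq> Z" if "x \<in> N" "st x" for x
      using zero[OF h[OF j(1)] st_j(2)[OF j(1,2)] that] j(3) nz[OF h[OF j(1)]] h_eq[OF j(1) that(1)] by metis
    have S: "F \<bullet> ?g \<bullet> j \<in> dom ty1" using F f j by simp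
    show "sPath f"
      unfolding sPath_def
    proof (intro bexI conjI ballI impI)
      show "cl pathT \<bullet> (F \<bullet> ?g \<bullet> j) \<in> dom ty1" using S by simp
      show "st (cl pathT \<bullet> (F \<bullet> ?g \<bullet> j))" using S st_j[OF j(1,2)] by (simp add: st_ap)
      fix x assume x: "x \<in> N" "st x"
      show "f \<bullet> Init (cl pathT \<bullet> (F \<bullet> ?g \<bullet> j)) x \<noteq> Z"
      proof (rule G2_won[OF f(1) S x(1)])
        fix m assume m: "m \<in> N" "m \<preceq> x \<oplus> x"
        have "st (Sc (x \<oplus> x))" using x by (simp add: st_ap)
        then have "st m" using st_below[of "Sc (x \<oplus> x)" m] m x by simp
        then show "?g \<bullet> Pos K0 (F \<bullet> ?g \<bullet> j) m \<noteq> Z" using pos m by blast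
      qed
    qed
  next
    assume "sPath f"
    then obtain j where j: "j \<in> N" "j \<prec> b \<bullet> ?g" "\<forall>k \<in> N. st k \<longrightarrow> ?g \<bullet> Pos K0 (F \<bullet> ?g \<bullet> j) k \<noteq> Z"
      using path[OF f] by blast
    \<comment> \<open>A hit of the inner search would be a standard zero of \<open>?h j\<close>,
      because the index \<open>i\<close> and hence the candidate are standard; the choice of
      \<open>j\<close> excludes this.\<close>
    have "\<not> (\<exists>i \<in> N. i \<prec> b \<bullet> (cl g1T \<bullet> ?h j) \<and> ?h j \<bullet> (F \<bullet> (cl g1T \<bullet> ?h j) \<bullet> i \<bullet> Z) = Z)"
    proof (intro notI, elim bexE conjE)
      fix i assume i: "i \<in> N" "i \<prec> b \<bullet> (cl g1T \<bullet> ?h j)" "?h j \<bullet> (F \<bullet> (cl g1T \<bullet> ?h j) \<bullet> i \<bullet> Z) = Z"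
      have sh: "st (cl g1T \<bullet> ?h j)" using h[OF j(1)] st_j[OF j(1,2)] by (simp add: st_ap)
      have "st (b \<bullet> (cl g1T \<bullet> ?h j))" using b sh h[OF j(1)] by (simp add: st_ap)
      then have "st i" using st_below[of "b \<bullet> (cl g1T \<bullet> ?h j)" i] i b h[OF j(1)] by simp
      then have "st (F \<bullet> (cl g1T \<bullet> ?h j) \<bullet> i)" using F sh h[OF j(1)] i by (simp add: st_ap)
      then have "st (F \<bullet> (cl g1T \<bullet> ?h j) \<bullet> i \<bullet> Z)" using F h[OF j(1)] i by (simp add: st_ap)
      moreover have "F \<bullet> (cl g1T \<bullet> ?h j) \<bullet> i \<bullet> Z \<in> N" using F h[OF j(1)] i by simp
      ultimately show False using i(3) j(3) h_eq[OF j(1)] by metis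
    qed
    then show "\<exists>j \<in> N. j \<prec> b \<bullet> ?g \<and> cl nzT \<bullet> F \<bullet> b \<bullet> ?h j = Z"
      using j nz[OF h[OF j(1)]] by blast
  qed
qed

text \<open>The functional does not reveal which of its components wins, so both are candidates and
  the bound is two.\<close>

lemma UDET_imp_S2: "sat e (rel UDET) \<Longrightarrow> sat e (rel S2)"
proof -
  assume "sat e (rel UDET)"
  then obtain F G where F: "F \<in> dom (ty1 \<rightarrow> ty1)" "st F" and G: "G \<in> dom (ty1 \<rightarrow> ty1)" "st G"
    and FG: "\<And>f. f \<in> dom ty1 \<Longrightarrow> st f \<Longrightarrow>
      (\<forall>S \<in> dom ty1. st S \<longrightarrow> sWin (F \<bullet> f) S f) \<or> (\<forall>S \<in> dom ty1. st S \<longrightarrow> \<not> sWin S (G \<bullet> f) f)"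
    unfolding sat_UDET by blast
  define cand where "cand = lams [] [ty1 \<rightarrow> ty1, ty1 \<rightarrow> ty1, ty1, Nat, Nat]
    (condT \<cdot> Var 1 \<cdot> (Var 4 \<cdot> Var 2 \<cdot> Var 0) \<cdot> (Var 3 \<cdot> Var 2 \<cdot> Var 0))"
  have w: "wt \<D> [] cand ((ty1 \<rightarrow> ty1) \<rightarrow> (ty1 \<rightarrow> ty1) \<rightarrow> ty1 \<rightarrow> Nat \<rightarrow> ty1)" by (simp add: cand_def wt_def)
  note [simp] = closed_simps[OF w]
  let ?F = "cl cand \<bullet> F \<bullet> G"
  have cand: "?F \<bullet> f \<bullet> Z = F \<bullet> f" "?F \<bullet> f \<bullet> One = G \<bullet> f" if "f \<in> dom ty1" for f
    by (rule fun_ext[of _ Nat Nat]; use F G that in \<open>simp add: cand_def cl_lam\<close>)+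
  let ?b = "con (KC Nat ty1) \<bullet> Sc One"
  have b: "?b \<bullet> f = Sc One" if "f \<in> dom ty1" for f using that by simp
  show ?thesis
  proof (rule Suslin_from_strategies)
    show "?F \<in> dom (ty1 \<rightarrow> Nat \<rightarrow> ty1)" using F G by simp
    show "st ?F" using F G by (simp add: st_ap)
    show "?b \<in> dom ty2" by simp
    show "st ?b" by (simp add: st_ap)
  next
    fix h x assume h: "h \<in> dom ty1" "st h" and x: "x \<in> N" "st x" and hx: "h \<bullet> x = Z"
    let ?g = "cl g1T \<bullet> h"
    have g: "?g \<in> dom ty1" "st ?g" "F \<bullet> ?g \<in> dom ty1" "G \<bullet> ?g \<in> dom ty1" using h F G by (simp_all add: st_ap)
    have k: "con (KC Nat Nat) \<bullet> y \<in> dom ty1" "y \<in> N \<Longrightarrow> st y \<Longrightarrow> st (con (KC Nat Nat) \<bullet> y)" if "y \<in> N" for y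
      using that by (simp_all add: st_ap)
    \<comment> \<open>Playing the zero \<open>x\<close> at once beats the second component. So the
      first component wins, and in this game it can win only by its opening move.\<close>
    have "sWin (con (KC Nat Nat) \<bullet> x) (G \<bullet> ?g) ?g"
      using h hx x g k by (subst sWin_G1) simp_all
    then have "sWin (F \<bullet> ?g) K0 ?g"
      using FG[OF g(1,2)] k[OF x(1)] k[of Z] x by fastforce
    then have "h \<bullet> (F \<bullet> ?g \<bullet> Z) = Z" using h g k[of Z] by (subst (asm) sWin_G1) simp_all
    then show "\<exists>i \<in> N. i \<prec> ?b \<bullet> ?g \<and> h \<bullet> (?F \<bullet> ?g \<bullet> i \<bullet> Z) = Z"
      using g by (intro bexI[of _ Z]) (simp_all add: cand)
  next
    fix f assume f: "f \<in> dom ty1" "st f" "sPath f"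
    let ?g = "cl g2T \<bullet> f"
    have g: "?g \<in> dom ty1" "st ?g" "F \<bullet> ?g \<in> dom ty1" "st (F \<bullet> ?g)" "G \<bullet> ?g \<in> dom ty1"
      using f F G by (simp_all add: st_ap)
    from f(3) obtain p where p: "p \<in> dom ty1" "st p" "\<And>x. x \<in> N \<Longrightarrow> st x \<Longrightarrow> f \<bullet> Init p x \<noteq> Z"
      unfolding sPath_def by blast
    have ps: "cl psT \<bullet> p \<in> dom ty1" "st (cl psT \<bullet> p)" using p by (simp_all add: st_ap)
    \<comment> \<open>Following the path \<open>p\<close> defeats the first component, so the second
      one cannot be beaten at a standard stage, in particular not by constant zero.\<close>
    have "\<not> sWin (F \<bullet> ?g) (cl psT \<bullet> p) ?g"
      unfolding sWin_def
    proof (intro notI, elim bexE conjE)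
      fix k assume k: "k \<in> N" "st k" "?g \<bullet> Pos (F \<bullet> ?g) (cl psT \<bullet> p) k = Z"
      let ?x = "Len (Last (Pos (F \<bullet> ?g) (cl psT \<bullet> p) k))"
      have "f \<bullet> Init p ?x = Z" by (rule G2_path[OF f(1) p(1) g(3) k(1,3)])
      moreover have "?x \<in> N" using g ps k by simp
      moreover have "st ?x" using g ps k f F p by (simp add: st_ap)
      ultimately show False using p(3) by blast
    qed
    then have "\<not> sWin K0 (G \<bullet> ?g) ?g" using FG[OF g(1,2)] ps by (auto simp: st_ap)
    then have "\<forall>k \<in> N. st k \<longrightarrow> ?g \<bullet> Pos K0 (G \<bullet> ?g) k \<noteq> Z" unfolding sWin_def by blast
    then show "\<exists>i \<in> N. i \<prec> ?b \<bullet> ?g \<and> (\<forall>k \<in> N. st k \<longrightarrow> ?g \<bullet> Pos K0 (?F \<bullet> ?g \<bullet> i) k \<noteq> Z)"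
      using g by (intro bexI[of _ One]) (simp_all add: cand)
  qed
qed

lemma HACint_lists:
  assumes A: "internal A" "wf_fm \<D> [\<tau>, \<rho>] A"
    and ex: "\<And>x. x \<in> dom \<rho> \<Longrightarrow> st x \<Longrightarrow> \<exists>y \<in> dom \<tau>. st y \<and> sat (case_nat y (case_nat x (\<lambda>_. Z))) A"
  shows "\<exists>F \<in> dom (\<rho> \<rightarrow> Star \<tau>). st F \<and> (\<forall>x \<in> dom \<rho>. st x \<longrightarrow> (\<exists>i \<in> N. i \<prec> con (cst.Len \<tau>) \<bullet> (F \<bullet> x) \<and>
    sat (case_nat (con (cst.Ent \<tau>) \<bullet> (F \<bullet> x) \<bullet> i) (case_nat x (\<lambda>_. Z))) A))"
proof -
  let ?s = "case_nat (Con (cst.Ent \<tau>) \<cdot> (Var 2 \<cdot> Var 1) \<cdot> Var 0) (case_nat (Var 1) (\<lambda>n. Var (n + 3)))"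
  let ?B = "AllSt \<rho> (ExSt \<tau> A) \<^bold>\<longrightarrow> ExSt (\<rho> \<rightarrow> Star \<tau>) (AllSt \<rho> (Ex Nat
            (lt (Var 0) (Con (cst.Len \<tau>) \<cdot> (Var 2 \<cdot> Var 1)) \<^bold>\<and> fsub ?s A)))"
  have "typed_sub \<D> [\<tau>, \<rho>] [Nat, \<rho>, \<rho> \<rightarrow> Star \<tau>] ?s"
    by (auto simp: typed_sub_def wt_def less_Suc_eq_0_disj)
  then have wf: "wf_fm \<D> [] ?B"
    using A wf_fsub[OF A(2)] by (simp add: wt_def lt_def)
  have "sat (\<lambda>_. Z) ?B"
    by (rule sat_Ax[OF RCAOmega.HACint, of _ _ _ "[]"]) (use A wf in simp_all)
  moreover have "sat (\<lambda>_. Z) (AllSt \<rho> (ExSt \<tau> A))" using ex by auto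
  ultimately have "sat (\<lambda>_. Z) (ExSt (\<rho> \<rightarrow> Star \<tau>) (AllSt \<rho> (Ex Nat
            (lt (Var 0) (Con (cst.Len \<tau>) \<cdot> (Var 2 \<cdot> Var 1)) \<^bold>\<and> fsub ?s A))))"
    by (simp only: sat.simps(4)[of _ "AllSt \<rho> (ExSt \<tau> A)"])
  then obtain F where F: "F \<in> dom (\<rho> \<rightarrow> Star \<tau>)" "st F"
    and FA: "\<And>x. x \<in> dom \<rho> \<Longrightarrow> st x \<Longrightarrow> \<exists>i \<in> N. i \<prec> con (cst.Len \<tau>) \<bullet> (F \<bullet> x) \<and>
      sat (case_nat i (case_nat x (case_nat F (\<lambda>_. Z)))) (fsub ?s A)"
    by (auto simp: lt_def)
  have "sat (case_nat i (case_nat x (case_nat F (\<lambda>_. Z)))) (fsub ?s A) \<longleftrightarrow>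
      sat (case_nat (con (cst.Ent \<tau>) \<bullet> (F \<bullet> x) \<bullet> i) (case_nat x (\<lambda>_. Z))) A" for i x
    unfolding sat_fsub by (rule sat_cong[OF A(2)]) (auto simp: less_Suc_eq_0_disj)
  with F FA show ?thesis by (intro bexI[of _ F]) auto
qed

definition goodF :: fm where
  "goodF = (All ty1 (win (play (Var 1) (Var 0)) (Var 2)) \<^bold>\<or> All ty1 (\<^bold>\<not> win (play (Var 0) (Var 1)) (Var 2)))"

lemma sat_goodF: "f \<in> dom ty1 \<Longrightarrow> S \<in> dom ty1 \<Longrightarrow> sat (case_nat S (case_nat f e)) goodF \<longleftrightarrow> good f S"
  by (simp add: goodF_def win_def Win_def good_def) blast

text \<open>\<open>HACint\<close> collects standard strategies into finite lists, at least one entry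
  of which wins. Here opponents are arbitrary and plays may be won at nonstandard stages. So a path
  has to be correct at nonstandard lengths too before player 1 can safely follow it; determinacy
  itself supplies the transfer for this.\<close>

lemma DETstar_imp_S2: "sat e DETstar \<Longrightarrow> sat e (rel S2)"
proof -
  assume "sat e DETstar"
  then have det: "\<exists>S \<in> dom ty1. st S \<and> good f S" if "f \<in> dom ty1" "st f" for f
    using that unfolding sat_DETstar by blast
  have "\<exists>F \<in> dom (ty1 \<rightarrow> Star ty1). st F \<and> (\<forall>f \<in> dom ty1. st f \<longrightarrow> (\<exists>i \<in> N. i \<prec> con (cst.Len ty1) \<bullet> (F \<bullet> f) \<and>
    sat (case_nat (con (cst.Ent ty1) \<bullet> (F \<bullet> f) \<bullet> i) (case_nat f (\<lambda>_. Z))) goodF))"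
  proof (rule HACint_lists)
    show "internal goodF" by (simp add: goodF_def win_def)
    show "wf_fm \<D> [ty1, ty1] goodF" by (simp add: goodF_def win_def wt_def)
    show "\<exists>S \<in> dom ty1. st S \<and> sat (case_nat S (case_nat f (\<lambda>_. Z))) goodF" if "f \<in> dom ty1" "st f" for f
      using det[OF that] sat_goodF that(1) by blast
  qed
  then obtain F where F: "F \<in> dom (ty1 \<rightarrow> Star ty1)" "st F" and FA: "\<And>f. f \<in> dom ty1 \<Longrightarrow> st f \<Longrightarrow>
    \<exists>i \<in> N. i \<prec> con (cst.Len ty1) \<bullet> (F \<bullet> f) \<and> good f (con (cst.Ent ty1) \<bullet> (F \<bullet> f) \<bullet> i)"
    using sat_goodF by fastforce
  define ent where "ent = lams [] [ty1 \<rightarrow> Star ty1, ty1, Nat] (Con (cst.Ent ty1) \<cdot> (Var 2 \<cdot> Var 1) \<cdot> Var 0)"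
  define len where "len = lams [] [ty1 \<rightarrow> Star ty1, ty1] (Con (cst.Len ty1) \<cdot> (Var 1 \<cdot> Var 0))"
  have w: "wt \<D> [] ent ((ty1 \<rightarrow> Star ty1) \<rightarrow> ty1 \<rightarrow> Nat \<rightarrow> ty1)" "wt \<D> [] len ((ty1 \<rightarrow> Star ty1) \<rightarrow> ty2)"
    by (simp_all add: ent_def len_def wt_def)
  note [simp] = closed_simps[OF w(1)] closed_simps[OF w(2)]
  let ?F = "cl ent \<bullet> F" and ?b = "cl len \<bullet> F"
  have ent: "?F \<bullet> f \<bullet> i = con (cst.Ent ty1) \<bullet> (F \<bullet> f) \<bullet> i" if "f \<in> dom ty1" "i \<in> N" for f i
    using that F by (simp add: ent_def cl_lam)
  have len: "?b \<bullet> f = con (cst.Len ty1) \<bullet> (F \<bullet> f)" if "f \<in> dom ty1" for f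
    using that F by (simp add: len_def cl_lam)
  have Fgood: "\<exists>i \<in> N. i \<prec> ?b \<bullet> f \<and> good f (?F \<bullet> f \<bullet> i)" if "f \<in> dom ty1" "st f" for f
    using FA[OF that] ent len that by fastforce
  have g1: "cl g1T \<bullet> h \<in> dom ty1" "st h \<Longrightarrow> st (cl g1T \<bullet> h)" if "h \<in> dom ty1" for h
    using that by (simp_all add: st_ap)
  have k: "con (KC Nat Nat) \<bullet> y \<in> dom ty1" if "y \<in> N" for y using that by simp
  have zero: "h \<bullet> (S \<bullet> Z) = Z"
    if "h \<in> dom ty1" "S \<in> dom ty1" "good (cl g1T \<bullet> h) S" "x \<in> N" "h \<bullet> x = Z" for h S x
  proof -
    have "Win (con (KC Nat Nat) \<bullet> x) S (cl g1T \<bullet> h)"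
      using that by (subst Win_G1) simp_all
    then have "Win S K0 (cl g1T \<bullet> h)"
      using that k[of x] k[of Z] unfolding good_def by fastforce
    then show ?thesis using that k[of Z] by (subst (asm) Win_G1) simp_all
  qed
  \<comment> \<open>If \<open>h\<close> has any zero, a standard good strategy in the game of
    \<open>g1T\<close> must open with a zero of \<open>h\<close>, and this zero is standard.\<close>
  have transfer: "h \<bullet> x \<noteq> Z"
    if h: "h \<in> dom ty1" "st h" and "\<And>x. x \<in> N \<Longrightarrow> st x \<Longrightarrow> h \<bullet> x \<noteq> Z" and x: "x \<in> N" for h x
  proof
    assume hx: "h \<bullet> x = Z"
    obtain S where S: "S \<in> dom ty1" "st S" "good (cl g1T \<bullet> h) S" using det[OF g1(1)] g1(2) h by blast
    from zero[OF h(1) S(1,3) x hx] that(3)[of "S \<bullet> Z"] S show False by (simp add: st_ap)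
  qed
  show ?thesis
  proof (rule Suslin_from_strategies)
    show "?F \<in> dom (ty1 \<rightarrow> Nat \<rightarrow> ty1)" "?b \<in> dom ty2" using F by simp_all
    show "st ?F" "st ?b" using F by (simp_all add: st_ap)
  next
    fix h x assume h: "h \<in> dom ty1" "st h" and x: "x \<in> N" "st x" and hx: "h \<bullet> x = Z"
    obtain i where i: "i \<in> N" "i \<prec> ?b \<bullet> (cl g1T \<bullet> h)" "good (cl g1T \<bullet> h) (?F \<bullet> (cl g1T \<bullet> h) \<bullet> i)"
      using Fgood[OF g1(1)] g1(2) h by blast
    have "?F \<bullet> (cl g1T \<bullet> h) \<bullet> i \<in> dom ty1" using F h i by simp
    from zero[OF h(1) this i(3) x(1) hx] i
    show "\<exists>i \<in> N. i \<prec> ?b \<bullet> (cl g1T \<bullet> h) \<and> h \<bullet> (?F \<bullet> (cl g1T \<bullet> h) \<bullet> i \<bullet> Z) = Z" by blast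
  next
    fix f assume f: "f \<in> dom ty1" "st f" "sPath f"
    let ?g = "cl g2T \<bullet> f"
    have g: "?g \<in> dom ty1" "st ?g" using f by (simp_all add: st_ap)
    from f(3) obtain p where p: "p \<in> dom ty1" "st p" "\<And>x. x \<in> N \<Longrightarrow> st x \<Longrightarrow> f \<bullet> Init p x \<noteq> Z"
      unfolding sPath_def by blast
    define cmp where "cmp = lams [] [ty1, ty1, Nat] (Var 2 \<cdot> (initT \<cdot> Var 1 \<cdot> Var 0))"
    have w: "wt \<D> [] cmp (ty1 \<rightarrow> ty1 \<rightarrow> ty1)" by (simp add: cmp_def wt_def)
    note [simp] = closed_simps[OF w]
    have cmp: "cl cmp \<bullet> f \<bullet> p \<bullet> x = f \<bullet> Init p x" if "x \<in> N" for x
      using that f p by (simp add: cmp_def cl_lam)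
    have p': "f \<bullet> Init p x \<noteq> Z" if "x \<in> N" for x
      using transfer[of "cl cmp \<bullet> f \<bullet> p" x] cmp p f that by (simp add: st_ap)
    obtain i where i: "i \<in> N" "i \<prec> ?b \<bullet> ?g" "good ?g (?F \<bullet> ?g \<bullet> i)" using Fgood[OF g] by blast
    have S: "?F \<bullet> ?g \<bullet> i \<in> dom ty1" using F g i by simp
    have ps: "cl psT \<bullet> p \<in> dom ty1" using p by simp
    have "\<not> Win (?F \<bullet> ?g \<bullet> i) (cl psT \<bullet> p) ?g"
      unfolding Win_def
    proof (intro notI, elim bexE)
      fix k assume k: "k \<in> N" "?g \<bullet> Pos (?F \<bullet> ?g \<bullet> i) (cl psT \<bullet> p) k = Z"
      have "f \<bullet> Init p (Len (Last (Pos (?F \<bullet> ?g \<bullet> i) (cl psT \<bullet> p) k))) = Z"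
        by (rule G2_path[OF f(1) p(1) S k])
      moreover have "Len (Last (Pos (?F \<bullet> ?g \<bullet> i) (cl psT \<bullet> p) k)) \<in> N" using S ps k by simp
      ultimately show False using p' by blast
    qed
    then have "\<not> Win K0 (?F \<bullet> ?g \<bullet> i) ?g" using i(3) ps k[of Z] unfolding good_def by fastforce
    then have "\<forall>k \<in> N. st k \<longrightarrow> ?g \<bullet> Pos K0 (?F \<bullet> ?g \<bullet> i) k \<noteq> Z" unfolding Win_def by blast
    with i show "\<exists>i \<in> N. i \<prec> ?b \<bullet> ?g \<and> (\<forall>k \<in> N. st k \<longrightarrow> ?g \<bullet> Pos K0 (?F \<bullet> ?g \<bullet> i) k \<noteq> Z)" by blast
  qed
qed

end

section \<open>The Suslin functional and transfer\<close>

context omega_model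
begin

lemma PFTP:
  assumes A: "internal A" "wf_fm \<D> [\<tau>] A"
    and "\<And>x. x \<in> dom \<tau> \<Longrightarrow> st x \<Longrightarrow> sat (case_nat x (\<lambda>_. Z)) A" and "x \<in> dom \<tau>"
  shows "sat (case_nat x (\<lambda>_. Z)) A"
proof -
  have "sat (\<lambda>_. Z) (AllSt \<tau> A \<^bold>\<longrightarrow> All \<tau> A)"
    by (rule sat_Ax[OF RCAOmega.PFTP[OF A], of "[]"]) (use A in simp_all)
  then show ?thesis using assms(3,4) by simp
qed

text \<open>As a tree, \<open>liftT h\<close> has at each level all nodes or none, so it has a path
  iff \<open>h\<close> has no zero. In this way the Suslin functional decides universal statements
  about numbers.\<close>

definition liftT :: tm where
  "liftT = lams [] [ty1, Nat] (Var 1 \<cdot> (lenT \<cdot> Var 0))"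
definition consT :: tm where
  "consT = lams [] [Nat, ty1, Nat] (Con Rec \<cdot> Var 0 \<cdot> Var 2 \<cdot> lams [Nat, ty1, Nat] [Nat, Nat] (Var 3 \<cdot> Var 0))"
definition tailT :: tm where
  "tailT = lams [] [ty1, Nat] (Var 1 \<cdot> (Con Succ \<cdot> Var 0))"
definition fstcT :: tm where
  "fstcT = lams [] [ty1, Nat] (fstT \<cdot> (Var 1 \<cdot> Var 0))"
definition sndcT :: tm where
  "sndcT = lams [] [ty1, Nat] (sndT \<cdot> (Var 1 \<cdot> Var 0))"
definition paircT :: tm where
  "paircT = lams [] [ty1, ty1, Nat] (pairT \<cdot> (Var 2 \<cdot> Var 0) \<cdot> (Var 1 \<cdot> Var 0))"
definition compT :: tm where
  "compT = lams [] [ty1, ty1, Nat] (Var 2 \<cdot> (initT \<cdot> Var 1 \<cdot> Var 0))"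

lemma liftT_wt: "wt \<D> [] liftT (ty1 \<rightarrow> ty1)" by (simp add: liftT_def wt_def)
lemmas [simp] = closed_simps[OF liftT_wt]
lemma consT_wt: "wt \<D> [] consT (Nat \<rightarrow> ty1 \<rightarrow> ty1)" by (simp add: consT_def wt_def)
lemmas [simp] = closed_simps[OF consT_wt]
lemma tailT_wt: "wt \<D> [] tailT (ty1 \<rightarrow> ty1)" by (simp add: tailT_def wt_def)
lemmas [simp] = closed_simps[OF tailT_wt]
lemma fstcT_wt: "wt \<D> [] fstcT (ty1 \<rightarrow> ty1)" by (simp add: fstcT_def wt_def)
lemmas [simp] = closed_simps[OF fstcT_wt]
lemma sndcT_wt: "wt \<D> [] sndcT (ty1 \<rightarrow> ty1)" by (simp add: sndcT_def wt_def)
lemmas [simp] = closed_simps[OF sndcT_wt]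
lemma paircT_wt: "wt \<D> [] paircT (ty1 \<rightarrow> ty1 \<rightarrow> ty1)" by (simp add: paircT_def wt_def)
lemmas [simp] = closed_simps[OF paircT_wt]
lemma compT_wt: "wt \<D> [] compT (ty1 \<rightarrow> ty1 \<rightarrow> ty1)" by (simp add: compT_def wt_def)
lemmas [simp] = closed_simps[OF compT_wt]

lemma lift_eq [simp]: "h \<in> dom ty1 \<Longrightarrow> s \<in> N \<Longrightarrow> cl liftT \<bullet> h \<bullet> s = h \<bullet> Len s"
  by (simp add: liftT_def cl_lam)

lemma cons_Z [simp]: "x \<in> N \<Longrightarrow> h \<in> dom ty1 \<Longrightarrow> cl consT \<bullet> x \<bullet> h \<bullet> Z = x"
  by (simp add: consT_def cl_lam)

lemma cons_Sc [simp]: "x \<in> N \<Longrightarrow> h \<in> dom ty1 \<Longrightarrow> n \<in> N \<Longrightarrow> cl consT \<bullet> x \<bullet> h \<bullet> Sc n = h \<bullet> n"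
  by (simp add: consT_def cl_lam)

lemma tail_eq [simp]: "h \<in> dom ty1 \<Longrightarrow> n \<in> N \<Longrightarrow> cl tailT \<bullet> h \<bullet> n = h \<bullet> Sc n"
  by (simp add: tailT_def cl_lam)

lemma tail_cons [simp]: "x \<in> N \<Longrightarrow> h \<in> dom ty1 \<Longrightarrow> cl tailT \<bullet> (cl consT \<bullet> x \<bullet> h) = h"
  by (rule fun_ext[of _ Nat Nat]) simp_all

lemma fstc_pairc [simp]: "f \<in> dom ty1 \<Longrightarrow> g \<in> dom ty1 \<Longrightarrow> cl fstcT \<bullet> (cl paircT \<bullet> f \<bullet> g) = f"
  by (rule fun_ext[of _ Nat Nat]) (simp_all add: fstcT_def paircT_def cl_lam)

lemma sndc_pairc [simp]: "f \<in> dom ty1 \<Longrightarrow> g \<in> dom ty1 \<Longrightarrow> cl sndcT \<bullet> (cl paircT \<bullet> f \<bullet> g) = g"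
  by (rule fun_ext[of _ Nat Nat]) (simp_all add: sndcT_def paircT_def cl_lam)

lemma comp_eq [simp]: "f \<in> dom ty1 \<Longrightarrow> g \<in> dom ty1 \<Longrightarrow> x \<in> N \<Longrightarrow> cl compT \<bullet> f \<bullet> g \<bullet> x = f \<bullet> Init g x"
  by (simp add: compT_def cl_lam)

definition Path :: "'a \<Rightarrow> bool" where
  "Path f \<longleftrightarrow> (\<exists>g \<in> dom ty1. \<forall>x \<in> N. f \<bullet> Init g x \<noteq> Z)"

end

locale suslin_model = omega_model U T ap con st \<D> Ax
  for U :: "'a set" and T :: "'a \<Rightarrow> ty" and ap :: "'a \<Rightarrow> 'a \<Rightarrow> 'a" (infixl "\<bullet>" 90)
    and con :: "cst \<Rightarrow> 'a" and st :: "'a \<Rightarrow> bool" and \<D> :: specs and Ax :: "ctx \<Rightarrow> fm set" +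
  fixes i :: nat
  assumes Xi_spec: "\<D> (i, ty2) = Some Suslin_spec"
    and S2: "sat e (rel S2)"
begin

definition XiT :: tm where "XiT = Con (Xi i ty2)"

lemma XiT_wt: "wt \<D> [] XiT ty2" by (simp add: XiT_def wt_def Xi_spec)
lemmas [simp] = closed_simps[OF XiT_wt]

abbreviation X\<^sub>0 :: "'a \<Rightarrow> 'a" where "X\<^sub>0 f \<equiv> cl XiT \<bullet> f"

text \<open>The axiom for the constant compares it with a functional that meets the specification
  relative to standard objects. The one from \<open>S2\<close> does so after its values are
  normalised to 0 and 1.\<close>

lemma Xi_sPath: "f \<in> dom ty1 \<Longrightarrow> st f \<Longrightarrow> X\<^sub>0 f = Z \<longleftrightarrow> sPath f"
proof -
  assume f: "f \<in> dom ty1" "st f"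
  obtain S where S: "S \<in> dom ty2" "st S" "\<And>f. f \<in> dom ty1 \<Longrightarrow> st f \<Longrightarrow> S \<bullet> f = Z \<longleftrightarrow> sPath f"
    using S2 unfolding sat_S2 by blast
  define norm where "norm = lams [] [ty2, ty1] (condT \<cdot> (Var 1 \<cdot> Var 0) \<cdot> zero \<cdot> one)"
  have w: "wt \<D> [] norm (ty2 \<rightarrow> ty2)" by (simp add: norm_def wt_def)
  note [simp] = closed_simps[OF w]
  let ?S = "cl norm \<bullet> S"
  have norm: "?S \<bullet> f = (if S \<bullet> f = Z then Z else One)" if "f \<in> dom ty1" for f
    using that S by (simp add: norm_def cl_lam)
  let ?B = "rel Suslin_spec \<^bold>\<longrightarrow> rel (eq ty2 (Con (Xi i ty2)) (Var 0))"
  have "sat (\<lambda>_. Z) (St ty2 (Con (Xi i ty2)) \<^bold>\<and> AllSt ty2 ?B)"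
    by (rule sat_Ax[OF RCAOmega.Spec[where \<D> = \<D> and i = i and \<tau> = ty2 and D = Suslin_spec, OF Xi_spec], of "[]"])
      (simp_all add: wt_def Xi_spec Suslin_spec_def has_path_def)
  then have "sat (\<lambda>_. Z) (AllSt ty2 ?B)" by simp
  moreover have "?S \<in> dom ty2" "st ?S" using S by (simp_all add: st_ap)
  ultimately have B: "sat (case_nat ?S (\<lambda>_. Z)) ?B" by (simp only: sat.simps ev.simps nat.case) blast
  have "sat (case_nat ?S (\<lambda>_. Z)) (rel Suslin_spec)"
    using S by (simp add: Suslin_spec_def has_path_def norm sPath_def)
  with B have "sat (case_nat ?S (\<lambda>_. Z)) (rel (eq ty2 (Con (Xi i ty2)) (Var 0)))" by simp
  with f have "con (Xi i ty2) \<bullet> f = ?S \<bullet> f" by simp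
  moreover have "cl XiT = con (Xi i ty2)" by (simp add: XiT_def cl_def)
  ultimately show ?thesis using norm[OF f(1)] S(3)[OF f] by simp
qed

lemma sPath_lift: "h \<in> dom ty1 \<Longrightarrow> sPath (cl liftT \<bullet> h) \<longleftrightarrow> (\<forall>x \<in> N. st x \<longrightarrow> h \<bullet> x \<noteq> Z)"
proof -
  assume h: "h \<in> dom ty1"
  have "cl liftT \<bullet> h \<bullet> Init g x = h \<bullet> x" if "g \<in> dom ty1" "x \<in> N" for g x
    using h that by simp
  moreover have "K0 \<in> dom ty1" "st K0" by (simp_all add: st_ap)
  ultimately show ?thesis unfolding sPath_def by metis
qed

lemma Xi_lift_imp:
  assumes "h \<in> dom ty1" "x \<in> N" "X\<^sub>0 (cl liftT \<bullet> h) = Z" shows "h \<bullet> x \<noteq> Z"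
proof -
  \<comment> \<open>The variable codes a number, its value at 0, together with a function, its tail.
    For a standard code both are standard, and \<open>Xi_sPath\<close> gives the formula.\<close>
  let ?A = "(XiT \<cdot> (liftT \<cdot> (tailT \<cdot> Var 0)) \<doteq> zero) \<^bold>\<longrightarrow> \<^bold>\<not> (tailT \<cdot> Var 0 \<cdot> (Var 0 \<cdot> zero) \<doteq> zero)"
  have "sat (case_nat (cl consT \<bullet> x \<bullet> h) (\<lambda>_. Z)) ?A"
  proof (rule PFTP)
    show "wf_fm \<D> [ty1] ?A" by (simp add: wt_def)
    fix k assume k: "k \<in> dom ty1" "st k"
    then have t: "cl tailT \<bullet> k \<in> dom ty1" "st (cl liftT \<bullet> (cl tailT \<bullet> k))" "k \<bullet> Z \<in> N" "st (k \<bullet> Z)"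
      by (simp_all add: st_ap)
    then have "cl liftT \<bullet> (cl tailT \<bullet> k) \<in> dom ty1" by simp
    from Xi_sPath[OF this t(2)] sPath_lift[OF t(1)] t
    show "sat (case_nat k (\<lambda>_. Z)) ?A" by (simp del: tail_eq)
  qed (use assms in simp_all)
  with assms show ?thesis by simp
qed

text \<open>The value of the Suslin constant carries the information across: for standard
  \<open>h\<close> it is determined by the standard arguments, and by \<open>Xi_lift_imp\<close> it
  is right about all of them.\<close>

lemma Pi01_transfer:
  "h \<in> dom ty1 \<Longrightarrow> st h \<Longrightarrow> (\<And>x. x \<in> N \<Longrightarrow> st x \<Longrightarrow> h \<bullet> x \<noteq> Z) \<Longrightarrow> x \<in> N \<Longrightarrow> h \<bullet> x \<noteq> Z"
  using Xi_sPath[of "cl liftT \<bullet> h"] sPath_lift[of h] Xi_lift_imp[of h x] by (simp add: st_ap)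

text \<open>For standard trees a standard path is a path at all lengths by
  \<open>Pi01_transfer\<close>. The two implications are transferred separately; for the converse,
  tree and path are coded together, so that the path becomes part of the universally quantified
  variable.\<close>

lemma Xi_Path:
  assumes f: "f \<in> dom ty1" shows "X\<^sub>0 f = Z \<longleftrightarrow> Path f"
proof
  assume *: "X\<^sub>0 f = Z"
  let ?A = "(XiT \<cdot> Var 0 \<doteq> zero) \<^bold>\<longrightarrow> has_path (Var 0)"
  have "sat (case_nat f (\<lambda>_. Z)) ?A"
  proof (rule PFTP)
    show "wf_fm \<D> [ty1] ?A" by (simp add: wt_def has_path_def)
    fix k assume k: "k \<in> dom ty1" "st k"
    have "Path k" if "sPath k"
    proof -
      from that obtain g where g: "g \<in> dom ty1" "st g" "\<And>x. x \<in> N \<Longrightarrow> st x \<Longrightarrow> k \<bullet> Init g x \<noteq> Z"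
        unfolding sPath_def by blast
      have "k \<bullet> Init g x \<noteq> Z" if "x \<in> N" for x
        using Pi01_transfer[of "cl compT \<bullet> k \<bullet> g" x] g k that by (simp add: st_ap)
      with g show ?thesis unfolding Path_def by blast
    qed
    with Xi_sPath[OF k] k show "sat (case_nat k (\<lambda>_. Z)) ?A"
      by (simp add: has_path_def Path_def)
  qed (use f in \<open>simp_all add: has_path_def\<close>)
  with * f show "Path f" by (simp add: has_path_def Path_def)
next
  assume "Path f"
  then obtain g where g: "g \<in> dom ty1" "\<forall>x \<in> N. f \<bullet> Init g x \<noteq> Z" unfolding Path_def by blast
  let ?A = "All Nat (\<^bold>\<not> (fstcT \<cdot> Var 1 \<cdot> (initT \<cdot> (sndcT \<cdot> Var 1) \<cdot> Var 0) \<doteq> zero)) \<^bold>\<longrightarrow> (XiT \<cdot> (fstcT \<cdot> Var 0) \<doteq> zero)"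
  have "sat (case_nat (cl paircT \<bullet> f \<bullet> g) (\<lambda>_. Z)) ?A"
  proof (rule PFTP)
    show "wf_fm \<D> [ty1] ?A" by (simp add: wt_def)
    fix k assume k: "k \<in> dom ty1" "st k"
    then have t: "cl fstcT \<bullet> k \<in> dom ty1" "st (cl fstcT \<bullet> k)" "cl sndcT \<bullet> k \<in> dom ty1" "st (cl sndcT \<bullet> k)"
      by (simp_all add: st_ap)
    have "sPath (cl fstcT \<bullet> k)" if "\<forall>x \<in> N. cl fstcT \<bullet> k \<bullet> Init (cl sndcT \<bullet> k) x \<noteq> Z"
      unfolding sPath_def using that t by blast
    with Xi_sPath[OF t(1,2)] show "sat (case_nat k (\<lambda>_. Z)) ?A" by simp
  qed (use f g in simp_all)
  with f g show "X\<^sub>0 f = Z" by simp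
qed

lemma Xi_lift: "h \<in> dom ty1 \<Longrightarrow> X\<^sub>0 (cl liftT \<bullet> h) = Z \<longleftrightarrow> (\<forall>x \<in> N. h \<bullet> x \<noteq> Z)"
proof -
  assume h: "h \<in> dom ty1"
  have "cl liftT \<bullet> h \<bullet> Init g x = h \<bullet> x" if "g \<in> dom ty1" "x \<in> N" for g x
    using h that by simp
  moreover have "K0 \<in> dom ty1" by simp
  moreover have "cl liftT \<bullet> h \<in> dom ty1" using h by simp
  ultimately show ?thesis using Xi_Path[of "cl liftT \<bullet> h"] unfolding Path_def by metis
qed

text \<open>This is Feferman's search functional. By \<open>Xi_lift\<close> the existence of a zero
  is quantifier-free in the Suslin constant, so \<open>QFAC\<close> applies. Standardness of the
  functional is not claimed.\<close>

lemma ex_mu: "\<exists>m \<in> dom ty2. \<forall>h \<in> dom ty1. (\<exists>x \<in> N. h \<bullet> x = Z) \<longrightarrow> h \<bullet> (m \<bullet> h) = Z"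
proof -
  let ?A = "\<^bold>\<not> (XiT \<cdot> (liftT \<cdot> Var 1) \<doteq> zero) \<^bold>\<longrightarrow> (Var 1 \<cdot> Var 0 \<doteq> zero)"
  let ?s = "case_nat (Var 1 \<cdot> Var 0) (case_nat (Var 0) (\<lambda>n. Var (n + 2)))"
  have "sat (\<lambda>_. Z) (All ty1 (Ex Nat ?A) \<^bold>\<longrightarrow> Ex ty2 (All ty1 (fsub ?s ?A)))"
    by (rule sat_Base[OF RCAw.QFAC, of _ "[]"]) (simp_all add: wt_def)
  moreover have "sat (\<lambda>_. Z) (All ty1 (Ex Nat ?A))"
  proof -
    have "\<exists>x \<in> N. X\<^sub>0 (cl liftT \<bullet> h) = Z \<or> h \<bullet> x = Z" if "h \<in> dom ty1" for h
    proof (cases "X\<^sub>0 (cl liftT \<bullet> h) = Z")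
      case True
      then show ?thesis by (intro bexI[of _ Z]) simp_all
    next
      case False
      then show ?thesis using Xi_lift[OF that] by blast
    qed
    then have "\<forall>h \<in> dom ty1. \<exists>x \<in> N. X\<^sub>0 (cl liftT \<bullet> h) = Z \<or> h \<bullet> x = Z" by blast
    then show ?thesis by simp
  qed
  ultimately have "sat (\<lambda>_. Z) (Ex ty2 (All ty1 (fsub ?s ?A)))" by (simp only: sat.simps(4)) blast
  then obtain m where "m \<in> dom ty2" "\<forall>h \<in> dom ty1. X\<^sub>0 (cl liftT \<bullet> h) = Z \<or> h \<bullet> (m \<bullet> h) = Z"
    by auto
  with Xi_lift show ?thesis by blast
qed

lemma choice:
  assumes p: "p \<in> dom (Nat \<rightarrow> ty1)"
  obtains m where "m \<in> dom ty1" "\<And>v. v \<in> N \<Longrightarrow> (\<exists>n \<in> N. p \<bullet> v \<bullet> n = Z) \<Longrightarrow> p \<bullet> v \<bullet> (m \<bullet> v) = Z"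
proof -
  obtain \<mu> where mu: "\<mu> \<in> dom ty2" "\<forall>h \<in> dom ty1. (\<exists>x \<in> N. h \<bullet> x = Z) \<longrightarrow> h \<bullet> (\<mu> \<bullet> h) = Z"
    using ex_mu by blast
  let ?m = "ev (case_nat \<mu> (case_nat p (\<lambda>_. Z))) (lam [ty2, Nat \<rightarrow> ty1] Nat (Var 1 \<cdot> (Var 2 \<cdot> Var 0)))"
  show thesis
  proof (rule that[of ?m])
    show "?m \<in> dom ty1" using mu p by simp
    fix v assume v: "v \<in> N" "\<exists>n \<in> N. p \<bullet> v \<bullet> n = Z"
    have "p \<bullet> v \<in> dom ty1" using p v by simp
    with mu(2) v have "p \<bullet> v \<bullet> (\<mu> \<bullet> (p \<bullet> v)) = Z" by blast
    then show "p \<bullet> v \<bullet> (?m \<bullet> v) = Z" using mu(1) p v by simp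
  qed
qed

text \<open>Primitive recursion through the search functional; the values are numbers, so the
  recursor of type 0 suffices.\<close>

lemma dependent_choice:
  assumes r: "r \<in> dom (Nat \<rightarrow> Nat \<rightarrow> ty1)" and a: "a \<in> N"
  obtains c where "c \<in> dom ty1" "c \<bullet> Z = a"
    "\<And>v. v \<in> N \<Longrightarrow> (\<exists>n \<in> N. r \<bullet> v \<bullet> (c \<bullet> v) \<bullet> n = Z) \<Longrightarrow> r \<bullet> v \<bullet> (c \<bullet> v) \<bullet> (c \<bullet> Sc v) = Z"
proof -
  obtain \<mu> where mu: "\<mu> \<in> dom ty2" "\<forall>h \<in> dom ty1. (\<exists>x \<in> N. h \<bullet> x = Z) \<longrightarrow> h \<bullet> (\<mu> \<bullet> h) = Z"
    using ex_mu by blast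
  let ?G = "[ty2, Nat \<rightarrow> Nat \<rightarrow> ty1, Nat]"
  let ?c = "ev (case_nat \<mu> (case_nat r (case_nat a (\<lambda>_. Z))))
    (lam ?G Nat (Con Rec \<cdot> Var 0 \<cdot> Var 3 \<cdot> lams (Nat # ?G) [Nat, Nat] (Var 3 \<cdot> (Var 4 \<cdot> Var 0 \<cdot> Var 1))))"
  have c: "?c \<in> dom ty1" using mu r a by simp
  have c0: "?c \<bullet> Z = a" using mu(1) r a by simp
  have cSc: "?c \<bullet> Sc v = \<mu> \<bullet> (r \<bullet> v \<bullet> (?c \<bullet> v))" if "v \<in> N" for v
    using mu(1) r a that by simp
  show thesis
  proof (rule that[OF c c0])
    fix v assume v: "v \<in> N" "\<exists>n \<in> N. r \<bullet> v \<bullet> (?c \<bullet> v) \<bullet> n = Z"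
    have "r \<bullet> v \<bullet> (?c \<bullet> v) \<in> dom ty1" using r c v by (simp del: ev_lam)
    with mu(2) v show "r \<bullet> v \<bullet> (?c \<bullet> v) \<bullet> (?c \<bullet> Sc v) = Z" unfolding cSc[OF v(1)] by blast
  qed
qed


section \<open>A normal form\<close>

text \<open>
  The tree at a node of length \<open>y\<close> checks the instance \<open>z = Fst y\<close>, provided that the two values of the
  path that this instance queries are already determined by the node.
\<close>
definition nfT :: tm where
  "nfT = lams [] [ty1, Nat \<rightarrow> ty1, Nat \<rightarrow> Nat \<rightarrow> ty1, Nat]
    (let y = lenT \<cdot> Var 0; z = fstT \<cdot> y; a = Var 3 \<cdot> z; v = entT \<cdot> Var 0 \<cdot> a; b = Var 2 \<cdot> z \<cdot> v
     in condT \<cdot> (subT \<cdot> (Con Succ \<cdot> a) \<cdot> y) \<cdot>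
         (condT \<cdot> (subT \<cdot> (Con Succ \<cdot> b) \<cdot> y) \<cdot> (Var 1 \<cdot> z \<cdot> v \<cdot> (entT \<cdot> Var 0 \<cdot> b)) \<cdot> one) \<cdot> one)"

lemma nfT_wt: "wt \<D> [] nfT (ty1 \<rightarrow> (Nat \<rightarrow> ty1) \<rightarrow> (Nat \<rightarrow> Nat \<rightarrow> ty1) \<rightarrow> ty1)"
  by (simp add: nfT_def wt_def Let_def)
lemmas [simp] = closed_simps[OF nfT_wt]

text \<open>Each instance \<open>z\<close> is checked at infinitely many levels, and at some of them
  both answers of \<open>g\<close> are known. The second query may depend on the first answer, as is
  needed when \<open>g\<close> itself names the move to be made.\<close>

lemma Path_nf:
  assumes q: "q\<^sub>1 \<in> dom ty1" "q\<^sub>2 \<in> dom (Nat \<rightarrow> ty1)" "c \<in> dom (Nat \<rightarrow> Nat \<rightarrow> ty1)"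
  shows "X\<^sub>0 (cl nfT \<bullet> q\<^sub>1 \<bullet> q\<^sub>2 \<bullet> c) = Z \<longleftrightarrow>
    (\<exists>g \<in> dom ty1. \<forall>z \<in> N. c \<bullet> z \<bullet> (g \<bullet> (q\<^sub>1 \<bullet> z)) \<bullet> (g \<bullet> (q\<^sub>2 \<bullet> z \<bullet> (g \<bullet> (q\<^sub>1 \<bullet> z)))) \<noteq> Z)"
proof -
  let ?f = "cl nfT \<bullet> q\<^sub>1 \<bullet> q\<^sub>2 \<bullet> c"
  let ?C = "\<lambda>g z. c \<bullet> z \<bullet> (g \<bullet> (q\<^sub>1 \<bullet> z)) \<bullet> (g \<bullet> (q\<^sub>2 \<bullet> z \<bullet> (g \<bullet> (q\<^sub>1 \<bullet> z))))"
  have nf: "?f \<bullet> Init g y = (if q\<^sub>1 \<bullet> Fst y \<prec> y \<and> q\<^sub>2 \<bullet> Fst y \<bullet> (g \<bullet> (q\<^sub>1 \<bullet> Fst y)) \<prec> y then ?C g (Fst y) else One)"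
    if "g \<in> dom ty1" "y \<in> N" for g y
    using that q by (simp add: nfT_def cl_lam Let_def Ent_Init)
  have "(\<forall>y \<in> N. ?f \<bullet> Init g y \<noteq> Z) \<longleftrightarrow> (\<forall>z \<in> N. ?C g z \<noteq> Z)" if g: "g \<in> dom ty1" for g
  proof (intro iffI ballI)
    fix z assume *: "\<forall>y \<in> N. ?f \<bullet> Init g y \<noteq> Z" and z: "z \<in> N"
    let ?a = "q\<^sub>1 \<bullet> z" let ?b = "q\<^sub>2 \<bullet> z \<bullet> (g \<bullet> ?a)"
    \<comment> \<open>A level that belongs to instance \<open>z\<close> and lies above both queried
      arguments.\<close>
    let ?y = "Pr z (Sc ?a \<oplus> Sc ?b)"
    have dom: "?a \<in> N" "?b \<in> N" using q z g by simp_all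
    have le: "Sc ?a \<oplus> Sc ?b \<preceq> ?y" using dom z by (intro Le_Pr2) simp_all
    have "?a \<prec> ?y" "?b \<prec> ?y"
      by (rule Le_trans[OF _ le], use dom z in \<open>simp_all del: Add_Sc Sc_Add\<close>)+
    then show "?C g z \<noteq> Z" using bspec[OF *, of ?y] nf[OF g, of ?y] dom z by simp
  next
    fix y assume *: "\<forall>z \<in> N. ?C g z \<noteq> Z" and y: "y \<in> N"
    then show "?f \<bullet> Init g y \<noteq> Z" using nf[OF g y] by simp
  qed
  moreover have "?f \<in> dom ty1" using q by simp
  ultimately show ?thesis using Xi_Path[of ?f] unfolding Path_def by blast
qed


section \<open>Greatest fixed points\<close>

text \<open>
  A state \<open>v\<close> is lost if \<open>k v = 0\<close>, won if \<open>k v = 1\<close>, and otherwise one moves to \<open>r v n\<close>, for all \<open>n\<close>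
  if \<open>k v = 2\<close> and for some \<open>n\<close> if \<open>k v > 2\<close>.  The set of states from which one need not lose is the
  greatest fixed point of \<open>step\<close>; the function witnessing membership of \<open>v\<close> maps \<open>v\<close> to 0 outside of
  some invariant set, and to \<open>n + 1\<close> for a suitable move \<open>n\<close> inside.
\<close>
definition step :: "'a \<Rightarrow> 'a \<Rightarrow> ('a \<Rightarrow> bool) \<Rightarrow> 'a \<Rightarrow> bool" where
  "step k r P v \<longleftrightarrow> k \<bullet> v \<noteq> Z \<and> (Pred (k \<bullet> v) = Z \<or>
     (if Pred (Pred (k \<bullet> v)) = Z then \<forall>n \<in> N. P (r \<bullet> v \<bullet> n) else \<exists>n \<in> N. P (r \<bullet> v \<bullet> n)))"

text \<open>These terms supply the instances of the normal form for membership of \<open>x\<close>.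
  Instance 0 asks that \<open>g(x)\<close> be nonzero. Instance \<open>Pr v n + 1\<close> asks for
  the closure condition at \<open>v\<close>: the first query is at \<open>v\<close>, the second at
  the state moved to, where \<open>n\<close> is the move if all moves count and
  \<open>g(v) - 1\<close> otherwise.\<close>

definition gq1T :: tm where
  "gq1T = lams [] [Nat, Nat] (condT \<cdot> Var 0 \<cdot> Var 1 \<cdot> (fstT \<cdot> (predT \<cdot> Var 0)))"
definition gq2T :: tm where
  "gq2T = lams [] [ty1, Nat \<rightarrow> ty1, Nat, Nat] (Var 2 \<cdot> (fstT \<cdot> (predT \<cdot> Var 1)) \<cdot>
     (condT \<cdot> (predT \<cdot> (predT \<cdot> (Var 3 \<cdot> (fstT \<cdot> (predT \<cdot> Var 1))))) \<cdot> (sndT \<cdot> (predT \<cdot> Var 1)) \<cdot> (predT \<cdot> Var 0)))"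
definition gcT :: tm where
  "gcT = lams [] [ty1, Nat, Nat, Nat] (condT \<cdot> Var 2 \<cdot> Var 1 \<cdot> (condT \<cdot> Var 1 \<cdot> one \<cdot>
     (condT \<cdot> (Var 3 \<cdot> (fstT \<cdot> (predT \<cdot> Var 2))) \<cdot> zero \<cdot>
       (condT \<cdot> (predT \<cdot> (Var 3 \<cdot> (fstT \<cdot> (predT \<cdot> Var 2)))) \<cdot> one \<cdot> Var 0))))"
definition gfpT :: tm where
  "gfpT = lams [] [ty1, Nat \<rightarrow> ty1, Nat]
     (XiT \<cdot> (nfT \<cdot> (gq1T \<cdot> Var 0) \<cdot> (gq2T \<cdot> Var 2 \<cdot> Var 1) \<cdot> (gcT \<cdot> Var 2)))"

lemma gq1T_wt: "wt \<D> [] gq1T (Nat \<rightarrow> ty1)" by (simp add: gq1T_def wt_def)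
lemmas [simp] = closed_simps[OF gq1T_wt]
lemma gq2T_wt: "wt \<D> [] gq2T (ty1 \<rightarrow> (Nat \<rightarrow> ty1) \<rightarrow> Nat \<rightarrow> ty1)" by (simp add: gq2T_def wt_def)
lemmas [simp] = closed_simps[OF gq2T_wt]
lemma gcT_wt: "wt \<D> [] gcT (ty1 \<rightarrow> Nat \<rightarrow> Nat \<rightarrow> ty1)" by (simp add: gcT_def wt_def)
lemmas [simp] = closed_simps[OF gcT_wt]
lemma gfpT_wt: "wt \<D> [] gfpT (ty1 \<rightarrow> (Nat \<rightarrow> ty1) \<rightarrow> ty1)" by (simp add: gfpT_def wt_def)
lemmas [simp] = closed_simps[OF gfpT_wt]

definition Gfp :: "'a \<Rightarrow> 'a \<Rightarrow> 'a \<Rightarrow> bool" where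
  "Gfp k r v \<longleftrightarrow> cl gfpT \<bullet> k \<bullet> r \<bullet> v = Z"

definition wit_fn :: "'a \<Rightarrow> 'a \<Rightarrow> 'a \<Rightarrow> bool" where
  "wit_fn k r g \<longleftrightarrow> (\<forall>v \<in> N. \<forall>n \<in> N. g \<bullet> v \<noteq> Z \<longrightarrow> k \<bullet> v \<noteq> Z \<and> (Pred (k \<bullet> v) = Z \<or>
     g \<bullet> (r \<bullet> v \<bullet> (if Pred (Pred (k \<bullet> v)) = Z then n else Pred (g \<bullet> v))) \<noteq> Z))"

context
  fixes k r assumes k: "k \<in> dom ty1" and r: "r \<in> dom (Nat \<rightarrow> ty1)"
begin

lemma Gfp_iff:
  assumes x: "x \<in> N" shows "Gfp k r x \<longleftrightarrow> (\<exists>g \<in> dom ty1. g \<bullet> x \<noteq> Z \<and> wit_fn k r g)"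
proof -
  let ?q1 = "cl gq1T \<bullet> x" and ?q2 = "cl gq2T \<bullet> k \<bullet> r" and ?c = "cl gcT \<bullet> k"
  have q: "?q1 \<in> dom ty1" "?q2 \<in> dom (Nat \<rightarrow> ty1)" "?c \<in> dom (Nat \<rightarrow> Nat \<rightarrow> ty1)" using k r x by simp_all
  have q1: "?q1 \<bullet> Z = x" "?q1 \<bullet> Sc z = Fst z" if "z \<in> N" for z
    using that x by (simp_all add: gq1T_def cl_lam)
  have q2: "?q2 \<bullet> Sc z \<bullet> a = r \<bullet> Fst z \<bullet> (if Pred (Pred (k \<bullet> Fst z)) = Z then Snd z else Pred a)"
    if "z \<in> N" "a \<in> N" for z a
    using that k r by (simp add: gq2T_def cl_lam)
  have c: "?c \<bullet> Z \<bullet> a \<bullet> b = a"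
    "?c \<bullet> Sc z \<bullet> a \<bullet> b \<noteq> Z \<longleftrightarrow> (a \<noteq> Z \<longrightarrow> k \<bullet> Fst z \<noteq> Z \<and> (Pred (k \<bullet> Fst z) = Z \<or> b \<noteq> Z))"
    if "z \<in> N" "a \<in> N" "b \<in> N" for z a b
    using that k by (auto simp: gcT_def cl_lam)
  let ?C = "\<lambda>g z. ?c \<bullet> z \<bullet> (g \<bullet> (?q1 \<bullet> z)) \<bullet> (g \<bullet> (?q2 \<bullet> z \<bullet> (g \<bullet> (?q1 \<bullet> z))))"
  have "(\<forall>z \<in> N. ?C g z \<noteq> Z) \<longleftrightarrow> g \<bullet> x \<noteq> Z \<and> wit_fn k r g" if g: "g \<in> dom ty1" for g
  proof -
    let ?D = "\<lambda>v n. g \<bullet> v \<noteq> Z \<longrightarrow> k \<bullet> v \<noteq> Z \<and> (Pred (k \<bullet> v) = Z \<or>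
     g \<bullet> (r \<bullet> v \<bullet> (if Pred (Pred (k \<bullet> v)) = Z then n else Pred (g \<bullet> v))) \<noteq> Z)"
    have CZ: "?C g Z = g \<bullet> x"
    proof -
      have "?q2 \<bullet> Z \<bullet> (g \<bullet> x) \<in> N" using q g x k r by simp
      then show ?thesis using c(1)[of Z "g \<bullet> x" "g \<bullet> (?q2 \<bullet> Z \<bullet> (g \<bullet> x))"] q1(1)[of Z] g x by simp
    qed
    have CSc: "?C g (Sc z) \<noteq> Z \<longleftrightarrow> ?D (Fst z) (Snd z)" if z: "z \<in> N" for z
    proof -
      have d: "g \<bullet> Fst z \<in> N" using g z by simp
      have "g \<bullet> (r \<bullet> Fst z \<bullet> (if Pred (Pred (k \<bullet> Fst z)) = Z then Snd z else Pred (g \<bullet> Fst z))) \<in> N"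
        using g z r k by simp
      from c(2)[OF z d this] show ?thesis unfolding q1(2)[OF z] q2[OF z d] .
    qed
    show ?thesis
    proof
      assume *: "\<forall>z \<in> N. ?C g z \<noteq> Z"
      have "?D v n" if "v \<in> N" "n \<in> N" for v n
      proof -
        have "Sc (Pr v n) \<in> N" "Pr v n \<in> N" using that by simp_all
        with * CSc[of "Pr v n"] have "?D (Fst (Pr v n)) (Snd (Pr v n))" by blast
        then show ?thesis unfolding Fst_Pr[OF that] Snd_Pr[OF that] .
      qed
      moreover have "g \<bullet> x \<noteq> Z" using bspec[OF *, of Z] unfolding CZ by simp
      ultimately show "g \<bullet> x \<noteq> Z \<and> wit_fn k r g" unfolding wit_fn_def by blast
    next
      assume *: "g \<bullet> x \<noteq> Z \<and> wit_fn k r g"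
      show "\<forall>z \<in> N. ?C g z \<noteq> Z"
      proof
        fix z assume "z \<in> N"
        then show "?C g z \<noteq> Z"
        proof (rule nat_cases)
          assume "z = Z"
          then show ?thesis using CZ * by simp
        next
          fix m assume m: "m \<in> N" "z = Sc m"
          have "Fst m \<in> N" "Snd m \<in> N" using m by simp_all
          then have "?D (Fst m) (Snd m)" using * unfolding wit_fn_def by blast
          then show ?thesis unfolding m(2) CSc[OF m(1)] .
        qed
      qed
    qed
  qed
  moreover have "cl gfpT \<bullet> k \<bullet> r \<bullet> x = X\<^sub>0 (cl nfT \<bullet> ?q1 \<bullet> ?q2 \<bullet> ?c)"
    using k r x by (simp add: gfpT_def cl_lam)
  ultimately show ?thesis unfolding Gfp_def using Path_nf[OF q] by auto
qed

lemma Gfp_unfold: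
  assumes x: "x \<in> N" and "Gfp k r x" shows "step k r (Gfp k r) x"
proof -
  obtain g where g: "g \<in> dom ty1" "g \<bullet> x \<noteq> Z" "wit_fn k r g" using assms Gfp_iff by blast
  have G: "Gfp k r v" if "v \<in> N" "g \<bullet> v \<noteq> Z" for v using that g Gfp_iff by blast
  have *: "k \<bullet> x \<noteq> Z" "Pred (k \<bullet> x) = Z \<or>
     g \<bullet> (r \<bullet> x \<bullet> (if Pred (Pred (k \<bullet> x)) = Z then n else Pred (g \<bullet> x))) \<noteq> Z" if "n \<in> N" for n
    using g that x unfolding wit_fn_def by blast+
  have dom: "r \<bullet> x \<bullet> n \<in> N" if "n \<in> N" for n using that r x by simp
  have "Pred (g \<bullet> x) \<in> N" using g x by simp
  show ?thesis
  proof (cases "Pred (k \<bullet> x) = Z")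
    case True
    then show ?thesis using *(1)[of Z] by (simp add: step_def)
  next
    case False
    show ?thesis
    proof (cases "Pred (Pred (k \<bullet> x)) = Z")
      case True
      then have "\<forall>n \<in> N. Gfp k r (r \<bullet> x \<bullet> n)" using *(2) False G dom by auto
      then show ?thesis using *(1)[of Z] True by (simp add: step_def)
    next
      case F: False
      have "Gfp k r (r \<bullet> x \<bullet> Pred (g \<bullet> x))"
        using *(2)[of Z] False F G[OF dom[OF \<open>Pred (g \<bullet> x) \<in> N\<close>]] by simp
      then show ?thesis using *(1)[of Z] F \<open>Pred (g \<bullet> x) \<in> N\<close> unfolding step_def by auto
    qed
  qed
qed

text \<open>The witnessing function has to be an element of the model. Its support is an invariant
  set, so this set must be decidable, and its moves are selected by \<open>choice\<close>, that is,
  by the search functional.\<close>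

lemma Gfp_coinduct:
  assumes P: "dec P" and closed: "\<And>v. v \<in> N \<Longrightarrow> P v \<Longrightarrow> step k r P v" and x: "x \<in> N" "P x"
  shows "Gfp k r x"
proof -
  obtain h where h: "h \<in> dom ty1" "\<And>v. v \<in> N \<Longrightarrow> h \<bullet> v = Z \<longleftrightarrow> P v" using dec_char[OF P] by blast
  let ?p = "ev (case_nat h (case_nat r (\<lambda>_. Z))) (lams [ty1, Nat \<rightarrow> ty1] [Nat, Nat] (Var 2 \<cdot> (Var 3 \<cdot> Var 1 \<cdot> Var 0)))"
  have p: "?p \<in> dom (Nat \<rightarrow> ty1)" and p_eq: "\<And>v n. v \<in> N \<Longrightarrow> n \<in> N \<Longrightarrow> ?p \<bullet> v \<bullet> n = h \<bullet> (r \<bullet> v \<bullet> n)"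
    using h(1) r by simp_all
  obtain m where m: "m \<in> dom ty1" "\<And>v. v \<in> N \<Longrightarrow> (\<exists>n \<in> N. ?p \<bullet> v \<bullet> n = Z) \<Longrightarrow> ?p \<bullet> v \<bullet> (m \<bullet> v) = Z"
    using choice[OF p] by blast
  let ?g = "ev (case_nat h (case_nat m (\<lambda>_. Z))) (lam [ty1, ty1] Nat (condT \<cdot> (Var 1 \<cdot> Var 0) \<cdot> (Con Succ \<cdot> (Var 2 \<cdot> Var 0)) \<cdot> zero))"
  have g: "?g \<in> dom ty1" and g_eq: "\<And>v. v \<in> N \<Longrightarrow> ?g \<bullet> v = (if P v then Sc (m \<bullet> v) else Z)"
    using h m(1) by simp_all
  have dom: "r \<bullet> v \<bullet> n \<in> N" if "v \<in> N" "n \<in> N" for v n using that r by simp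
  have mv: "m \<bullet> v \<in> N" if "v \<in> N" for v using that m(1) by simp
  have "wit_fn k r ?g"
    unfolding wit_fn_def
  proof (intro ballI impI)
    fix v n assume v: "v \<in> N" and n: "n \<in> N" and "?g \<bullet> v \<noteq> Z"
    then have Pv: "P v" using g_eq[OF v] by (simp split: if_splits)
    have s: "step k r P v" by (rule closed[OF v Pv])
    have gP: "?g \<bullet> w \<noteq> Z" if "w \<in> N" "P w" for w using that g_eq[of w] mv[of w] by simp
    have Pg: "Pred (?g \<bullet> v) = m \<bullet> v" using g_eq[OF v] Pv mv[OF v] by simp
    have "P (r \<bullet> v \<bullet> (m \<bullet> v))" if "\<exists>n \<in> N. P (r \<bullet> v \<bullet> n)"
    proof -
      have "\<exists>n \<in> N. ?p \<bullet> v \<bullet> n = Z" using that p_eq[OF v] h(2) dom[OF v] by metis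
      from m(2)[OF v this] show ?thesis using p_eq[OF v mv[OF v]] h(2)[OF dom[OF v mv[OF v]]] by metis
    qed
    with s have "k \<bullet> v \<noteq> Z \<and> (Pred (k \<bullet> v) = Z \<or> P (r \<bullet> v \<bullet> (if Pred (Pred (k \<bullet> v)) = Z then n else m \<bullet> v)))"
      using n unfolding step_def by (cases "Pred (Pred (k \<bullet> v)) = Z") (simp_all only: if_True if_False simp_thms, blast+)
    moreover have "r \<bullet> v \<bullet> (if Pred (Pred (k \<bullet> v)) = Z then n else m \<bullet> v) \<in> N"
      by (cases "Pred (Pred (k \<bullet> v)) = Z") (simp_all only: if_True if_False simp_thms dom[OF v n] dom[OF v mv[OF v]])
    ultimately show "k \<bullet> v \<noteq> Z \<and> (Pred (k \<bullet> v) = Z \<or>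
        ?g \<bullet> (r \<bullet> v \<bullet> (if Pred (Pred (k \<bullet> v)) = Z then n else Pred (?g \<bullet> v))) \<noteq> Z)"
      unfolding Pg using gP by blast
  qed
  moreover have "?g \<bullet> x \<noteq> Z" using g_eq[OF x(1)] x(2) mv[OF x(1)] by simp
  ultimately show ?thesis using Gfp_iff[OF x(1)] g by blast
qed

lemma step_mono: "step k r P v \<Longrightarrow> v \<in> N \<Longrightarrow> (\<And>w. w \<in> N \<Longrightarrow> P w \<Longrightarrow> Q w) \<Longrightarrow> step k r Q v"
proof -
  assume s: "step k r P v" and v: "v \<in> N" and PQ: "\<And>w. w \<in> N \<Longrightarrow> P w \<Longrightarrow> Q w"
  have "Q (r \<bullet> v \<bullet> n)" if "n \<in> N" "P (r \<bullet> v \<bullet> n)" for n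
    by (rule PQ) (use r v that in simp_all)
  with s show ?thesis unfolding step_def by metis
qed

text \<open>Adding the state \<open>x\<close> to the fixed point gives a set that is still
  decidable, since \<open>Gfp\<close> is the zero set of a term, and still closed, so coinduction
  applies.\<close>

lemma Gfp_fold:
  assumes x: "x \<in> N" and s: "step k r (Gfp k r) x" shows "Gfp k r x"
proof (rule Gfp_coinduct[of "\<lambda>v. Gfp k r v \<or> v = x"])
  show "dec (\<lambda>v. Gfp k r v \<or> v = x)"
    unfolding Gfp_def using k r x by (intro dec_intros) simp_all
  fix v assume v: "v \<in> N" "Gfp k r v \<or> v = x"
  then have "step k r (Gfp k r) v" using Gfp_unfold s by blast
  then show "step k r (\<lambda>v. Gfp k r v \<or> v = x) v" by (rule step_mono) (use v in auto)
qed (use x in simp_all)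

end

end

section \<open>The comparison game\<close>

context suslin_model
begin

text \<open>
  A state codes a pair of positions \<open>t\<close> and \<open>u\<close> in the game \<open>f\<close>, together with a bit that says whether
  a move is to be made in \<open>t\<close> or in \<open>u\<close>; the quantifiers are such that \<open>Gt t u\<close> expresses that the rank
  of \<open>t\<close> (as a position won by player 0) is greater than that of \<open>u\<close>, or undefined.
\<close>
definition kindT :: tm where
  "kindT = lams [] [ty1, Nat]
    (let t = fstT \<cdot> (sndT \<cdot> Var 0); u = sndT \<cdot> (sndT \<cdot> Var 0); two = Con Succ \<cdot> one; three = Con Succ \<cdot> two
     in condT \<cdot> (fstT \<cdot> Var 0)
       \<cdot> (condT \<cdot> (Var 1 \<cdot> t) \<cdot> zero \<cdot> (condT \<cdot> (parT \<cdot> (lenT \<cdot> t)) \<cdot> two \<cdot> three))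
       \<cdot> (condT \<cdot> (Var 1 \<cdot> u) \<cdot> one \<cdot> (condT \<cdot> (parT \<cdot> (lenT \<cdot> u)) \<cdot> three \<cdot> two)))"
definition moveT :: tm where
  "moveT = lams [] [Nat, Nat]
    (let t = fstT \<cdot> (sndT \<cdot> Var 1); u = sndT \<cdot> (sndT \<cdot> Var 1)
     in condT \<cdot> (fstT \<cdot> Var 1) \<cdot> (pairT \<cdot> one \<cdot> (pairT \<cdot> (snocT \<cdot> t \<cdot> Var 0) \<cdot> u))
       \<cdot> (pairT \<cdot> zero \<cdot> (pairT \<cdot> t \<cdot> (snocT \<cdot> u \<cdot> Var 0))))"
definition gtT :: tm where
  "gtT = lams [] [ty1, Nat, Nat, Nat] (gfpT \<cdot> (kindT \<cdot> Var 3) \<cdot> moveT \<cdot> (pairT \<cdot> Var 2 \<cdot> (pairT \<cdot> Var 1 \<cdot> Var 0)))"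

lemma kindT_wt: "wt \<D> [] kindT (ty1 \<rightarrow> ty1)" by (simp add: kindT_def wt_def Let_def)
lemmas [simp] = closed_simps[OF kindT_wt]
lemma moveT_wt: "wt \<D> [] moveT (Nat \<rightarrow> ty1)" by (simp add: moveT_def wt_def Let_def)
lemmas [simp] = closed_simps[OF moveT_wt]
lemma gtT_wt: "wt \<D> [] gtT (ty1 \<rightarrow> Nat \<rightarrow> Nat \<rightarrow> ty1)" by (simp add: gtT_def wt_def)
lemmas [simp] = closed_simps[OF gtT_wt]

text \<open>With the queries \<open>g(z)\<close> and \<open>g(z + 1)\<close> the normal form says
  that \<open>g\<close> is a descending chain; instance 0 also fixes where the chain starts.\<close>

definition idT :: tm where "idT = lams [] [Nat] (Var 0)"
definition scT :: tm where "scT = lams [] [Nat, Nat] (Con Succ \<cdot> Var 1)"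
definition chT :: tm where
  "chT = lams [] [ty1, Nat, Nat, Nat, Nat]
    (let w = condT \<cdot> (gtT \<cdot> Var 4 \<cdot> zero \<cdot> Var 1 \<cdot> Var 0) \<cdot> one \<cdot> zero
     in condT \<cdot> Var 2 \<cdot> (condT \<cdot> (eqT \<cdot> Var 1 \<cdot> Var 3) \<cdot> w \<cdot> zero) \<cdot> w)"
text \<open>\<open>xT f s = 0\<close> iff there is an infinite descending chain that starts with the position \<open>s\<close>.\<close>
definition xT :: tm where
  "xT = lams [] [ty1, Nat] (XiT \<cdot> (nfT \<cdot> idT \<cdot> scT \<cdot> (chT \<cdot> Var 1 \<cdot> Var 0)))"

lemma idT_wt: "wt \<D> [] idT ty1" by (simp add: idT_def wt_def)
lemmas [simp] = closed_simps[OF idT_wt]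
lemma scT_wt: "wt \<D> [] scT (Nat \<rightarrow> ty1)" by (simp add: scT_def wt_def)
lemmas [simp] = closed_simps[OF scT_wt]
lemma chT_wt: "wt \<D> [] chT (ty1 \<rightarrow> Nat \<rightarrow> Nat \<rightarrow> Nat \<rightarrow> ty1)" by (simp add: chT_def wt_def Let_def)
lemmas [simp] = closed_simps[OF chT_wt]
lemma xT_wt: "wt \<D> [] xT (ty1 \<rightarrow> ty1)" by (simp add: xT_def wt_def)
lemmas [simp] = closed_simps[OF xT_wt]

text \<open>The zeros are the moves worth making: those that lower the rank for player 0, and those
  that stay among the safe positions for player 1. As the parity of the position decides between the
  cases, one strategy serves both players.\<close>

definition selT :: tm where
  "selT = lams [] [ty1, Nat, Nat] (condT \<cdot> (parT \<cdot> (lenT \<cdot> Var 1))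
     \<cdot> (gtT \<cdot> Var 2 \<cdot> zero \<cdot> Var 1 \<cdot> (snocT \<cdot> Var 1 \<cdot> Var 0)) \<cdot> (xT \<cdot> Var 2 \<cdot> (snocT \<cdot> Var 1 \<cdot> Var 0)))"
lemma selT_wt: "wt \<D> [] selT (ty1 \<rightarrow> Nat \<rightarrow> ty1)" by (simp add: selT_def wt_def)
lemmas [simp] = closed_simps[OF selT_wt]

context
  fixes f assumes f: "f \<in> dom ty1"
begin

abbreviation Gt :: "'a \<Rightarrow> 'a \<Rightarrow> bool" where "Gt t u \<equiv> cl gtT \<bullet> f \<bullet> Z \<bullet> t \<bullet> u = Z"
text \<open>The intermediate states; \<open>Ge t u\<close> expresses that the rank of \<open>t\<close> is at least that of \<open>u\<close>.\<close>
abbreviation Ge :: "'a \<Rightarrow> 'a \<Rightarrow> bool" where "Ge t u \<equiv> cl gtT \<bullet> f \<bullet> One \<bullet> t \<bullet> u = Z"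
abbreviation X :: "'a \<Rightarrow> bool" where "X s \<equiv> cl xT \<bullet> f \<bullet> s = Z"

lemma kind_dom: "cl kindT \<bullet> f \<in> dom ty1" and move_dom: "cl moveT \<in> dom (Nat \<rightarrow> ty1)"
  using f by simp_all

lemma gt_Gfp: "b \<in> N \<Longrightarrow> t \<in> N \<Longrightarrow> u \<in> N \<Longrightarrow>
    cl gtT \<bullet> f \<bullet> b \<bullet> t \<bullet> u = Z \<longleftrightarrow> Gfp (cl kindT \<bullet> f) (cl moveT) (Pr b (Pr t u))"
  using f by (simp add: gtT_def cl_lam Gfp_def)

lemma step_Z: "t \<in> N \<Longrightarrow> u \<in> N \<Longrightarrow> step (cl kindT \<bullet> f) (cl moveT) P (Pr Z (Pr t u)) \<longleftrightarrow>
    f \<bullet> t \<noteq> Z \<and> (if Even t then \<forall>n \<in> N. P (Pr One (Pr (Snoc t n) u)) else \<exists>n \<in> N. P (Pr One (Pr (Snoc t n) u)))"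
  using f by (simp add: step_def kindT_def moveT_def cl_lam Let_def)

lemma step_One: "t \<in> N \<Longrightarrow> u \<in> N \<Longrightarrow> step (cl kindT \<bullet> f) (cl moveT) P (Pr One (Pr t u)) \<longleftrightarrow>
    f \<bullet> u = Z \<or> (if Even u then \<exists>n \<in> N. P (Pr Z (Pr t (Snoc u n))) else \<forall>n \<in> N. P (Pr Z (Pr t (Snoc u n))))"
  using f by (simp add: step_def kindT_def moveT_def cl_lam Let_def)

lemma Gt_iff: "t \<in> N \<Longrightarrow> u \<in> N \<Longrightarrow>
    Gt t u \<longleftrightarrow> f \<bullet> t \<noteq> Z \<and> (if Even t then \<forall>n \<in> N. Ge (Snoc t n) u else \<exists>n \<in> N. Ge (Snoc t n) u)"
proof -
  assume *: "t \<in> N" "u \<in> N"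
  have "Gt t u \<longleftrightarrow> step (cl kindT \<bullet> f) (cl moveT) (Gfp (cl kindT \<bullet> f) (cl moveT)) (Pr Z (Pr t u))"
    using Gfp_fold[OF kind_dom move_dom] Gfp_unfold[OF kind_dom move_dom] * by (auto simp: gt_Gfp)
  also have "\<dots> \<longleftrightarrow> f \<bullet> t \<noteq> Z \<and> (if Even t then \<forall>n \<in> N. Ge (Snoc t n) u else \<exists>n \<in> N. Ge (Snoc t n) u)"
    using * by (simp add: step_Z gt_Gfp)
  finally show ?thesis .
qed

lemma Ge_iff: "t \<in> N \<Longrightarrow> u \<in> N \<Longrightarrow>
    Ge t u \<longleftrightarrow> f \<bullet> u = Z \<or> (if Even u then \<exists>n \<in> N. Gt t (Snoc u n) else \<forall>n \<in> N. Gt t (Snoc u n))"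
proof -
  assume *: "t \<in> N" "u \<in> N"
  have "Ge t u \<longleftrightarrow> step (cl kindT \<bullet> f) (cl moveT) (Gfp (cl kindT \<bullet> f) (cl moveT)) (Pr One (Pr t u))"
    using Gfp_fold[OF kind_dom move_dom] Gfp_unfold[OF kind_dom move_dom] * by (auto simp: gt_Gfp)
  also have "\<dots> \<longleftrightarrow> f \<bullet> u = Z \<or> (if Even u then \<exists>n \<in> N. Gt t (Snoc u n) else \<forall>n \<in> N. Gt t (Snoc u n))"
    using * by (simp add: step_One gt_Gfp)
  finally show ?thesis .
qed

lemma Gt_coinduct:
  assumes A: "dec (\<lambda>x. A (Fst (Snd x)) (Snd (Snd x)))" and B: "dec (\<lambda>x. B (Fst (Snd x)) (Snd (Snd x)))"
    and stepA: "\<And>t u. t \<in> N \<Longrightarrow> u \<in> N \<Longrightarrow> A t u \<Longrightarrow>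
      f \<bullet> t \<noteq> Z \<and> (if Even t then \<forall>n \<in> N. B (Snoc t n) u else \<exists>n \<in> N. B (Snoc t n) u)"
    and stepB: "\<And>t u. t \<in> N \<Longrightarrow> u \<in> N \<Longrightarrow> B t u \<Longrightarrow>
      f \<bullet> u = Z \<or> (if Even u then \<exists>n \<in> N. A t (Snoc u n) else \<forall>n \<in> N. A t (Snoc u n))"
    and tu: "t \<in> N" "u \<in> N" "A t u"
  shows "Gt t u"
proof -
  \<comment> \<open>\<open>A\<close> governs the states with bit 0 and \<open>B\<close> those with
    bit 1. The equations confine \<open>P\<close> to numbers literally of the form
    \<open>Pr b (Pr t u)\<close>, for which \<open>step_Z\<close> and \<open>step_One\<close> are
    stated.\<close>
  define P where "P x \<longleftrightarrow> (x = Pr Z (Snd x) \<and> A (Fst (Snd x)) (Snd (Snd x)) \<or> x = Pr One (Snd x) \<and> B (Fst (Snd x)) (Snd (Snd x)))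
    \<and> Snd x = Pr (Fst (Snd x)) (Snd (Snd x))" for x
  have Pr_inj: "Pr One a \<noteq> Pr Z b" if "a \<in> N" "b \<in> N" for a b
  proof
    assume "Pr One a = Pr Z b"
    then have "Fst (Pr One a) = Fst (Pr Z b)" by (simp only:)
    with that show False by simp
  qed
  have P0: "P (Pr Z (Pr t u)) \<longleftrightarrow> A t u" "P (Pr One (Pr t u)) \<longleftrightarrow> B t u" if "t \<in> N" "u \<in> N" for t u
    using that Pr_inj[of "Pr t u" "Pr t u"] by (simp_all add: P_def)
  have "Gfp (cl kindT \<bullet> f) (cl moveT) (Pr Z (Pr t u))"
  proof (rule Gfp_coinduct[OF kind_dom move_dom])
    show "dec P" unfolding P_def by (intro dec_and dec_or A B dec_intros) simp_all
    fix v assume v: "v \<in> N" "P v"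
    let ?t = "Fst (Snd v)" and ?u = "Snd (Snd v)"
    have tu: "?t \<in> N" "?u \<in> N" using v by simp_all
    have "v = Pr Z (Pr ?t ?u) \<and> A ?t ?u \<or> v = Pr One (Pr ?t ?u) \<and> B ?t ?u"
      using v(2) unfolding P_def by metis
    then show "step (cl kindT \<bullet> f) (cl moveT) P v"
    proof (elim disjE conjE)
      assume v: "v = Pr Z (Pr ?t ?u)" and "A ?t ?u"
      have "step (cl kindT \<bullet> f) (cl moveT) P (Pr Z (Pr ?t ?u))"
        unfolding step_Z[OF tu] using stepA[OF tu \<open>A ?t ?u\<close>] P0(2) tu by (cases "Even ?t") simp_all
      then show ?thesis using v by simp
    next
      assume v: "v = Pr One (Pr ?t ?u)" and "B ?t ?u"
      have "step (cl kindT \<bullet> f) (cl moveT) P (Pr One (Pr ?t ?u))"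
        unfolding step_One[OF tu] using stepB[OF tu \<open>B ?t ?u\<close>] P0(1) tu by (cases "Even ?u") simp_all
      then show ?thesis using v by simp
    qed
  qed (use tu P0 in simp_all)
  then show ?thesis using tu by (simp add: gt_Gfp)
qed

text \<open>Negating the equations for \<open>Gt\<close> and \<open>Ge\<close> and exchanging the
  two positions gives back the same equations. The complement is therefore closed in the sense
  required for coinduction; no determinacy of the comparison game is presupposed.\<close>

lemma Gt_total:
  assumes "t \<in> N" "u \<in> N" "\<not> Ge t u" shows "Gt u t"
proof (rule Gt_coinduct[of "\<lambda>u t. \<not> Ge t u" "\<lambda>u t. \<not> Gt t u"])
  fix u t assume *: "u \<in> N" "t \<in> N"
  show "f \<bullet> u \<noteq> Z \<and> (if Even u then \<forall>n \<in> N. \<not> Gt t (Snoc u n) else \<exists>n \<in> N. \<not> Gt t (Snoc u n))" if "\<not> Ge t u"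
    using that Ge_iff[of t u] * by (auto split: if_splits)
  show "f \<bullet> t = Z \<or> (if Even t then \<exists>n \<in> N. \<not> Ge (Snoc t n) u else \<forall>n \<in> N. \<not> Ge (Snoc t n) u)" if "\<not> Gt t u"
    using that Gt_iff[of t u] * by (auto split: if_splits)
qed (use assms f in \<open>(intro dec_intros; simp) | simp\<close>)+

section \<open>Infinite descending chains and the positions safe for player 1\<close>

lemma X_iff: "s \<in> N \<Longrightarrow> X s \<longleftrightarrow> (\<exists>h \<in> dom ty1. h \<bullet> Z = s \<and> (\<forall>i \<in> N. Gt (h \<bullet> i) (h \<bullet> Sc i)))"
proof -
  assume s: "s \<in> N"
  let ?c = "cl chT \<bullet> f \<bullet> s"
  have dom: "cl idT \<in> dom ty1" "cl scT \<in> dom (Nat \<rightarrow> ty1)" "?c \<in> dom (Nat \<rightarrow> Nat \<rightarrow> ty1)"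
    using f s by simp_all
  have id: "cl idT \<bullet> z = z" "a \<in> N \<Longrightarrow> cl scT \<bullet> z \<bullet> a = Sc z" if "z \<in> N" for z a
    using that by (simp_all add: idT_def scT_def cl_lam)
  have c: "?c \<bullet> z \<bullet> a \<bullet> b \<noteq> Z \<longleftrightarrow> (z = Z \<longrightarrow> a = s) \<and> Gt a b" if "z \<in> N" "a \<in> N" "b \<in> N" for z a b
    using that f s by (simp add: chT_def cl_lam Let_def)
  have "(\<forall>z \<in> N. ?c \<bullet> z \<bullet> (g \<bullet> (cl idT \<bullet> z)) \<bullet> (g \<bullet> (cl scT \<bullet> z \<bullet> (g \<bullet> (cl idT \<bullet> z)))) \<noteq> Z) \<longleftrightarrow>
      g \<bullet> Z = s \<and> (\<forall>i \<in> N. Gt (g \<bullet> i) (g \<bullet> Sc i))" if g: "g \<in> dom ty1" for g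
  proof -
    have "?c \<bullet> z \<bullet> (g \<bullet> (cl idT \<bullet> z)) \<bullet> (g \<bullet> (cl scT \<bullet> z \<bullet> (g \<bullet> (cl idT \<bullet> z)))) \<noteq> Z \<longleftrightarrow>
        (z = Z \<longrightarrow> g \<bullet> z = s) \<and> Gt (g \<bullet> z) (g \<bullet> Sc z)" if "z \<in> N" for z
      using that g id c[of z "g \<bullet> z" "g \<bullet> Sc z"] by simp
    moreover have "Z \<in> N" by simp
    ultimately show ?thesis by blast
  qed
  moreover have "X s \<longleftrightarrow> X\<^sub>0 (cl nfT \<bullet> cl idT \<bullet> cl scT \<bullet> ?c) = Z"
    using f s by (simp add: xT_def cl_lam)
  ultimately show ?thesis unfolding Path_nf[OF dom] by blast
qed

lemma X_Gt: "s \<in> N \<Longrightarrow> u \<in> N \<Longrightarrow> Gt s u \<Longrightarrow> X u \<Longrightarrow> X s"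
proof -
  assume *: "s \<in> N" "u \<in> N" "Gt s u" "X u"
  then obtain h where h: "h \<in> dom ty1" "h \<bullet> Z = u" "\<And>i. i \<in> N \<Longrightarrow> Gt (h \<bullet> i) (h \<bullet> Sc i)"
    using X_iff by blast
  have "Gt (cl consT \<bullet> s \<bullet> h \<bullet> i) (cl consT \<bullet> s \<bullet> h \<bullet> Sc i)" if "i \<in> N" for i
    by (rule nat_cases[OF that]) (use * h in simp_all)
  moreover have "cl consT \<bullet> s \<bullet> h \<in> dom ty1" "cl consT \<bullet> s \<bullet> h \<bullet> Z = s" using * h by simp_all
  ultimately show "X s" using X_iff[OF *(1)] by blast
qed

lemma X_refl: "s \<in> N \<Longrightarrow> Gt s s \<Longrightarrow> X s"
proof -
  assume *: "s \<in> N" "Gt s s"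
  have "con (KC Nat Nat) \<bullet> s \<in> dom ty1" "con (KC Nat Nat) \<bullet> s \<bullet> i = s" if "i \<in> N" for i
    using * that by simp_all
  then show "X s" using X_iff[OF *(1)] * by (intro iffD2[OF X_iff[OF *(1)]] bexI[of _ "con (KC Nat Nat) \<bullet> s"]) simp_all
qed

text \<open>The chain \<open>h\<close> is shadowed by a chain \<open>c\<close> from \<open>t\<close>
  such that \<open>Ge (c i) (h i)\<close> is kept throughout. The invariant is decidable and
  dependent choice builds \<open>c\<close>, so composing strategies for the comparison game is
  avoided.\<close>

lemma X_Ge:
  assumes t: "t \<in> N" and h: "h \<in> dom ty1" "\<And>i. i \<in> N \<Longrightarrow> Gt (h \<bullet> i) (h \<bullet> Sc i)" and Ge: "Ge t (h \<bullet> Z)"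
  shows "X t"
proof -
  define r where "r = lams [] [ty1, ty1, Nat, Nat, Nat]
    (addT \<cdot> (gtT \<cdot> Var 4 \<cdot> zero \<cdot> Var 1 \<cdot> Var 0) \<cdot> (gtT \<cdot> Var 4 \<cdot> one \<cdot> Var 0 \<cdot> (Var 3 \<cdot> (Con Succ \<cdot> Var 2))))"
  have w: "wt \<D> [] r (ty1 \<rightarrow> ty1 \<rightarrow> Nat \<rightarrow> Nat \<rightarrow> ty1)" by (simp add: r_def wt_def)
  note [simp] = closed_simps[OF w]
  let ?r = "cl r \<bullet> f \<bullet> h"
  have r: "?r \<bullet> i \<bullet> v \<bullet> n = Z \<longleftrightarrow> Gt v n \<and> Ge n (h \<bullet> Sc i)" if "i \<in> N" "v \<in> N" "n \<in> N" for i v n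
    using that f h(1) by (simp add: r_def cl_lam)
  have "?r \<in> dom (Nat \<rightarrow> Nat \<rightarrow> ty1)" using f h by simp
  from dependent_choice[OF this t] obtain c where c: "c \<in> dom ty1" "c \<bullet> Z = t"
    "\<And>i. i \<in> N \<Longrightarrow> (\<exists>n \<in> N. ?r \<bullet> i \<bullet> (c \<bullet> i) \<bullet> n = Z) \<Longrightarrow> ?r \<bullet> i \<bullet> (c \<bullet> i) \<bullet> (c \<bullet> Sc i) = Z" by blast
  have step: "Gt (c \<bullet> i) (c \<bullet> Sc i) \<and> Ge (c \<bullet> Sc i) (h \<bullet> Sc i)" if i: "i \<in> N" "Ge (c \<bullet> i) (h \<bullet> i)" for i
  proof -
    have d: "c \<bullet> i \<in> N" "h \<bullet> i \<in> N" "h \<bullet> Sc i \<in> N" "c \<bullet> Sc i \<in> N" using c h i by simp_all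
    have sn: "Snoc (h \<bullet> i) n \<in> N" if "n \<in> N" for n using that d by simp
    have "Z \<in> N" by simp
    note 1 = h(2)[OF i(1), unfolded Gt_iff[OF d(2,3)]] and 2 = i(2)[unfolded Ge_iff[OF d(1,2)]]
    \<comment> \<open>The next element is an extension of \<open>h i\<close> by one move. Depending
      on the parity, one of \<open>Ge (c i) (h i)\<close> and \<open>Gt (h i) (h (i + 1))\<close>
      provides the move, and the other one holds for all moves.\<close>
    have "\<exists>n \<in> N. Gt (c \<bullet> i) n \<and> Ge n (h \<bullet> Sc i)"
    proof (cases "Even (h \<bullet> i)")
      case True
      with 1 2 show ?thesis using sn by auto
    next
      case False
      with 1 2 show ?thesis using sn by auto
    qed
    then have "\<exists>n \<in> N. ?r \<bullet> i \<bullet> (c \<bullet> i) \<bullet> n = Z" using r[OF i(1) d(1)] by blast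
    from c(3)[OF i(1) this] r[OF i(1) d(1) d(4)] show ?thesis by blast
  qed
  have "Ge (c \<bullet> i) (h \<bullet> i)" if "i \<in> N" for i
    using that
  proof (induction rule: qf_induct)
    case dec show ?case using f c h by (intro dec_intros) simp_all
  next
    case zero show ?case using c Ge by simp
  next
    case (Suc i) then show ?case using step by blast
  qed
  with step c show "X t" using X_iff[OF t] by blast
qed

text \<open>Unfolding \<open>Gt\<close> between the first two elements of a chain from
  \<open>s\<close> relates extensions of \<open>s\<close> by \<open>Ge\<close> to the second
  element; by \<open>X_Ge\<close> the rest of the chain can be copied below them.\<close>

lemma X_unfold: "s \<in> N \<Longrightarrow> X s \<Longrightarrow> f \<bullet> s \<noteq> Z \<and> (if Even s then \<forall>n \<in> N. X (Snoc s n) else \<exists>n \<in> N. X (Snoc s n))"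
proof -
  assume s: "s \<in> N" "X s"
  then obtain h where h: "h \<in> dom ty1" "h \<bullet> Z = s" "\<And>i. i \<in> N \<Longrightarrow> Gt (h \<bullet> i) (h \<bullet> Sc i)"
    using X_iff by blast
  have d: "h \<bullet> One \<in> N" using h by simp
  let ?h = "cl tailT \<bullet> h"
  have "?h \<in> dom ty1" "?h \<bullet> Z = h \<bullet> One" "\<And>i. i \<in> N \<Longrightarrow> Gt (?h \<bullet> i) (?h \<bullet> Sc i)"
    using h by simp_all
  then have X: "X (Snoc s n)" if "n \<in> N" "Ge (Snoc s n) (h \<bullet> One)" for n
    using that s by (intro X_Ge[of _ ?h]) simp_all
  have "Gt s (h \<bullet> One)" using h(3)[of Z] h(2) by simp
  note gt = this[unfolded Gt_iff[OF s(1) d]]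
  show ?thesis
  proof (cases "Even s")
    case True
    show ?thesis using gt X unfolding if_P[OF True] by blast
  next
    case False
    show ?thesis using gt X unfolding if_not_P[OF False] by blast
  qed
qed

text \<open>Inside \<open>X\<close> together with \<open>s\<close>, player 1 can avoid losing for
  ever, whatever happens in the other position. So \<open>s\<close> has undefined rank and exceeds
  every position, itself included; the constant chain then puts it into \<open>X\<close>.\<close>

lemma X_fold:
  assumes s: "s \<in> N" "f \<bullet> s \<noteq> Z" and "if Even s then \<forall>n \<in> N. X (Snoc s n) else \<exists>n \<in> N. X (Snoc s n)"
  shows "X s"
proof (rule X_refl[OF s(1)], rule Gt_coinduct[of "\<lambda>t u. X t \<or> t = s" "\<lambda>t u. X t"])
  show "dec (\<lambda>x. X (Fst (Snd x)) \<or> Fst (Snd x) = s)" "dec (\<lambda>x. X (Fst (Snd x)))"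
    using f s by (intro dec_intros; simp)+
  fix t u assume tu: "t \<in> N" "u \<in> N"
  show "f \<bullet> t \<noteq> Z \<and> (if Even t then \<forall>n \<in> N. X (Snoc t n) else \<exists>n \<in> N. X (Snoc t n))" if "X t \<or> t = s"
    using that X_unfold[OF tu(1)] assms by blast
  show "f \<bullet> u = Z \<or> (if Even u then \<exists>n \<in> N. X t \<or> t = s else \<forall>n \<in> N. X t \<or> t = s)" if "X t"
    using that bexI[of "\<lambda>_. X t \<or> t = s" Z N] by simp
qed (use s in simp_all)

text \<open>If no extension of \<open>s\<close> had smaller rank than \<open>s\<close>, then by
  totality every extension would have another one below it, so there would be no extension of least
  rank. Dependent choice turns this into a chain from each extension, which makes them all safe, and
  then \<open>s\<close> too.\<close>

lemma not_X_even:
  assumes s: "s \<in> N" "f \<bullet> s \<noteq> Z" "Even s" "\<not> X s"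
  shows "\<exists>n \<in> N. Gt s (Snoc s n)"
proof (rule ccontr)
  assume no: "\<not> ?thesis"
  have sn: "Snoc s n \<in> N" if "n \<in> N" for n using that s by simp
  have ex: "\<exists>m \<in> N. Gt (Snoc s n) (Snoc s m)" if n: "n \<in> N" for n
  proof -
    have "\<not> Gt s (Snoc s n)" using no n by blast
    then have "\<not> (f \<bullet> s \<noteq> Z \<and> (\<forall>m \<in> N. Ge (Snoc s m) (Snoc s n)))"
      unfolding Gt_iff[OF s(1) sn[OF n]] if_P[OF s(3)] .
    then obtain m where "m \<in> N" "\<not> Ge (Snoc s m) (Snoc s n)" using s(2) by blast
    then show ?thesis using Gt_total[OF sn sn[OF n]] by blast
  qed
  define r where "r = lams [] [ty1, Nat, Nat, Nat, Nat] (gtT \<cdot> Var 4 \<cdot> zero \<cdot> (snocT \<cdot> Var 3 \<cdot> Var 1) \<cdot> (snocT \<cdot> Var 3 \<cdot> Var 0))"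
  have w: "wt \<D> [] r (ty1 \<rightarrow> Nat \<rightarrow> Nat \<rightarrow> Nat \<rightarrow> ty1)" by (simp add: r_def wt_def)
  note [simp] = closed_simps[OF w]
  let ?r = "cl r \<bullet> f \<bullet> s"
  have r: "?r \<bullet> i \<bullet> v \<bullet> n = cl gtT \<bullet> f \<bullet> Z \<bullet> (Snoc s v) \<bullet> (Snoc s n)" if "i \<in> N" "v \<in> N" "n \<in> N" for i v n
    using that f s by (simp add: r_def cl_lam)
  have "X (Snoc s n)" if n: "n \<in> N" for n
  proof -
    have "?r \<in> dom (Nat \<rightarrow> Nat \<rightarrow> ty1)" using f s by simp
    from dependent_choice[OF this n] obtain c where c: "c \<in> dom ty1" "c \<bullet> Z = n"
      "\<And>i. i \<in> N \<Longrightarrow> (\<exists>n \<in> N. ?r \<bullet> i \<bullet> (c \<bullet> i) \<bullet> n = Z) \<Longrightarrow> ?r \<bullet> i \<bullet> (c \<bullet> i) \<bullet> (c \<bullet> Sc i) = Z" by blast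
    let ?h = "ev (case_nat s (case_nat c (\<lambda>_. Z))) (lam [Nat, ty1] Nat (snocT \<cdot> Var 1 \<cdot> (Var 2 \<cdot> Var 0)))"
    have h: "?h \<in> dom ty1" "\<And>i. i \<in> N \<Longrightarrow> ?h \<bullet> i = Snoc s (c \<bullet> i)" using s c by simp_all
    have "Gt (Snoc s (c \<bullet> i)) (Snoc s (c \<bullet> Sc i))" if i: "i \<in> N" for i
    proof -
      have d: "c \<bullet> i \<in> N" "c \<bullet> Sc i \<in> N" using c i by simp_all
      have "\<exists>n \<in> N. ?r \<bullet> i \<bullet> (c \<bullet> i) \<bullet> n = Z" using ex[OF d(1)] r[OF i d(1)] by metis
      from c(3)[OF i this] show ?thesis using r[OF i d] by simp
    qed
    then have "\<forall>i \<in> N. Gt (?h \<bullet> i) (?h \<bullet> Sc i)"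
    proof -
      assume *: "\<And>i. i \<in> N \<Longrightarrow> Gt (Snoc s (c \<bullet> i)) (Snoc s (c \<bullet> Sc i))"
      show ?thesis
      proof
        fix i assume i: "i \<in> N"
        then have "Sc i \<in> N" by simp
        show "Gt (?h \<bullet> i) (?h \<bullet> Sc i)" unfolding h(2)[OF i] h(2)[OF \<open>Sc i \<in> N\<close>] by (rule *[OF i])
      qed
    qed
    moreover have "?h \<bullet> Z = Snoc s n" using h(2)[of Z] c(2) by simp
    ultimately show ?thesis using X_iff[OF sn[OF n]] h(1) by blast
  qed
  with s X_fold show False by auto
qed

text \<open>No extension of \<open>s\<close> is safe, so none is below itself. By totality it is
  then \<open>Ge\<close> to itself, which is what \<open>Gt\<close> between \<open>s\<close> and the
  extension asks for.\<close>

lemma not_X_odd: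
  assumes s: "s \<in> N" "f \<bullet> s \<noteq> Z" "\<not> Even s" "\<not> X s" and n: "n \<in> N"
  shows "Gt s (Snoc s n)"
proof -
  have sn: "Snoc s n \<in> N" using s n by simp
  have "\<not> X (Snoc s n)" using X_fold[OF s(1,2), unfolded if_not_P[OF s(3)]] s(4) n by blast
  then have "Ge (Snoc s n) (Snoc s n)" using X_refl[OF sn] Gt_total[OF sn sn] by blast
  then show ?thesis unfolding Gt_iff[OF s(1) sn] if_not_P[OF s(3)] using s(2) n by blast
qed

lemma sel_eq: "s \<in> N \<Longrightarrow> n \<in> N \<Longrightarrow>
    cl selT \<bullet> f \<bullet> s \<bullet> n = Z \<longleftrightarrow> (if Even s then Gt s (Snoc s n) else X (Snoc s n))"
  using f by (simp add: selT_def cl_lam)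

text \<open>If the empty position is safe, the strategy keeps every play within \<open>X\<close>,
  where \<open>f\<close> has no zero. Otherwise each round of a play that player 0 does not win goes
  down in \<open>Gt\<close>, and by \<open>X_Gt\<close> it never enters \<open>X\<close>.\<close>

theorem good_strategy:
  assumes S: "S \<in> dom ty1"
    and sel: "\<And>s. s \<in> N \<Longrightarrow> (\<exists>n \<in> N. cl selT \<bullet> f \<bullet> s \<bullet> n = Z) \<Longrightarrow> cl selT \<bullet> f \<bullet> s \<bullet> (S \<bullet> s) = Z"
  shows "good f S"
proof (cases "X Z")
  case True
  have "\<not> Win S' S f" if S': "S' \<in> dom ty1" for S'
  proof -
    let ?p = "\<lambda>k. Pos S' S k"
    have "X (?p k)" if "k \<in> N" for k
      using that
    proof (induction rule: qf_induct)
      case dec show ?case using f S S' by (intro dec_intros) simp_all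
    next
      case zero show ?case using True S S' by simp
    next
      case (Suc k)
      have d: "?p k \<in> N" "S \<bullet> ?p k \<in> N" "S' \<bullet> ?p k \<in> N" using Suc S S' by simp_all
      note u = X_unfold[OF d(1) Suc(2)]
      show ?case
      proof (cases "Even (?p k)")
        case True
        then show ?thesis using u d Suc(1) S S' unfolding Pos_Sc[OF S' S Suc(1)] by auto
      next
        case False
        then have "\<exists>n \<in> N. cl selT \<bullet> f \<bullet> ?p k \<bullet> n = Z" using u sel_eq[OF d(1)] by auto
        from sel[OF d(1) this] sel_eq[OF d(1,2)] False show ?thesis
          unfolding Pos_Sc[OF S' S Suc(1)] by simp
      qed
    qed
    moreover have "?p k \<in> N" if "k \<in> N" for k using that S S' by simp
    ultimately show ?thesis using X_unfold unfolding Win_def by blast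
  qed
  then show ?thesis unfolding good_def by blast
next
  case False
  have "Win S S' f" if S': "S' \<in> dom ty1" for S'
  proof (rule ccontr)
    assume lost: "\<not> ?thesis"
    let ?p = "\<lambda>k. Pos S S' k"
    have pN: "?p k \<in> N" if "k \<in> N" for k using that S S' by simp
    have Gt: "Gt (?p k) (?p (Sc k))" if k: "k \<in> N" "\<not> X (?p k)" for k
    proof -
      have d: "?p k \<in> N" "S \<bullet> ?p k \<in> N" "S' \<bullet> ?p k \<in> N" using k S S' by simp_all
      have fp: "f \<bullet> ?p k \<noteq> Z" using lost k unfolding Win_def by blast
      show ?thesis
      proof (cases "Even (?p k)")
        case True
        then have "\<exists>n \<in> N. cl selT \<bullet> f \<bullet> ?p k \<bullet> n = Z"
          using not_X_even[OF d(1) fp True k(2)] sel_eq[OF d(1)] by auto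
        from sel[OF d(1) this] sel_eq[OF d(1,2)] True show ?thesis
          unfolding Pos_Sc[OF S S' k(1)] by simp
      next
        case False
        then show ?thesis using not_X_odd[OF d(1) fp False k(2) d(3)] unfolding Pos_Sc[OF S S' k(1)] by simp
      qed
    qed
    have nX: "\<not> X (?p k)" if "k \<in> N" for k
      using that
    proof (induction rule: qf_induct)
      case dec show ?case using f S S' by (intro dec_intros) simp_all
    next
      case zero show ?case using False S S' by simp
    next
      case (Suc k)
      have "Sc k \<in> N" using Suc by simp
      from X_Gt[OF pN[OF Suc(1)] pN[OF this] Gt[OF Suc]] Suc(2) show ?case by blast
    qed
    \<comment> \<open>The positions of the lost play, as a function of their length, are a
      descending chain from the empty position.\<close>
    have "cl posT \<bullet> S \<bullet> S' \<in> dom ty1" "?p Z = Z" using S S' by simp_all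
    then have "X Z" using Gt nX by (intro iffD2[OF X_iff] bexI[of _ "cl posT \<bullet> S \<bullet> S'"] conjI ballI) simp_all
    with False show False ..
  qed
  then show ?thesis unfolding good_def by blast
qed

end

section \<open>Standard strategies\<close>

definition enT :: tm where
  "enT = lams [] [ty1 \<rightarrow> Star Nat, ty1, Nat] (Var 1 \<cdot> (Con (cst.Ent Nat) \<cdot> (Var 2 \<cdot> Var 1) \<cdot> Var 0))"
text \<open>A list from \<open>HACint\<close> may contain wrong entries. As a right one can be
  recognised by evaluating the function, a bounded search reduces the list to a single
  value.\<close>

definition muT :: tm where
  "muT = lams [] [ty1 \<rightarrow> Star Nat, ty1]
    (Con (cst.Ent Nat) \<cdot> (Var 1 \<cdot> Var 0) \<cdot> (witT \<cdot> (enT \<cdot> Var 1 \<cdot> Var 0) \<cdot> (Con (cst.Len Nat) \<cdot> (Var 1 \<cdot> Var 0))))"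
definition stratT :: tm where
  "stratT = lams [] [ty1 \<rightarrow> Star Nat, ty1, Nat] (muT \<cdot> Var 2 \<cdot> (selT \<cdot> Var 1 \<cdot> Var 0))"
text \<open>Zero where a suitable move exists but the strategy does not make one. The Suslin
  constant makes this quantifier-free, so \<open>Pi01_transfer\<close> can be applied to the absence
  of zeros.\<close>

definition chkT :: tm where
  "chkT = lams [] [ty1, ty1, Nat] (condT \<cdot> (XiT \<cdot> (liftT \<cdot> (selT \<cdot> Var 1 \<cdot> Var 0))) \<cdot> one
     \<cdot> (condT \<cdot> (selT \<cdot> Var 1 \<cdot> Var 0 \<cdot> (Var 2 \<cdot> Var 0)) \<cdot> one \<cdot> zero))"
definition posfT :: tm where
  "posfT = lams [] [ty1, ty1, ty1, Nat] (Var 3 \<cdot> (posT \<cdot> Var 2 \<cdot> Var 1 \<cdot> Var 0))"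

lemma enT_wt: "wt \<D> [] enT ((ty1 \<rightarrow> Star Nat) \<rightarrow> ty1 \<rightarrow> ty1)" by (simp add: enT_def wt_def)
lemmas [simp] = closed_simps[OF enT_wt]
lemma muT_wt: "wt \<D> [] muT ((ty1 \<rightarrow> Star Nat) \<rightarrow> ty2)" by (simp add: muT_def wt_def)
lemmas [simp] = closed_simps[OF muT_wt]
lemma stratT_wt: "wt \<D> [] stratT ((ty1 \<rightarrow> Star Nat) \<rightarrow> ty1 \<rightarrow> ty1)" by (simp add: stratT_def wt_def)
lemmas [simp] = closed_simps[OF stratT_wt]
lemma chkT_wt: "wt \<D> [] chkT (ty1 \<rightarrow> ty1 \<rightarrow> ty1)" by (simp add: chkT_def wt_def)
lemmas [simp] = closed_simps[OF chkT_wt]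
lemma posfT_wt: "wt \<D> [] posfT (ty1 \<rightarrow> ty1 \<rightarrow> ty1 \<rightarrow> ty1)" by (simp add: posfT_def wt_def)
lemmas [simp] = closed_simps[OF posfT_wt]

text \<open>
  There is no closed term for the choice operator \<open>\<mu>\<close>, since \<open>Xi i ty2\<close> is 0-1-valued and \<open>\<mu>\<close> is not
  majorizable; \<open>HACint\<close> provides a standard one that is correct on standard inputs only.
\<close>
lemma ex_standard_mu:
  "\<exists>F \<in> dom (ty1 \<rightarrow> Star Nat). st F \<and>
     (\<forall>h \<in> dom ty1. st h \<longrightarrow> (\<exists>x \<in> N. h \<bullet> x = Z) \<longrightarrow> h \<bullet> (cl muT \<bullet> F \<bullet> h) = Z)"
proof -
  let ?A = "Ex Nat (Var 2 \<cdot> Var 0 \<doteq> zero) \<^bold>\<longrightarrow> (Var 1 \<cdot> Var 0 \<doteq> zero)"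
  have A: "sat (case_nat y (case_nat h (\<lambda>_. Z))) ?A \<longleftrightarrow> ((\<exists>x \<in> N. h \<bullet> x = Z) \<longrightarrow> h \<bullet> y = Z)" for y h
    by simp
  have "\<exists>F \<in> dom (ty1 \<rightarrow> Star Nat). st F \<and> (\<forall>h \<in> dom ty1. st h \<longrightarrow> (\<exists>i \<in> N. i \<prec> con (cst.Len Nat) \<bullet> (F \<bullet> h) \<and>
    sat (case_nat (con (cst.Ent Nat) \<bullet> (F \<bullet> h) \<bullet> i) (case_nat h (\<lambda>_. Z))) ?A))"
  proof (rule HACint_lists)
    show "wf_fm \<D> [Nat, ty1] ?A" by (simp add: wt_def)
    show "\<exists>y \<in> N. st y \<and> sat (case_nat y (case_nat h (\<lambda>_. Z))) ?A" if h: "h \<in> dom ty1" "st h" for h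
    proof (cases "\<exists>x \<in> N. h \<bullet> x = Z")
      case True
      \<comment> \<open>Transfer in contrapositive form: a standard function with a zero has a
        standard zero.\<close>
      then obtain y where "y \<in> N" "st y" "h \<bullet> y = Z" using Pi01_transfer[OF h] by blast
      then show ?thesis unfolding A by blast
    next
      case False
      have "Z \<in> N" "st Z" by simp_all
      with False show ?thesis unfolding A by blast
    qed
  qed simp
  then obtain F where F: "F \<in> dom (ty1 \<rightarrow> Star Nat)" "st F"
    and FA: "\<And>h. h \<in> dom ty1 \<Longrightarrow> st h \<Longrightarrow> \<exists>x \<in> N. h \<bullet> x = Z \<Longrightarrow>
      \<exists>i \<in> N. i \<prec> con (cst.Len Nat) \<bullet> (F \<bullet> h) \<and> h \<bullet> (con (cst.Ent Nat) \<bullet> (F \<bullet> h) \<bullet> i) = Z"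
    unfolding A by blast
  have "h \<bullet> (cl muT \<bullet> F \<bullet> h) = Z" if h: "h \<in> dom ty1" "st h" and ex: "\<exists>x \<in> N. h \<bullet> x = Z" for h
  proof -
    let ?p = "cl enT \<bullet> F \<bullet> h" and ?b = "con (cst.Len Nat) \<bullet> (F \<bullet> h)"
    have p: "?p \<in> dom ty1" "?b \<in> N" using F h by simp_all
    have p_eq: "?p \<bullet> i = h \<bullet> (con (cst.Ent Nat) \<bullet> (F \<bullet> h) \<bullet> i)" if "i \<in> N" for i
      using that F h by (simp add: enT_def cl_lam)
    obtain i where "i \<in> N" "i \<prec> ?b" "?p \<bullet> i = Z" using FA[OF h ex] p_eq by metis
    then have "?p \<bullet> (cl witT \<bullet> ?p \<bullet> ?b) = Z" using witT_eq[OF p] by blast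
    moreover have "cl witT \<bullet> ?p \<bullet> ?b \<in> N" using p by simp
    ultimately have "h \<bullet> (con (cst.Ent Nat) \<bullet> (F \<bullet> h) \<bullet> (cl witT \<bullet> ?p \<bullet> ?b)) = Z" using p_eq by metis
    then show ?thesis using F h by (simp add: muT_def cl_lam)
  qed
  with F show ?thesis by blast
qed

text \<open>The standard choice operator is reliable only at standard positions. For a standard
  game, transfer of the check function extends correctness to all positions, and so the strategy
  also copes with nonstandard opponents.\<close>

lemma ex_standard_strategies:
  "\<exists>F \<in> dom (ty1 \<rightarrow> ty1). st F \<and> (\<forall>f \<in> dom ty1. st f \<longrightarrow> good f (F \<bullet> f))"
proof -
  obtain M where M: "M \<in> dom (ty1 \<rightarrow> Star Nat)" "st M"
    and mu: "\<And>h. h \<in> dom ty1 \<Longrightarrow> st h \<Longrightarrow> \<exists>x \<in> N. h \<bullet> x = Z \<Longrightarrow> h \<bullet> (cl muT \<bullet> M \<bullet> h) = Z"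
    using ex_standard_mu by blast
  let ?F = "cl stratT \<bullet> M"
  have F: "?F \<in> dom (ty1 \<rightarrow> ty1)" "st ?F" using M by (simp_all add: st_ap)
  have "good f (?F \<bullet> f)" if f: "f \<in> dom ty1" "st f" for f
  proof (rule good_strategy[OF f(1)])
    let ?S = "?F \<bullet> f"
    show S: "?S \<in> dom ty1" using F f by simp
    have stS: "st ?S" using F f by (simp add: st_ap)
    have sel_dom: "cl selT \<bullet> f \<bullet> s \<in> dom ty1" if "s \<in> N" for s using that f by simp
    have S_eq: "?S \<bullet> s = cl muT \<bullet> M \<bullet> (cl selT \<bullet> f \<bullet> s)" if "s \<in> N" for s
      using that f M by (simp add: stratT_def cl_lam)
    let ?c = "cl chkT \<bullet> ?S \<bullet> f"
    have c: "?c \<in> dom ty1" "st ?c" using S stS f by (simp_all add: st_ap)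
    have c_eq: "?c \<bullet> s = Z \<longleftrightarrow> (\<exists>n \<in> N. cl selT \<bullet> f \<bullet> s \<bullet> n = Z) \<and> cl selT \<bullet> f \<bullet> s \<bullet> (?S \<bullet> s) \<noteq> Z" if s: "s \<in> N" for s
    proof -
      have "?c \<bullet> s = Z \<longleftrightarrow> X\<^sub>0 (cl liftT \<bullet> (cl selT \<bullet> f \<bullet> s)) \<noteq> Z \<and> cl selT \<bullet> f \<bullet> s \<bullet> (?S \<bullet> s) \<noteq> Z"
        using s f S by (simp add: chkT_def cl_lam)
      then show ?thesis unfolding Xi_lift[OF sel_dom[OF s]] by blast
    qed
    have "?c \<bullet> s \<noteq> Z" if s: "s \<in> N" for s
    proof (rule Pi01_transfer[OF c _ s])
      fix s assume s: "s \<in> N" "st s"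
      have "st (cl selT \<bullet> f \<bullet> s)" using s f by (simp add: st_ap)
      with mu[OF sel_dom[OF s(1)]] show "?c \<bullet> s \<noteq> Z" unfolding c_eq[OF s(1)] S_eq[OF s(1)] by blast
    qed
    then show "cl selT \<bullet> f \<bullet> s \<bullet> (?S \<bullet> s) = Z" if "s \<in> N" "\<exists>n \<in> N. cl selT \<bullet> f \<bullet> s \<bullet> n = Z" for s
      using that c_eq by blast
  qed
  with F show ?thesis by blast
qed

lemma DETstar: "sat e DETstar"
  unfolding sat_DETstar
proof (intro ballI impI)
  obtain F where F: "F \<in> dom (ty1 \<rightarrow> ty1)" "st F" "\<And>f. f \<in> dom ty1 \<Longrightarrow> st f \<Longrightarrow> good f (F \<bullet> f)"
    using ex_standard_strategies by blast
  fix f assume f: "f \<in> dom ty1" "st f"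
  have "F \<bullet> f \<in> dom ty1" "st (F \<bullet> f)" using F(1,2) f by (simp_all add: st_ap)
  with F(3)[OF f] show "\<exists>S \<in> dom ty1. st S \<and> good f S" by blast
qed

text \<open>One functional serves as both components, since a good strategy wins for one of the
  players. Against a standard opponent the winning stage can be taken to be standard, by transfer
  along the positions of the play.\<close>

lemma UDET: "sat e (rel UDET)"
  unfolding sat_UDET
proof -
  obtain F where F: "F \<in> dom (ty1 \<rightarrow> ty1)" "st F" "\<And>f. f \<in> dom ty1 \<Longrightarrow> st f \<Longrightarrow> good f (F \<bullet> f)"
    using ex_standard_strategies by blast
  have sWin: "sWin (F \<bullet> f) S f" if f: "f \<in> dom ty1" "st f" and S: "S \<in> dom ty1" "st S" and W: "Win (F \<bullet> f) S f" for f S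
  proof (rule ccontr)
    assume no: "\<not> sWin (F \<bullet> f) S f"
    have Ff: "F \<bullet> f \<in> dom ty1" "st (F \<bullet> f)" using F(1,2) f by (simp_all add: st_ap)
    let ?h = "cl posfT \<bullet> f \<bullet> (F \<bullet> f) \<bullet> S"
    have h: "?h \<in> dom ty1" "st ?h" using f Ff S by (simp_all add: st_ap)
    have h_eq: "?h \<bullet> k = f \<bullet> Pos (F \<bullet> f) S k" if "k \<in> N" for k
      using that f Ff S by (simp add: posfT_def cl_lam)
    have "?h \<bullet> k \<noteq> Z" if "k \<in> N" for k
      using no unfolding sWin_def by (intro Pi01_transfer[OF h _ that]) (use h_eq in metis)
    with W h_eq show False unfolding Win_def by metis
  qed
  have "(\<forall>S \<in> dom ty1. st S \<longrightarrow> sWin (F \<bullet> f) S f) \<or> (\<forall>S \<in> dom ty1. st S \<longrightarrow> \<not> sWin S (F \<bullet> f) f)"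
    if f: "f \<in> dom ty1" "st f" for f
    using F(3)[OF f] unfolding good_def
  proof
    assume "\<forall>S \<in> dom ty1. Win (F \<bullet> f) S f"
    then show ?thesis using sWin[OF f] by blast
  next
    assume "\<forall>S \<in> dom ty1. \<not> Win S (F \<bullet> f) f"
    then have "\<forall>S \<in> dom ty1. st S \<longrightarrow> \<not> sWin S (F \<bullet> f) f" unfolding Win_def sWin_def by blast
    then show ?thesis ..
  qed
  with F(1,2) show "\<exists>F \<in> dom (ty1 \<rightarrow> ty1). st F \<and> (\<exists>G \<in> dom (ty1 \<rightarrow> ty1). st G \<and>
    (\<forall>f \<in> dom ty1. st f \<longrightarrow> (\<forall>S \<in> dom ty1. st S \<longrightarrow> sWin (F \<bullet> f) S f) \<or> (\<forall>S \<in> dom ty1. st S \<longrightarrow> \<not> sWin S (G \<bullet> f) f)))"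
    by blast
qed

end

lemma (in omega_model) equivalences:
  assumes "\<D> (i, ty2) = Some Suslin_spec"
  shows "sat e DETstar \<longleftrightarrow> sat e (rel UDET)" "sat e (rel UDET) \<longleftrightarrow> sat e (rel S2)"
proof -
  have "sat e DETstar \<and> sat e (rel UDET)" if "sat e (rel S2)"
  proof -
    have "sat e' (rel S2)" for e' using that unfolding sat_S2 .
    with assms interpret suslin_model U T ap con st \<D> Ax i by unfold_locales
    show ?thesis using DETstar UDET by blast
  qed
  then show "sat e DETstar \<longleftrightarrow> sat e (rel UDET)" "sat e (rel UDET) \<longleftrightarrow> sat e (rel S2)"
    using UDET_imp_S2 DETstar_imp_S2 by blast+
qed

lemma wf_principles: "wf_fm \<D> [] DETstar" "wf_fm \<D> [] (rel UDET)" "wf_fm \<D> [] (rel S2)"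
  by (simp_all add: DETstar_def UDET_def S2_def has_path_def win_def wt_def)

theorem theorem7p8:
  fixes \<D> :: specs and i :: nat
  assumes "admissible \<D>"
    and "\<D> (i, ty2) = Some Suslin_spec"
  shows "proves \<D> (\<lambda>\<Gamma>. insert STP (RCAOmega \<D> \<Gamma>)) (DETstar \<^bold>\<longleftrightarrow> rel UDET)
    \<and> proves \<D> (\<lambda>\<Gamma>. insert STP (RCAOmega \<D> \<Gamma>)) (rel UDET \<^bold>\<longleftrightarrow> rel S2)"
proof -
  let ?Ax = "\<lambda>\<Gamma>. insert STP (RCAOmega \<D> \<Gamma>)"
  have "fm_structure.sat U T ap con st e (DETstar \<^bold>\<longleftrightarrow> rel UDET) \<and>
      fm_structure.sat U T ap con st e (rel UDET \<^bold>\<longleftrightarrow> rel S2)"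
    if "ext_model U T ap con st \<D> ?Ax" for U :: "tm set" and T ap con st e
  proof -
    interpret ext_model U T ap con st \<D> ?Ax by (rule that)
    interpret omega_model U T ap con st \<D> ?Ax by unfold_locales auto
    show ?thesis using equivalences[OF assms(2), of e] by simp
  qed
  then show ?thesis
    by (intro conjI completeness) (auto simp: wf_principles)
qed


end
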